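(* Let $H$ be a Hopf algebra over $\mathbb{K}$ with coproduct $\Delta$, counit $\varepsilon$, antipode $S$ and unit $1_H$. Equip $H\otimes H$ with the smash coalgebra structure $$\Delta_s(a\otimes b)=\sum a_{(1)}\otimes a_{(2)}S(a_{(4)})b_{(1)}\otimes a_{(3)}\otimes b_{(2)},\qquad \varepsilon_s(a\otimes b)=\varepsilon(a)\varepsilon(b).$$ Define linear endomorphisms $P_1$ and $P_2$ of $H\otimes H$ by $$P_1(a\otimes b)=a\otimes\varepsilon(b)1_H,$$ $$P_2(a\otimes b)=\sum S\big(a_{(2)}S(a_{(4)})b_{(2)}\big)a_{(3)}\otimes S\big(a_{(1)}S(a_{(5)})b_{(1)}\big)b_{(3)}.$$ Then $(H\otimes H,\Delta_s,\varepsilon_s,P_1)$ and $(H\otimes H,\Delta_s,\varepsilon_s,P_2)$ are idempotent Rota-Baxter coalgebras of weight $-1$.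
   Context: $\mathbb{K}$ is a fixed ground field of characteristic 0; all vector spaces, algebras, coalgebras and tensor products are over $\mathbb{K}$. Sweedler's notation $\Delta(c)=\sum c_{(1)}\otimes c_{(2)}$ (and its iterates $\sum c_{(1)}\otimes\cdots\otimes c_{(k)}$) is used. The coalgebra $(H\otimes H,\Delta_s,\varepsilon_s)$ is the smash coproduct coming from the left $H$-comodule-coalgebra structure on $H$ given by $\delta(h)=\sum h_{(1)}S(h_{(3)})\otimes h_{(2)}$. In the formula for $\Delta_s$, the first two tensor factors form the first factor in $H\otimes H$ and the last two form the second. A Rota-Baxter coalgebra of weight $\lambda\in\mathbb{K}$ is a (coassociative, counital) coalgebra $(C,\Delta,\varepsilon)$ equipped with a linear operator $P:C\to C$ such that $(P\otimes P)\Delta=(\mathrm{id}\otimes P)\Delta P+(P\otimes\mathrm{id})\Delta P+\lambda\Delta P$. It is called idempotent if $P^2=P$. *)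

theory Defs
  imports "HOL-Algebra.Module" "HOL-Algebra.AbelCoset"
begin

section \<open>Linear maps and tensor products over a field\<close>

text \<open>
  A vector space over \<open>K\<close> is a \<open>module K V\<close> with \<open>field K\<close>. The fields \<open>mult\<close> and \<open>one\<close> of the
  record \<open>V\<close> are only meaningful when \<open>V\<close> is an algebra.
\<close>

definition linear_map ::
  "('k, 'm) ring_scheme \<Rightarrow> ('k, 'a, 'x) module_scheme \<Rightarrow> ('k, 'b, 'y) module_scheme \<Rightarrow> ('a \<Rightarrow> 'b) \<Rightarrow> bool"
  where "linear_map K V W f \<longleftrightarrow>
    f \<in> carrier V \<rightarrow> carrier W \<and>
    (\<forall>x\<in>carrier V. \<forall>y\<in>carrier V. f (x \<oplus>\<^bsub>V\<^esub> y) = f x \<oplus>\<^bsub>W\<^esub> f y) \<and>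
    (\<forall>c\<in>carrier K. \<forall>x\<in>carrier V. f (c \<odot>\<^bsub>V\<^esub> x) = c \<odot>\<^bsub>W\<^esub> f x)"

definition bilinear_map ::
  "('k, 'm) ring_scheme \<Rightarrow> ('k, 'a, 'x) module_scheme \<Rightarrow> ('k, 'b, 'y) module_scheme \<Rightarrow>
   ('k, 'c, 'z) module_scheme \<Rightarrow> ('a \<Rightarrow> 'b \<Rightarrow> 'c) \<Rightarrow> bool"
  where "bilinear_map K V W U f \<longleftrightarrow>
    (\<forall>a\<in>carrier V. linear_map K W U (f a)) \<and>
    (\<forall>b\<in>carrier W. linear_map K V U (\<lambda>a. f a b))"

definition ground_module :: "('k, 'm) ring_scheme \<Rightarrow> ('k, 'k) module"
  where "ground_module K =
    \<lparr>carrier = carrier K, mult = mult K, one = one K, zero = zero K, add = add K, smult = mult K\<rparr>"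

definition free_module :: "('k, 'm) ring_scheme \<Rightarrow> 'i set \<Rightarrow> ('k, 'i \<Rightarrow> 'k) module"
  where "free_module K I =
    \<lparr>carrier = {u. (\<forall>i. u i \<in> carrier K) \<and> finite {i. u i \<noteq> \<zero>\<^bsub>K\<^esub>} \<and> {i. u i \<noteq> \<zero>\<^bsub>K\<^esub>} \<subseteq> I},
     mult = undefined, one = undefined,
     zero = (\<lambda>i. \<zero>\<^bsub>K\<^esub>),
     add = (\<lambda>u v i. u i \<oplus>\<^bsub>K\<^esub> v i),
     smult = (\<lambda>c u i. c \<otimes>\<^bsub>K\<^esub> u i)\<rparr>"

definition free_gen :: "('k, 'm) ring_scheme \<Rightarrow> 'i \<Rightarrow> 'i \<Rightarrow> 'k"
  where "free_gen K i = (\<lambda>j. if j = i then \<one>\<^bsub>K\<^esub> else \<zero>\<^bsub>K\<^esub>)"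

definition generated_submodule ::
  "('k, 'm) ring_scheme \<Rightarrow> ('k, 'a, 'x) module_scheme \<Rightarrow> 'a set \<Rightarrow> 'a set"
  where "generated_submodule K M A = \<Inter>{N. submodule N K M \<and> A \<subseteq> N}"

definition quotient_module ::
  "('k, 'a, 'x) module_scheme \<Rightarrow> 'a set \<Rightarrow> ('k, 'a set) module"
  where "quotient_module M N =
    \<lparr>carrier = a_rcosets\<^bsub>M\<^esub> N,
     mult = undefined, one = undefined,
     zero = N,
     add = set_add M,
     smult = (\<lambda>c X. \<Union>x\<in>X. N +>\<^bsub>M\<^esub> (c \<odot>\<^bsub>M\<^esub> x))\<rparr>"

definition tensor_relations ::
  "('k, 'm) ring_scheme \<Rightarrow> ('k, 'a, 'x) module_scheme \<Rightarrow> ('k, 'b, 'y) module_scheme \<Rightarrow> ('a \<times> 'b \<Rightarrow> 'k) set"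
  where "tensor_relations K V W =
    (let F = free_module K (carrier V \<times> carrier W); e = (\<lambda>a b. free_gen K (a, b)) in
      {e (a \<oplus>\<^bsub>V\<^esub> a') b \<ominus>\<^bsub>F\<^esub> (e a b \<oplus>\<^bsub>F\<^esub> e a' b) | a a' b.
         a \<in> carrier V \<and> a' \<in> carrier V \<and> b \<in> carrier W} \<union>
      {e a (b \<oplus>\<^bsub>W\<^esub> b') \<ominus>\<^bsub>F\<^esub> (e a b \<oplus>\<^bsub>F\<^esub> e a b') | a b b'.
         a \<in> carrier V \<and> b \<in> carrier W \<and> b' \<in> carrier W} \<union>
      {e (c \<odot>\<^bsub>V\<^esub> a) b \<ominus>\<^bsub>F\<^esub> c \<odot>\<^bsub>F\<^esub> e a b | c a b.
         c \<in> carrier K \<and> a \<in> carrier V \<and> b \<in> carrier W} \<union>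
      {e a (c \<odot>\<^bsub>W\<^esub> b) \<ominus>\<^bsub>F\<^esub> c \<odot>\<^bsub>F\<^esub> e a b | c a b.
         c \<in> carrier K \<and> a \<in> carrier V \<and> b \<in> carrier W})"

definition tensor_kernel ::
  "('k, 'm) ring_scheme \<Rightarrow> ('k, 'a, 'x) module_scheme \<Rightarrow> ('k, 'b, 'y) module_scheme \<Rightarrow> ('a \<times> 'b \<Rightarrow> 'k) set"
  where "tensor_kernel K V W =
    generated_submodule K (free_module K (carrier V \<times> carrier W)) (tensor_relations K V W)"

definition tensor ::
  "('k, 'm) ring_scheme \<Rightarrow> ('k, 'a, 'x) module_scheme \<Rightarrow> ('k, 'b, 'y) module_scheme \<Rightarrow>
   ('k, ('a \<times> 'b \<Rightarrow> 'k) set) module"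
  where "tensor K V W =
    quotient_module (free_module K (carrier V \<times> carrier W)) (tensor_kernel K V W)"

definition pure_tensor ::
  "('k, 'm) ring_scheme \<Rightarrow> ('k, 'a, 'x) module_scheme \<Rightarrow> ('k, 'b, 'y) module_scheme \<Rightarrow>
   'a \<Rightarrow> 'b \<Rightarrow> ('a \<times> 'b \<Rightarrow> 'k) set"
  where "pure_tensor K V W a b =
    tensor_kernel K V W +>\<^bsub>free_module K (carrier V \<times> carrier W)\<^esub> free_gen K (a, b)"

text \<open>
  The linear map out of a tensor product that is induced by a bilinear map \<open>f\<close> into \<open>U\<close>,
  computed on a representative \<open>u\<close> of the coset \<open>t\<close>. For bilinear \<open>f\<close> the choice of the
  representative is immaterial; for other \<open>f\<close> the value is meaningless.
\<close>

definition tensor_lift ::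
  "('k, 'm) ring_scheme \<Rightarrow> ('k, 'c, 'z) module_scheme \<Rightarrow> ('a \<Rightarrow> 'b \<Rightarrow> 'c) \<Rightarrow> ('a \<times> 'b \<Rightarrow> 'k) set \<Rightarrow> 'c"
  where "tensor_lift K U f t =
    (let u = (SOME u. u \<in> t) in
      \<Oplus>\<^bsub>U\<^esub>p\<in>{p. u p \<noteq> \<zero>\<^bsub>K\<^esub>}. u p \<odot>\<^bsub>U\<^esub> f (fst p) (snd p))"

text \<open>\<open>tensor_map K V W f g\<close> is \<open>f \<otimes> g\<close>, where \<open>V\<close> and \<open>W\<close> are the codomains of \<open>f\<close> and \<open>g\<close>.\<close>

definition tensor_map ::
  "('k, 'm) ring_scheme \<Rightarrow> ('k, 'c, 'x) module_scheme \<Rightarrow> ('k, 'd, 'y) module_scheme \<Rightarrow>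
   ('a \<Rightarrow> 'c) \<Rightarrow> ('b \<Rightarrow> 'd) \<Rightarrow> ('a \<times> 'b \<Rightarrow> 'k) set \<Rightarrow> ('c \<times> 'd \<Rightarrow> 'k) set"
  where "tensor_map K V W f g =
    tensor_lift K (tensor K V W) (\<lambda>a b. pure_tensor K V W (f a) (g b))"

text \<open>The canonical map \<open>(U \<otimes> V) \<otimes> W \<rightarrow> U \<otimes> (V \<otimes> W)\<close>.\<close>

definition tensor_assoc ::
  "('k, 'm) ring_scheme \<Rightarrow> ('k, 'a, 'x) module_scheme \<Rightarrow> ('k, 'b, 'y) module_scheme \<Rightarrow>
   ('k, 'c, 'z) module_scheme \<Rightarrow>
   (('a \<times> 'b \<Rightarrow> 'k) set \<times> 'c \<Rightarrow> 'k) set \<Rightarrow> ('a \<times> ('b \<times> 'c \<Rightarrow> 'k) set \<Rightarrow> 'k) set"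
  where "tensor_assoc K U V W =
    (let VW = tensor K V W; T = tensor K U VW in
      tensor_lift K T
        (\<lambda>t w. tensor_lift K T (\<lambda>u v. pure_tensor K U VW u (pure_tensor K V W v w)) t))"


section \<open>Coalgebras and Hopf algebras\<close>

locale coalgebra = K?: field K + C?: module K C
  for K (structure) and C (structure) +
  fixes comult :: "'c \<Rightarrow> ('c \<times> 'c \<Rightarrow> 'k) set" and counit :: "'c \<Rightarrow> 'k"
  assumes comult_linear: "linear_map K C (tensor K C C) comult"
    and counit_linear: "linear_map K C (ground_module K) counit"
    and coassoc: "c \<in> carrier C \<Longrightarrow>
      tensor_assoc K C C C (tensor_map K (tensor K C C) C comult id (comult c)) =
      tensor_map K C (tensor K C C) id comult (comult c)"
    and counit_left: "c \<in> carrier C \<Longrightarrow> tensor_lift K C (\<lambda>x y. counit x \<odot>\<^bsub>C\<^esub> y) (comult c) = c"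
    and counit_right: "c \<in> carrier C \<Longrightarrow> tensor_lift K C (\<lambda>x y. counit y \<odot>\<^bsub>C\<^esub> x) (comult c) = c"

text \<open>
  Sweedler notation: \<open>sweedlerN K W \<Delta> f c\<close> is \<open>\<Sum> f c\<^sub>1 \<dots> c\<^sub>N\<close>, an element of \<open>W\<close>, for an \<open>N\<close>-linear
  map \<open>f\<close> into \<open>W\<close> (\<open>c\<^sub>i\<close> stands for the usual \<open>c\<close> with index \<open>i\<close> in parentheses).
  The iterated coproducts are \<open>(id \<otimes> \<Delta>) \<circ> \<Delta>\<close>, \<open>(id \<otimes> id \<otimes> \<Delta>) \<circ> (id \<otimes> \<Delta>) \<circ> \<Delta>\<close>, and so on.
\<close>

definition sweedler2 ::
  "('k, 'm) ring_scheme \<Rightarrow> ('k, 'w, 'z) module_scheme \<Rightarrow> ('c \<Rightarrow> ('c \<times> 'c \<Rightarrow> 'k) set) \<Rightarrow>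
   ('c \<Rightarrow> 'c \<Rightarrow> 'w) \<Rightarrow> 'c \<Rightarrow> 'w"
  where "sweedler2 K W \<Delta> f c = tensor_lift K W f (\<Delta> c)"

definition sweedler3 ::
  "('k, 'm) ring_scheme \<Rightarrow> ('k, 'w, 'z) module_scheme \<Rightarrow> ('c \<Rightarrow> ('c \<times> 'c \<Rightarrow> 'k) set) \<Rightarrow>
   ('c \<Rightarrow> 'c \<Rightarrow> 'c \<Rightarrow> 'w) \<Rightarrow> 'c \<Rightarrow> 'w"
  where "sweedler3 K W \<Delta> f c = sweedler2 K W \<Delta> (\<lambda>c1. sweedler2 K W \<Delta> (f c1)) c"

definition sweedler4 ::
  "('k, 'm) ring_scheme \<Rightarrow> ('k, 'w, 'z) module_scheme \<Rightarrow> ('c \<Rightarrow> ('c \<times> 'c \<Rightarrow> 'k) set) \<Rightarrow>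
   ('c \<Rightarrow> 'c \<Rightarrow> 'c \<Rightarrow> 'c \<Rightarrow> 'w) \<Rightarrow> 'c \<Rightarrow> 'w"
  where "sweedler4 K W \<Delta> f c = sweedler2 K W \<Delta> (\<lambda>c1. sweedler3 K W \<Delta> (f c1)) c"

definition sweedler5 ::
  "('k, 'm) ring_scheme \<Rightarrow> ('k, 'w, 'z) module_scheme \<Rightarrow> ('c \<Rightarrow> ('c \<times> 'c \<Rightarrow> 'k) set) \<Rightarrow>
   ('c \<Rightarrow> 'c \<Rightarrow> 'c \<Rightarrow> 'c \<Rightarrow> 'c \<Rightarrow> 'w) \<Rightarrow> 'c \<Rightarrow> 'w"
  where "sweedler5 K W \<Delta> f c = sweedler2 K W \<Delta> (\<lambda>c1. sweedler4 K W \<Delta> (f c1)) c"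

locale hopf_algebra = coalgebra K H comult counit + H?: ring H
  for K (structure) and H (structure) and comult :: "'h \<Rightarrow> ('h \<times> 'h \<Rightarrow> 'k) set" and counit +
  fixes antipode :: "'h \<Rightarrow> 'h"
  assumes smult_mult_left: "\<lbrakk>c \<in> carrier K; x \<in> carrier H; y \<in> carrier H\<rbrakk> \<Longrightarrow>
      (c \<odot>\<^bsub>H\<^esub> x) \<otimes>\<^bsub>H\<^esub> y = c \<odot>\<^bsub>H\<^esub> (x \<otimes>\<^bsub>H\<^esub> y)"
    and smult_mult_right: "\<lbrakk>c \<in> carrier K; x \<in> carrier H; y \<in> carrier H\<rbrakk> \<Longrightarrow>
      x \<otimes>\<^bsub>H\<^esub> (c \<odot>\<^bsub>H\<^esub> y) = c \<odot>\<^bsub>H\<^esub> (x \<otimes>\<^bsub>H\<^esub> y)"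
    and comult_mult: "\<lbrakk>x \<in> carrier H; y \<in> carrier H\<rbrakk> \<Longrightarrow>
      comult (x \<otimes>\<^bsub>H\<^esub> y) =
        sweedler2 K (tensor K H H) comult (\<lambda>x1 x2.
          sweedler2 K (tensor K H H) comult (\<lambda>y1 y2.
            pure_tensor K H H (x1 \<otimes>\<^bsub>H\<^esub> y1) (x2 \<otimes>\<^bsub>H\<^esub> y2)) y) x"
    and comult_one: "comult \<one>\<^bsub>H\<^esub> = pure_tensor K H H \<one>\<^bsub>H\<^esub> \<one>\<^bsub>H\<^esub>"
    and counit_mult: "\<lbrakk>x \<in> carrier H; y \<in> carrier H\<rbrakk> \<Longrightarrow>
      counit (x \<otimes>\<^bsub>H\<^esub> y) = counit x \<otimes>\<^bsub>K\<^esub> counit y"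
    and counit_one: "counit \<one>\<^bsub>H\<^esub> = \<one>\<^bsub>K\<^esub>"
    and antipode_linear: "linear_map K H H antipode"
    and antipode_left: "h \<in> carrier H \<Longrightarrow>
      sweedler2 K H comult (\<lambda>h1 h2. antipode h1 \<otimes>\<^bsub>H\<^esub> h2) h = counit h \<odot>\<^bsub>H\<^esub> \<one>\<^bsub>H\<^esub>"
    and antipode_right: "h \<in> carrier H \<Longrightarrow>
      sweedler2 K H comult (\<lambda>h1 h2. h1 \<otimes>\<^bsub>H\<^esub> antipode h2) h = counit h \<odot>\<^bsub>H\<^esub> \<one>\<^bsub>H\<^esub>"


section \<open>Rota-Baxter coalgebras\<close>

locale rota_baxter_coalgebra = coalgebra K C comult counit
  for K (structure) and C (structure) and comult :: "'c \<Rightarrow> ('c \<times> 'c \<Rightarrow> 'k) set" and counit +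
  fixes P :: "'c \<Rightarrow> 'c" and weight :: 'k
  assumes weight_closed: "weight \<in> carrier K"
    and P_linear: "linear_map K C C P"
    and rota_baxter: "c \<in> carrier C \<Longrightarrow>
      tensor_map K C C P P (comult c) =
        tensor_map K C C id P (comult (P c)) \<oplus>\<^bsub>tensor K C C\<^esub>
        tensor_map K C C P id (comult (P c)) \<oplus>\<^bsub>tensor K C C\<^esub>
        weight \<odot>\<^bsub>tensor K C C\<^esub> comult (P c)"

locale idempotent_rota_baxter_coalgebra = rota_baxter_coalgebra K C comult counit P weight
  for K (structure) and C (structure) and comult :: "'c \<Rightarrow> ('c \<times> 'c \<Rightarrow> 'k) set"
    and counit and P and weight +
  assumes idempotent: "c \<in> carrier C \<Longrightarrow> P (P c) = P c"


section \<open>The smash coproduct on \<open>H \<otimes> H\<close> and the operators \<open>P\<^sub>1\<close>, \<open>P\<^sub>2\<close>\<close>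

definition smash_comult ::
  "('k, 'm) ring_scheme \<Rightarrow> ('k, 'h, 'n) module_scheme \<Rightarrow> ('h \<Rightarrow> ('h \<times> 'h \<Rightarrow> 'k) set) \<Rightarrow>
   ('h \<Rightarrow> 'h) \<Rightarrow>
   ('h \<times> 'h \<Rightarrow> 'k) set \<Rightarrow> (('h \<times> 'h \<Rightarrow> 'k) set \<times> ('h \<times> 'h \<Rightarrow> 'k) set \<Rightarrow> 'k) set"
  where "smash_comult K H \<Delta> S =
    (let HH = tensor K H H; W = tensor K HH HH in
      tensor_lift K W (\<lambda>a b.
        sweedler4 K W \<Delta> (\<lambda>a1 a2 a3 a4.
          sweedler2 K W \<Delta> (\<lambda>b1 b2.
            pure_tensor K HH HH
              (pure_tensor K H H a1 (a2 \<otimes>\<^bsub>H\<^esub> S a4 \<otimes>\<^bsub>H\<^esub> b1))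
              (pure_tensor K H H a3 b2)) b) a))"

definition smash_counit ::
  "('k, 'm) ring_scheme \<Rightarrow> ('h \<Rightarrow> 'k) \<Rightarrow> ('h \<times> 'h \<Rightarrow> 'k) set \<Rightarrow> 'k"
  where "smash_counit K \<epsilon> = tensor_lift K (ground_module K) (\<lambda>a b. \<epsilon> a \<otimes>\<^bsub>K\<^esub> \<epsilon> b)"

definition P1 ::
  "('k, 'm) ring_scheme \<Rightarrow> ('k, 'h, 'n) module_scheme \<Rightarrow> ('h \<Rightarrow> 'k) \<Rightarrow>
   ('h \<times> 'h \<Rightarrow> 'k) set \<Rightarrow> ('h \<times> 'h \<Rightarrow> 'k) set"
  where "P1 K H \<epsilon> =
    tensor_lift K (tensor K H H) (\<lambda>a b. pure_tensor K H H a (\<epsilon> b \<odot>\<^bsub>H\<^esub> \<one>\<^bsub>H\<^esub>))"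

definition P2 ::
  "('k, 'm) ring_scheme \<Rightarrow> ('k, 'h, 'n) module_scheme \<Rightarrow> ('h \<Rightarrow> ('h \<times> 'h \<Rightarrow> 'k) set) \<Rightarrow>
   ('h \<Rightarrow> 'h) \<Rightarrow> ('h \<times> 'h \<Rightarrow> 'k) set \<Rightarrow> ('h \<times> 'h \<Rightarrow> 'k) set"
  where "P2 K H \<Delta> S =
    (let HH = tensor K H H in
      tensor_lift K HH (\<lambda>a b.
        sweedler5 K HH \<Delta> (\<lambda>a1 a2 a3 a4 a5.
          sweedler3 K HH \<Delta> (\<lambda>b1 b2 b3.
            pure_tensor K H H
              (S (a2 \<otimes>\<^bsub>H\<^esub> S a4 \<otimes>\<^bsub>H\<^esub> b2) \<otimes>\<^bsub>H\<^esub> a3)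
              (S (a1 \<otimes>\<^bsub>H\<^esub> S a5 \<otimes>\<^bsub>H\<^esub> b1) \<otimes>\<^bsub>H\<^esub> b3)) b) a))"

end

theory Submission
  imports Defs
begin

text \<open>
  The map \<open>a \<otimes> b \<mapsto> \<Sum> a\<^sub>1 \<otimes> S(a\<^sub>2) b\<close> is an isomorphism from the smash coalgebra onto the tensor product
  coalgebra \<open>H \<otimes> H\<close>, with inverse \<open>a \<otimes> b \<mapsto> \<Sum> a\<^sub>1 \<otimes> a\<^sub>2 b\<close>. It carries \<open>P\<^sub>1\<close> and \<open>P\<^sub>2\<close> to
  \<open>a \<otimes> b \<mapsto> \<epsilon>(b) \<Sum> a\<^sub>1 \<otimes> S(a\<^sub>2)\<close> and \<open>a \<otimes> b \<mapsto> \<epsilon>(a) \<Sum> S(b\<^sub>1) \<otimes> b\<^sub>2\<close>. Each of these is \<open>j \<circ> f\<close>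
  for a coalgebra map \<open>f : H \<otimes> H \<rightarrow> H\<close> (one of the two projections) and a linear section \<open>j\<close> of \<open>f\<close>,
  and one of \<open>id \<otimes> jf\<close>, \<open>jf \<otimes> id\<close> fixes \<open>\<Delta> j\<close> while the other one maps it to \<open>(j \<otimes> j) \<Delta>\<close>.
  The Rota-Baxter identity of weight \<open>-1\<close> is then the tautology
  \<open>(j \<otimes> j) \<Delta> f = \<Delta> j f + (j \<otimes> j) \<Delta> f - \<Delta> j f\<close>.
\<close>

section \<open>Linear maps and tensor products\<close>

text \<open>The isomorphism exists because the coaction multiplies by legs of the same element: in
  the smash formula \<open>S(a4)\<close> is multiplied in by the map itself and \<open>a2\<close> by
  its inverse, so the twist is a change of coordinates. Coassociativity of the smash coproduct is
  then inherited rather than computed, and the five legs in \<open>P2\<close> reduce to the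
  coordinate \<open>S(a) b\<close>. Since \<open>S\<close> reverses coproducts,
  \<open>\<Delta> j\<close> has an outer pair of legs \<open>c1\<close>, \<open>c4\<close> in one
  factor and an inner pair \<open>c2\<close>, \<open>c3\<close> in the other. The inner pair is
  again a value of \<open>j\<close>, so \<open>j f\<close> fixes it; on the outer pair
  \<open>f\<close> kills the leg under \<open>S\<close> and leaves \<open>j\<close> of the other
  one. This gives the two terms \<open>\<Delta> j\<close> and
  \<open>(j \<otimes> j) \<Delta>\<close>. The obstacle is that tensors are cosets and a lift is
  evaluated at a chosen representative. Congruence and outer linear maps tolerate this for any
  integrand, but coassociativity, counit laws and changes of coordinates need an integrand that is
  linear in each leg. Most side conditions are therefore linearity statements, left to
  simplification rules.\<close>

lemma foldSetD_cong:
  "\<lbrakk>(A, x) \<in> foldSetD D f e; \<And>a. a \<in> A \<Longrightarrow> f a = g a\<rbrakk> \<Longrightarrow> (A, x) \<in> foldSetD D g e"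
  by (induction A x rule: foldSetD.induct) (auto intro: foldSetD.intros)

text \<open>Unlike \<open>finsum_cong'\<close>, this needs no closure condition: both sides are the same fold.\<close>

lemma finsum_cong_on:
  assumes "\<And>i. i \<in> A \<Longrightarrow> f i = g i"
  shows "finsum G f A = finsum G g A"
proof -
  have "(A, x) \<in> foldSetD (carrier G) (add G \<circ> f) e \<longleftrightarrow> (A, x) \<in> foldSetD (carrier G) (add G \<circ> g) e" for x e
    using assms by (intro iffI; elim foldSetD_cong) simp_all
  then show ?thesis by (simp add: finsum_def finprod_def foldD_def)
qed

section \<open>Linear maps between modules\<close>

lemma linear_mapI:
  assumes "\<And>x. x \<in> carrier V \<Longrightarrow> f x \<in> carrier W"
    and "\<And>x y. \<lbrakk>x \<in> carrier V; y \<in> carrier V\<rbrakk> \<Longrightarrow> f (x \<oplus>\<^bsub>V\<^esub> y) = f x \<oplus>\<^bsub>W\<^esub> f y"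
    and "\<And>c x. \<lbrakk>c \<in> carrier K; x \<in> carrier V\<rbrakk> \<Longrightarrow> f (c \<odot>\<^bsub>V\<^esub> x) = c \<odot>\<^bsub>W\<^esub> f x"
  shows "linear_map K V W f"
  using assms by (auto simp: linear_map_def)

lemma linear_map_closed: "\<lbrakk>linear_map K V W f; x \<in> carrier V\<rbrakk> \<Longrightarrow> f x \<in> carrier W"
  and linear_map_add: "\<lbrakk>linear_map K V W f; x \<in> carrier V; y \<in> carrier V\<rbrakk> \<Longrightarrow>
    f (x \<oplus>\<^bsub>V\<^esub> y) = f x \<oplus>\<^bsub>W\<^esub> f y"
  and linear_map_smult: "\<lbrakk>linear_map K V W f; c \<in> carrier K; x \<in> carrier V\<rbrakk> \<Longrightarrow>
    f (c \<odot>\<^bsub>V\<^esub> x) = c \<odot>\<^bsub>W\<^esub> f x"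
  by (auto simp: linear_map_def)

lemma linear_map_comp:
  "\<lbrakk>linear_map K V W f; linear_map K U V g\<rbrakk> \<Longrightarrow> linear_map K U W (\<lambda>x. f (g x))"
  by (simp add: linear_map_def Pi_iff)

lemma linear_map_ident [simp]: "linear_map K V V (\<lambda>x. x)"
  by (simp add: linear_map_def)

lemma linear_map_cong:
  assumes "module K V" "\<And>x. x \<in> carrier V \<Longrightarrow> f x = g x"
  shows "linear_map K V W f \<longleftrightarrow> linear_map K V W g"
proof -
  interpret module K V by fact
  show ?thesis using assms(2) by (simp add: linear_map_def Pi_iff)
qed

lemma linear_map_zero:
  assumes "module K V" "module K W" "linear_map K V W f"
  shows "f \<zero>\<^bsub>V\<^esub> = \<zero>\<^bsub>W\<^esub>"
proof -
  interpret V: module K V by fact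
  interpret W: module K W by fact
  have "f \<zero>\<^bsub>V\<^esub> = f (\<zero>\<^bsub>K\<^esub> \<odot>\<^bsub>V\<^esub> \<zero>\<^bsub>V\<^esub>)" by simp
  also have "\<dots> = \<zero>\<^bsub>K\<^esub> \<odot>\<^bsub>W\<^esub> f \<zero>\<^bsub>V\<^esub>"
    using assms(3) by (blast intro: linear_map_smult)
  finally show ?thesis using linear_map_closed[OF assms(3)] by simp
qed

lemma linear_map_minus:
  assumes "module K V" "module K W" "linear_map K V W f" "x \<in> carrier V"
  shows "f (\<ominus>\<^bsub>V\<^esub> x) = \<ominus>\<^bsub>W\<^esub> f x"
proof -
  interpret V: module K V by fact
  interpret W: module K W by fact
  have "f (\<ominus>\<^bsub>V\<^esub> x) = f ((\<ominus>\<^bsub>K\<^esub> \<one>\<^bsub>K\<^esub>) \<odot>\<^bsub>V\<^esub> x)"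
    using assms(4) by (simp add: V.smult_l_minus)
  also have "\<dots> = (\<ominus>\<^bsub>K\<^esub> \<one>\<^bsub>K\<^esub>) \<odot>\<^bsub>W\<^esub> f x"
    using assms by (intro linear_map_smult[of K V W]) auto
  finally show ?thesis using linear_map_closed[OF assms(3,4)] by (simp add: W.smult_l_minus)
qed

lemma linear_map_finsum:
  assumes "module K V" "module K W" "linear_map K V W f" "finite A" "g \<in> A \<rightarrow> carrier V"
  shows "f (\<Oplus>\<^bsub>V\<^esub>i\<in>A. g i) = (\<Oplus>\<^bsub>W\<^esub>i\<in>A. f (g i))"
proof -
  interpret V: module K V by fact
  interpret W: module K W by fact
  show ?thesis using assms(4,5)
    by induction (auto simp: linear_map_zero[OF assms(1-3)] Pi_iff
        linear_map_add[OF assms(3)] linear_map_closed[OF assms(3)])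
qed

section \<open>The ground field and free modules as modules, and linear maps out of free
  modules\<close>

lemma module_ground: "cring K \<Longrightarrow> module K (ground_module K)"
proof -
  assume "cring K"
  then interpret cring K .
  show ?thesis
  proof (rule moduleI; (rule abelian_groupI)?)
    show "cring K" by fact
  next
    fix x assume "x \<in> carrier (ground_module K)"
    then show "\<exists>y\<in>carrier (ground_module K). y \<oplus>\<^bsub>ground_module K\<^esub> x = \<zero>\<^bsub>ground_module K\<^esub>"
      by (intro bexI[of _ "\<ominus>\<^bsub>K\<^esub> x"]) (simp_all add: ground_module_def l_neg)
  qed (simp_all add: ground_module_def a_ac m_ac l_distr r_distr)
qed

lemma module_free: "cring K \<Longrightarrow> module K (free_module K I)"
proof -
  assume "cring K"
  then interpret cring K .
  let ?S = "\<lambda>u. {i. u i \<noteq> \<zero>\<^bsub>K\<^esub>}"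
  \<comment> \<open>One support estimate for all operations: a pointwise operation that sends zeros
    to zero keeps the support inside the union of the supports. Unary operations use it with
    \<open>v = u\<close>.\<close>
  have fin: "finite (?S w) \<and> ?S w \<subseteq> I"
    if "finite (?S u)" "?S u \<subseteq> I" "finite (?S v)" "?S v \<subseteq> I" "\<And>i. u i = \<zero>\<^bsub>K\<^esub> \<Longrightarrow> v i = \<zero>\<^bsub>K\<^esub> \<Longrightarrow> w i = \<zero>\<^bsub>K\<^esub>"
    for u v w
  proof -
    have "?S w \<subseteq> ?S u \<union> ?S v" using that(5) by blast
    then show ?thesis using that(1-4) by (meson finite_UnI finite_subset le_sup_iff subset_trans)
  qed
  show ?thesis
  proof (rule moduleI; (rule abelian_groupI)?)
    show "cring K" by fact
  next
    fix u v assume "u \<in> carrier (free_module K I)" "v \<in> carrier (free_module K I)"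
    then show "u \<oplus>\<^bsub>free_module K I\<^esub> v \<in> carrier (free_module K I)"
      using fin[of u v "\<lambda>i. u i \<oplus>\<^bsub>K\<^esub> v i"] by (simp add: free_module_def)
  next
    fix c u assume "c \<in> carrier K" "u \<in> carrier (free_module K I)"
    then show "c \<odot>\<^bsub>free_module K I\<^esub> u \<in> carrier (free_module K I)"
      using fin[of u u "\<lambda>i. c \<otimes>\<^bsub>K\<^esub> u i"] by (simp add: free_module_def)
  next
    fix u assume u: "u \<in> carrier (free_module K I)"
    then have "(\<lambda>i. \<ominus>\<^bsub>K\<^esub> u i) \<in> carrier (free_module K I)"
      using fin[of u u "\<lambda>i. \<ominus>\<^bsub>K\<^esub> u i"] by (simp add: free_module_def)
    then show "\<exists>v\<in>carrier (free_module K I). v \<oplus>\<^bsub>free_module K I\<^esub> u = \<zero>\<^bsub>free_module K I\<^esub>"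
      by (rule rev_bexI) (use u in \<open>simp add: free_module_def l_neg\<close>)
  qed (auto simp: free_module_def a_ac m_ac l_distr r_distr)
qed

lemma free_gen_closed: "cring K \<Longrightarrow> i \<in> I \<Longrightarrow> free_gen K i \<in> carrier (free_module K I)"
proof -
  assume "cring K" and i: "i \<in> I"
  then interpret cring K by simp
  have "{j. free_gen K i j \<noteq> \<zero>\<^bsub>K\<^esub>} \<subseteq> {i}" by (auto simp: free_gen_def)
  then have "finite {j. free_gen K i j \<noteq> \<zero>\<^bsub>K\<^esub>} \<and> {j. free_gen K i j \<noteq> \<zero>\<^bsub>K\<^esub>} \<subseteq> I"
    using i finite_subset by blast
  then show ?thesis by (simp add: free_module_def free_gen_def)
qed

text \<open>Supports are finite, so the induction runs over a finite index set containing the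
  support and peels off one index at a time as a multiple of a generator.\<close>

lemma free_module_induct [consumes 2, case_names zero add smult gen]:
  assumes "cring K" "u \<in> carrier (free_module K I)"
    and zero: "P \<zero>\<^bsub>free_module K I\<^esub>"
    and add: "\<And>u v. \<lbrakk>u \<in> carrier (free_module K I); v \<in> carrier (free_module K I); P u; P v\<rbrakk> \<Longrightarrow>
      P (u \<oplus>\<^bsub>free_module K I\<^esub> v)"
    and smult: "\<And>c u. \<lbrakk>c \<in> carrier K; u \<in> carrier (free_module K I); P u\<rbrakk> \<Longrightarrow>
      P (c \<odot>\<^bsub>free_module K I\<^esub> u)"
    and gen: "\<And>i. i \<in> I \<Longrightarrow> P (free_gen K i)"
  shows "P u"
proof -
  interpret cring K by fact
  interpret F: module K "free_module K I" using assms(1) by (rule module_free)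
  have "\<forall>u\<in>carrier (free_module K I). {i. u i \<noteq> \<zero>\<^bsub>K\<^esub>} \<subseteq> A \<longrightarrow> P u" if "finite A" "A \<subseteq> I" for A
    using that
  proof (induction A)
    case empty
    then show ?case using zero by (auto simp: free_module_def)
  next
    case (insert i A)
    show ?case
    proof (intro ballI impI)
      fix u assume u: "u \<in> carrier (free_module K I)" "{i. u i \<noteq> \<zero>\<^bsub>K\<^esub>} \<subseteq> insert i A"
      define v where "v = u(i := \<zero>\<^bsub>K\<^esub>)"
      have "{j. v j \<noteq> \<zero>\<^bsub>K\<^esub>} \<subseteq> {j. u j \<noteq> \<zero>\<^bsub>K\<^esub>}" by (auto simp: v_def)
      then have v: "v \<in> carrier (free_module K I)" "{i. v i \<noteq> \<zero>\<^bsub>K\<^esub>} \<subseteq> A"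
        using u by (auto simp: free_module_def v_def intro: finite_subset)
      have ui: "u i \<in> carrier K" using u by (simp add: free_module_def)
      have "u = v \<oplus>\<^bsub>free_module K I\<^esub> u i \<odot>\<^bsub>free_module K I\<^esub> free_gen K i"
        using u(1) by (auto simp: free_module_def v_def free_gen_def fun_eq_iff)
      moreover have "free_gen K i \<in> carrier (free_module K I)"
        using insert.prems assms(1) by (auto intro: free_gen_closed)
      ultimately show "P u"
        using insert v ui by (metis F.smult_closed add gen insert_subset smult)
    qed
  qed
  from this[of "{i. u i \<noteq> \<zero>\<^bsub>K\<^esub>}"] assms(2) show ?thesis by (simp add: free_module_def)
qed

text \<open>The sum from \<open>tensor_lift\<close> with the representative as an explicit argument.
  Linearity can be proved here, before any coset or choice enters.\<close>

definition free_lift ::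
  "('k, 'm) ring_scheme \<Rightarrow> ('k, 'c, 'z) module_scheme \<Rightarrow> ('i \<Rightarrow> 'c) \<Rightarrow> ('i \<Rightarrow> 'k) \<Rightarrow> 'c"
  where "free_lift K U g u = (\<Oplus>\<^bsub>U\<^esub>p\<in>{p. u p \<noteq> \<zero>\<^bsub>K\<^esub>}. u p \<odot>\<^bsub>U\<^esub> g p)"

text \<open>The support of a sum can shrink by cancellation, so free lifts of different elements are
  compared over a common finite index set; the extra terms are zero.\<close>

lemma free_lift_superset:
  assumes "module K U" "u \<in> carrier (free_module K I)" "g \<in> I \<rightarrow> carrier U"
    and "finite A" "A \<subseteq> I" "{p. u p \<noteq> \<zero>\<^bsub>K\<^esub>} \<subseteq> A"
  shows "free_lift K U g u = (\<Oplus>\<^bsub>U\<^esub>p\<in>A. u p \<odot>\<^bsub>U\<^esub> g p)"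
proof -
  interpret module K U by fact
  show ?thesis unfolding free_lift_def
    by (rule M.add.finprod_mono_neutral_cong_left) (use assms in \<open>auto simp: free_module_def Pi_iff\<close>)
qed

lemma free_lift_gen:
  assumes "module K U" "g \<in> I \<rightarrow> carrier U" "i \<in> I"
  shows "free_lift K U g (free_gen K i) = g i"
proof -
  interpret module K U by fact
  have "free_lift K U g (free_gen K i) = (\<Oplus>\<^bsub>U\<^esub>p\<in>{i}. free_gen K i p \<odot>\<^bsub>U\<^esub> g p)"
    using assms by (intro free_lift_superset[where I = I] free_gen_closed R.cring_axioms)
      (auto simp: free_gen_def)
  also have "\<dots> = g i" using assms by (simp add: Pi_iff free_gen_def)
  finally show ?thesis .
qed

lemma linear_map_free_lift:
  assumes "module K U" "g \<in> I \<rightarrow> carrier U"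
  shows "linear_map K (free_module K I) U (free_lift K U g)"
proof -
  interpret module K U by fact
  interpret F: module K "free_module K I" by (rule module_free) (rule R.cring_axioms)
  note sup = free_lift_superset[OF assms(1) _ assms(2)]
  have supp: "finite {p. u p \<noteq> \<zero>\<^bsub>K\<^esub>}" "{p. u p \<noteq> \<zero>\<^bsub>K\<^esub>} \<subseteq> I" "u p \<in> carrier K"
    if "u \<in> carrier (free_module K I)" for u p
    using that by (auto simp: free_module_def)
  show ?thesis
  proof (rule linear_mapI)
    fix u assume u: "u \<in> carrier (free_module K I)"
    show "free_lift K U g u \<in> carrier U"
      unfolding free_lift_def using supp[OF u] assms(2) by (intro M.finsum_closed) (auto simp: Pi_iff)
  next
    fix u v assume u: "u \<in> carrier (free_module K I)" and v: "v \<in> carrier (free_module K I)"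
    define A where "A = {p. u p \<noteq> \<zero>\<^bsub>K\<^esub>} \<union> {p. v p \<noteq> \<zero>\<^bsub>K\<^esub>}"
    have A: "finite A" "A \<subseteq> I" using supp[OF u] supp[OF v] by (auto simp: A_def)
    have gA: "g p \<in> carrier U" if "p \<in> A" for p using that A assms(2) by auto
    have "free_lift K U g (u \<oplus>\<^bsub>free_module K I\<^esub> v) =
        (\<Oplus>\<^bsub>U\<^esub>p\<in>A. (u \<oplus>\<^bsub>free_module K I\<^esub> v) p \<odot>\<^bsub>U\<^esub> g p)"
      using u v by (intro sup F.M.add.m_closed A) (auto simp: A_def free_module_def)
    also have "\<dots> = (\<Oplus>\<^bsub>U\<^esub>p\<in>A. u p \<odot>\<^bsub>U\<^esub> g p \<oplus>\<^bsub>U\<^esub> v p \<odot>\<^bsub>U\<^esub> g p)"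
      using supp[OF u] supp[OF v] gA
      by (intro M.finsum_cong') (auto simp: free_module_def smult_l_distr)
    also have "\<dots> = (\<Oplus>\<^bsub>U\<^esub>p\<in>A. u p \<odot>\<^bsub>U\<^esub> g p) \<oplus>\<^bsub>U\<^esub> (\<Oplus>\<^bsub>U\<^esub>p\<in>A. v p \<odot>\<^bsub>U\<^esub> g p)"
      using supp[OF u] supp[OF v] gA by (intro M.finsum_addf) auto
    also have "\<dots> = free_lift K U g u \<oplus>\<^bsub>U\<^esub> free_lift K U g v"
      using A u v by (simp add: sup[of u A] sup[of v A] A_def)
    finally show "free_lift K U g (u \<oplus>\<^bsub>free_module K I\<^esub> v) = free_lift K U g u \<oplus>\<^bsub>U\<^esub> free_lift K U g v" .
  next
    fix c u assume c: "c \<in> carrier K" and u: "u \<in> carrier (free_module K I)"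
    define A where "A = {p. u p \<noteq> \<zero>\<^bsub>K\<^esub>}"
    have A: "finite A" "A \<subseteq> I" using supp[OF u] by (auto simp: A_def)
    have gA: "g p \<in> carrier U" if "p \<in> A" for p using that A assms(2) by auto
    have "free_lift K U g (c \<odot>\<^bsub>free_module K I\<^esub> u) =
        (\<Oplus>\<^bsub>U\<^esub>p\<in>A. (c \<odot>\<^bsub>free_module K I\<^esub> u) p \<odot>\<^bsub>U\<^esub> g p)"
      using u c by (intro sup F.smult_closed A) (auto simp: A_def free_module_def)
    also have "\<dots> = (\<Oplus>\<^bsub>U\<^esub>p\<in>A. c \<odot>\<^bsub>U\<^esub> (u p \<odot>\<^bsub>U\<^esub> g p))"
      using supp[OF u] gA c by (intro M.finsum_cong') (auto simp: free_module_def smult_assoc1)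
    also have "\<dots> = c \<odot>\<^bsub>U\<^esub> (\<Oplus>\<^bsub>U\<^esub>p\<in>A. u p \<odot>\<^bsub>U\<^esub> g p)"
      using supp[OF u] gA c A by (intro finsum_smult_ldistr[symmetric]) auto
    finally show "free_lift K U g (c \<odot>\<^bsub>free_module K I\<^esub> u) = c \<odot>\<^bsub>U\<^esub> free_lift K U g u"
      by (simp add: free_lift_def A_def)
  qed
qed

section \<open>Submodules, generated submodules and quotient modules\<close>

lemma submodule_kernel:
  assumes "module K V" "module K W" "linear_map K V W f"
  shows "submodule {x \<in> carrier V. f x = \<zero>\<^bsub>W\<^esub>} K V"
proof -
  interpret V: module K V by fact
  interpret W: module K W by fact
  show ?thesis
    by (rule V.submoduleI) (use assms in \<open>auto simp: linear_map_zero linear_map_minus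
        linear_map_add linear_map_smult\<close>)
qed

lemma submodule_generated:
  assumes "module K M" "A \<subseteq> carrier M"
  shows "submodule (generated_submodule K M A) K M"
proof -
  interpret module K M by fact
  have sub: "N \<in> {N. submodule N K M \<and> A \<subseteq> N} \<Longrightarrow> submodule N K M" for N by blast
  show ?thesis unfolding generated_submodule_def
  proof (rule submoduleI)
    show "\<Inter>{N. submodule N K M \<and> A \<subseteq> N} \<subseteq> carrier M"
      using assms(2) carrier_is_submodule by blast
    show "\<zero>\<^bsub>M\<^esub> \<in> \<Inter>{N. submodule N K M \<and> A \<subseteq> N}"
      using subgroup.one_closed[OF submodule.axioms(1)[OF sub]] by simp
  qed (auto intro: submoduleE(3-5)[OF sub])
qed

lemma generated_submodule_superset: "A \<subseteq> generated_submodule K M A"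
  by (auto simp: generated_submodule_def)

lemma generated_submodule_minimal: "submodule N K M \<Longrightarrow> A \<subseteq> N \<Longrightarrow> generated_submodule K M A \<subseteq> N"
  by (auto simp: generated_submodule_def)

context
  fixes K :: "('k, 'm) ring_scheme" and M :: "('k, 'a, 'x) module_scheme" and N
  assumes M: "module K M" and N: "submodule N K M"
begin

interpretation module K M by (rule M)
interpretation N: abelian_subgroup N M
  using submodule.axioms(1)[OF N] M.a_comm_group by (rule abelian_subgroupI2[rotated])

lemma quotient_module_add:
  "\<lbrakk>x \<in> carrier M; y \<in> carrier M\<rbrakk> \<Longrightarrow>
    (N +>\<^bsub>M\<^esub> x) \<oplus>\<^bsub>quotient_module M N\<^esub> (N +>\<^bsub>M\<^esub> y) = N +>\<^bsub>M\<^esub> (x \<oplus>\<^bsub>M\<^esub> y)"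
  by (simp add: quotient_module_def N.a_rcos_sum)

text \<open>The action on a coset is encoded as a union over all its elements. Since
  \<open>N\<close> is closed under scalars, every element contributes the same coset and the union
  collapses.\<close>

lemma quotient_module_smult:
  assumes c: "c \<in> carrier K" and x: "x \<in> carrier M"
  shows "c \<odot>\<^bsub>quotient_module M N\<^esub> (N +>\<^bsub>M\<^esub> x) = N +>\<^bsub>M\<^esub> (c \<odot>\<^bsub>M\<^esub> x)"
proof -
  have "N +>\<^bsub>M\<^esub> (c \<odot>\<^bsub>M\<^esub> y) = N +>\<^bsub>M\<^esub> (c \<odot>\<^bsub>M\<^esub> x)" if y: "y \<in> N +>\<^bsub>M\<^esub> x" for y
  proof -
    from y obtain n where n: "n \<in> N" "y = n \<oplus>\<^bsub>M\<^esub> x" by (auto simp: a_r_coset_def')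
    have "c \<odot>\<^bsub>M\<^esub> y = c \<odot>\<^bsub>M\<^esub> n \<oplus>\<^bsub>M\<^esub> c \<odot>\<^bsub>M\<^esub> x" using n c x N.a_Hcarr by (simp add: smult_r_distr)
    then have "c \<odot>\<^bsub>M\<^esub> y \<in> N +>\<^bsub>M\<^esub> (c \<odot>\<^bsub>M\<^esub> x)"
      using n c submodule.smult_closed[OF N] by (auto simp: a_r_coset_def')
    then show ?thesis using c x by (intro N.a_repr_independence'[symmetric]) auto
  qed
  then have "(\<Union>y\<in>N +>\<^bsub>M\<^esub> x. N +>\<^bsub>M\<^esub> (c \<odot>\<^bsub>M\<^esub> y)) = (\<Union>y\<in>N +>\<^bsub>M\<^esub> x. N +>\<^bsub>M\<^esub> (c \<odot>\<^bsub>M\<^esub> x))"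
    by (rule SUP_cong[OF refl])
  also have "\<dots> = N +>\<^bsub>M\<^esub> (c \<odot>\<^bsub>M\<^esub> x)" using N.a_rcos_self[OF x] by blast
  finally show ?thesis by (simp add: quotient_module_def)
qed

lemma module_quotient: "module K (quotient_module M N)"
proof -
  have rep: "X \<in> carrier (quotient_module M N) \<longleftrightarrow> (\<exists>x\<in>carrier M. X = N +>\<^bsub>M\<^esub> x)" for X
    by (auto simp: quotient_module_def A_RCOSETS_def')
  \<comment> \<open>The zero of the quotient is \<open>N\<close> itself; written as a coset it falls
    under the same laws on representatives as every other element.\<close>
  have zero: "\<zero>\<^bsub>quotient_module M N\<^esub> = N +>\<^bsub>M\<^esub> \<zero>\<^bsub>M\<^esub>"
    using N.a_rcos_const[OF N.zero_closed] by (simp add: quotient_module_def)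
  show ?thesis
  proof (rule moduleI; (rule abelian_groupI)?)
    show "cring K" by (rule R.cring_axioms)
  next
    fix X assume "X \<in> carrier (quotient_module M N)"
    then obtain x where x: "x \<in> carrier M" "X = N +>\<^bsub>M\<^esub> x" by (auto simp: rep)
    then show "\<exists>Y\<in>carrier (quotient_module M N). Y \<oplus>\<^bsub>quotient_module M N\<^esub> X = \<zero>\<^bsub>quotient_module M N\<^esub>"
      by (intro bexI[of _ "N +>\<^bsub>M\<^esub> (\<ominus>\<^bsub>M\<^esub> x)"])
        (auto simp: rep zero quotient_module_add M.l_neg)
  qed (auto simp: rep zero quotient_module_add quotient_module_smult M.a_ac
      smult_l_distr smult_r_distr smult_assoc1)
qed

lemma quotient_module_proj: "linear_map K M (quotient_module M N) (\<lambda>x. N +>\<^bsub>M\<^esub> x)"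
proof (rule linear_mapI)
  show "N +>\<^bsub>M\<^esub> x \<in> carrier (quotient_module M N)" if "x \<in> carrier M" for x
    using that by (auto simp: quotient_module_def A_RCOSETS_def')
qed (simp_all add: quotient_module_add quotient_module_smult)

end

section \<open>The tensor product: pure tensors, induction and the universal property\<close>

lemma tensor_relations_subset:
  assumes "module K V" "module K W"
  shows "tensor_relations K V W \<subseteq> carrier (free_module K (carrier V \<times> carrier W))"
proof -
  interpret V: module K V by fact
  interpret W: module K W by fact
  interpret F: module K "free_module K (carrier V \<times> carrier W)"
    by (rule module_free) (rule V.R.cring_axioms)
  show ?thesis
    by (auto simp: tensor_relations_def Let_def intro!: free_gen_closed V.R.cring_axioms)
qed

context
  fixes K :: "('k, 'm) ring_scheme" and V :: "('k, 'a, 'x) module_scheme" and W :: "('k, 'b, 'y) module_scheme"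
  assumes V: "module K V" and W: "module K W"
begin

interpretation V: module K V by (rule V)
interpretation W: module K W by (rule W)

lemma module_free_pairs: "module K (free_module K (carrier V \<times> carrier W))"
  by (rule module_free) (rule V.R.cring_axioms)

interpretation F: module K "free_module K (carrier V \<times> carrier W)" by (rule module_free_pairs)

lemma submodule_tensor_kernel:
  "submodule (tensor_kernel K V W) K (free_module K (carrier V \<times> carrier W))"
  unfolding tensor_kernel_def
  by (intro submodule_generated module_free_pairs tensor_relations_subset V W)

lemma module_tensor [simp]: "module K (tensor K V W)"
  unfolding tensor_def by (intro module_quotient module_free_pairs submodule_tensor_kernel)

interpretation N: abelian_subgroup "tensor_kernel K V W" "free_module K (carrier V \<times> carrier W)"
  using submodule.axioms(1)[OF submodule_tensor_kernel] F.M.a_comm_group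
  by (rule abelian_subgroupI2[rotated])

lemma tensor_proj:
  "linear_map K (free_module K (carrier V \<times> carrier W)) (tensor K V W)
    (\<lambda>u. tensor_kernel K V W +>\<^bsub>free_module K (carrier V \<times> carrier W)\<^esub> u)"
  unfolding tensor_def by (intro quotient_module_proj module_free_pairs submodule_tensor_kernel)

lemma tensor_carrierE:
  assumes "t \<in> carrier (tensor K V W)"
  obtains u where "u \<in> carrier (free_module K (carrier V \<times> carrier W))"
    "t = tensor_kernel K V W +>\<^bsub>free_module K (carrier V \<times> carrier W)\<^esub> u"
  using assms by (auto simp: tensor_def quotient_module_def A_RCOSETS_def')

lemma pure_tensor_closed [simp]:
  "\<lbrakk>a \<in> carrier V; b \<in> carrier W\<rbrakk> \<Longrightarrow> pure_tensor K V W a b \<in> carrier (tensor K V W)"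
  unfolding pure_tensor_def
  by (intro linear_map_closed[OF tensor_proj] free_gen_closed V.R.cring_axioms) auto

text \<open>Turns a defining relation into an equation of cosets. The four linearity laws of pure
  tensors are four uses of it.\<close>

lemma tensor_proj_eq:
  assumes "x \<in> carrier (free_module K (carrier V \<times> carrier W))"
    and "y \<in> carrier (free_module K (carrier V \<times> carrier W))"
    and "x \<ominus>\<^bsub>free_module K (carrier V \<times> carrier W)\<^esub> y \<in> tensor_relations K V W"
  shows "tensor_kernel K V W +>\<^bsub>free_module K (carrier V \<times> carrier W)\<^esub> x =
    tensor_kernel K V W +>\<^bsub>free_module K (carrier V \<times> carrier W)\<^esub> y"
proof -
  have "x \<ominus>\<^bsub>free_module K (carrier V \<times> carrier W)\<^esub> y \<in> tensor_kernel K V W"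
    using assms(3) generated_submodule_superset unfolding tensor_kernel_def by (rule rev_subsetD)
  then have "x \<in> tensor_kernel K V W +>\<^bsub>free_module K (carrier V \<times> carrier W)\<^esub> y"
    using assms(1,2) by (simp add: N.a_rcos_module a_minus_def)
  then show ?thesis
    using assms(2) by (intro N.a_repr_independence'[symmetric])
qed

lemma free_gen_pair_closed:
  "\<lbrakk>a \<in> carrier V; b \<in> carrier W\<rbrakk> \<Longrightarrow> free_gen K (a, b) \<in> carrier (free_module K (carrier V \<times> carrier W))"
  by (intro free_gen_closed V.R.cring_axioms) auto

lemma linear_pure_tensor_left:
  assumes b: "b \<in> carrier W"
  shows "linear_map K V (tensor K V W) (\<lambda>a. pure_tensor K V W a b)"
proof (rule linear_mapI)
  fix x y assume xy: "x \<in> carrier V" "y \<in> carrier V"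
  note cl = free_gen_pair_closed[OF xy(1) b] free_gen_pair_closed[OF xy(2) b]
  have "free_gen K (x \<oplus>\<^bsub>V\<^esub> y, b) \<ominus>\<^bsub>free_module K (carrier V \<times> carrier W)\<^esub> (free_gen K (x, b)
      \<oplus>\<^bsub>free_module K (carrier V \<times> carrier W)\<^esub> free_gen K (y, b)) \<in> tensor_relations K V W"
    using xy b unfolding tensor_relations_def Let_def by blast
  then show "pure_tensor K V W (x \<oplus>\<^bsub>V\<^esub> y) b =
      pure_tensor K V W x b \<oplus>\<^bsub>tensor K V W\<^esub> pure_tensor K V W y b"
    unfolding pure_tensor_def linear_map_add[OF tensor_proj cl, symmetric]
    using xy b cl by (intro tensor_proj_eq free_gen_pair_closed) auto
next
  fix c x assume c: "c \<in> carrier K" and x: "x \<in> carrier V"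
  have "free_gen K (c \<odot>\<^bsub>V\<^esub> x, b) \<ominus>\<^bsub>free_module K (carrier V \<times> carrier W)\<^esub>
      c \<odot>\<^bsub>free_module K (carrier V \<times> carrier W)\<^esub> free_gen K (x, b) \<in> tensor_relations K V W"
    using x b c unfolding tensor_relations_def Let_def by blast
  then show "pure_tensor K V W (c \<odot>\<^bsub>V\<^esub> x) b = c \<odot>\<^bsub>tensor K V W\<^esub> pure_tensor K V W x b"
    unfolding pure_tensor_def linear_map_smult[OF tensor_proj c free_gen_pair_closed[OF x b], symmetric]
    using x b c free_gen_pair_closed[OF x b] by (intro tensor_proj_eq free_gen_pair_closed) auto
qed (use b in \<open>auto intro: pure_tensor_closed\<close>)

lemma linear_pure_tensor_right:
  assumes a: "a \<in> carrier V"
  shows "linear_map K W (tensor K V W) (\<lambda>b. pure_tensor K V W a b)"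
proof (rule linear_mapI)
  fix x y assume xy: "x \<in> carrier W" "y \<in> carrier W"
  note cl = free_gen_pair_closed[OF a xy(1)] free_gen_pair_closed[OF a xy(2)]
  have "free_gen K (a, x \<oplus>\<^bsub>W\<^esub> y) \<ominus>\<^bsub>free_module K (carrier V \<times> carrier W)\<^esub> (free_gen K (a, x)
      \<oplus>\<^bsub>free_module K (carrier V \<times> carrier W)\<^esub> free_gen K (a, y)) \<in> tensor_relations K V W"
    using xy a unfolding tensor_relations_def Let_def by blast
  then show "pure_tensor K V W a (x \<oplus>\<^bsub>W\<^esub> y) =
      pure_tensor K V W a x \<oplus>\<^bsub>tensor K V W\<^esub> pure_tensor K V W a y"
    unfolding pure_tensor_def linear_map_add[OF tensor_proj cl, symmetric]
    using xy a cl by (intro tensor_proj_eq free_gen_pair_closed) auto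
next
  fix c x assume c: "c \<in> carrier K" and x: "x \<in> carrier W"
  have "free_gen K (a, c \<odot>\<^bsub>W\<^esub> x) \<ominus>\<^bsub>free_module K (carrier V \<times> carrier W)\<^esub>
      c \<odot>\<^bsub>free_module K (carrier V \<times> carrier W)\<^esub> free_gen K (a, x) \<in> tensor_relations K V W"
    using x a c unfolding tensor_relations_def Let_def by blast
  then show "pure_tensor K V W a (c \<odot>\<^bsub>W\<^esub> x) = c \<odot>\<^bsub>tensor K V W\<^esub> pure_tensor K V W a x"
    unfolding pure_tensor_def linear_map_smult[OF tensor_proj c free_gen_pair_closed[OF a x], symmetric]
    using x a c free_gen_pair_closed[OF a x] by (intro tensor_proj_eq free_gen_pair_closed) auto
qed (use a in \<open>auto intro: pure_tensor_closed\<close>)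

text \<open>Cosets are nonempty, so the choice in \<open>tensor_lift\<close> yields a genuine
  representative. The facts about \<open>tensor_lift\<close> for integrands that are not bilinear
  rest on this.\<close>

lemma tensor_some_rep:
  assumes "t \<in> carrier (tensor K V W)"
  shows "(SOME u. u \<in> t) \<in> carrier (free_module K (carrier V \<times> carrier W))"
    and "t = tensor_kernel K V W +>\<^bsub>free_module K (carrier V \<times> carrier W)\<^esub> (SOME u. u \<in> t)"
proof -
  obtain u where u: "u \<in> carrier (free_module K (carrier V \<times> carrier W))"
    "t = tensor_kernel K V W +>\<^bsub>free_module K (carrier V \<times> carrier W)\<^esub> u"
    using assms by (rule tensor_carrierE)
  define v where "v = (SOME u. u \<in> t)"
  have "u \<in> t" unfolding u(2) by (rule N.a_rcos_self[OF u(1)])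
  then have "v \<in> t" unfolding v_def by (rule someI[where P = "\<lambda>v. v \<in> t"])
  then have v: "v \<in> tensor_kernel K V W +>\<^bsub>free_module K (carrier V \<times> carrier W)\<^esub> u"
    unfolding u(2) .
  show "(SOME u. u \<in> t) \<in> carrier (free_module K (carrier V \<times> carrier W))"
    unfolding v_def[symmetric] by (rule N.a_elemrcos_carrier[OF u(1) v])
  show "t = tensor_kernel K V W +>\<^bsub>free_module K (carrier V \<times> carrier W)\<^esub> (SOME u. u \<in> t)"
    unfolding v_def[symmetric] unfolding u(2) by (rule N.a_repr_independence'[OF v u(1)])
qed

lemma tensor_induct [consumes 1, case_names zero add smult pure]:
  assumes "t \<in> carrier (tensor K V W)"
    and zero: "P \<zero>\<^bsub>tensor K V W\<^esub>"
    and add: "\<And>s t. \<lbrakk>s \<in> carrier (tensor K V W); t \<in> carrier (tensor K V W); P s; P t\<rbrakk> \<Longrightarrow>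
      P (s \<oplus>\<^bsub>tensor K V W\<^esub> t)"
    and smult: "\<And>c t. \<lbrakk>c \<in> carrier K; t \<in> carrier (tensor K V W); P t\<rbrakk> \<Longrightarrow> P (c \<odot>\<^bsub>tensor K V W\<^esub> t)"
    and pure: "\<And>a b. \<lbrakk>a \<in> carrier V; b \<in> carrier W\<rbrakk> \<Longrightarrow> P (pure_tensor K V W a b)"
  shows "P t"
proof -
  obtain u where u: "u \<in> carrier (free_module K (carrier V \<times> carrier W))"
    "t = tensor_kernel K V W +>\<^bsub>free_module K (carrier V \<times> carrier W)\<^esub> u"
    using assms(1) by (rule tensor_carrierE)
  note closed = linear_map_closed[OF tensor_proj]
  from V.R.cring_axioms u(1)
  have "P (tensor_kernel K V W +>\<^bsub>free_module K (carrier V \<times> carrier W)\<^esub> u)"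
  proof (induction rule: free_module_induct)
    case zero
    then show ?case
      using linear_map_zero[OF module_free_pairs module_tensor tensor_proj] assms(2) by simp
  next
    case (add u v)
    then show ?case using assms(3) closed by (simp add: linear_map_add[OF tensor_proj])
  next
    case (smult c u)
    then show ?case using assms(4) closed by (simp add: linear_map_smult[OF tensor_proj])
  next
    case (gen i)
    then show ?case using pure by (auto simp: pure_tensor_def)
  qed
  then show ?thesis using u by simp
qed

text \<open>The main device for identities on a tensor product: linearity of both sides reduces them
  to pure tensors, on which Sweedler sums can be written down.\<close>

lemma tensor_linear_ext:
  assumes U: "module K U" and g: "linear_map K (tensor K V W) U g" and h: "linear_map K (tensor K V W) U h"
    and eq: "\<And>a b. \<lbrakk>a \<in> carrier V; b \<in> carrier W\<rbrakk> \<Longrightarrow>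
      g (pure_tensor K V W a b) = h (pure_tensor K V W a b)"
    and t: "t \<in> carrier (tensor K V W)"
  shows "g t = h t"
  using t
  by (induction rule: tensor_induct)
    (auto simp: eq linear_map_zero[OF module_tensor U g] linear_map_zero[OF module_tensor U h]
      linear_map_add[OF g] linear_map_add[OF h] linear_map_smult[OF g] linear_map_smult[OF h])

lemma tensor_lift_closed:
  assumes "module K U" "\<And>x y. \<lbrakk>x \<in> carrier V; y \<in> carrier W\<rbrakk> \<Longrightarrow> f x y \<in> carrier U"
    and "t \<in> carrier (tensor K V W)"
  shows "tensor_lift K U f t \<in> carrier U"
proof -
  have "free_lift K U (\<lambda>p. f (fst p) (snd p)) (SOME u. u \<in> t) \<in> carrier U"
    by (rule linear_map_closed[OF linear_map_free_lift tensor_some_rep(1)]) (use assms in auto)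
  then show ?thesis by (simp add: tensor_lift_def free_lift_def Let_def)
qed

lemma tensor_lift_cong:
  assumes "\<And>x y. \<lbrakk>x \<in> carrier V; y \<in> carrier W\<rbrakk> \<Longrightarrow> f x y = g x y"
    and "t \<in> carrier (tensor K V W)"
  shows "tensor_lift K U f t = tensor_lift K U g t"
proof -
  have "f (fst p) (snd p) = g (fst p) (snd p)" if "(SOME u. u \<in> t) p \<noteq> \<zero>\<^bsub>K\<^esub>" for p
  proof -
    have "p \<in> carrier V \<times> carrier W"
      using tensor_some_rep(1)[OF assms(2)] that by (auto simp: free_module_def)
    then show ?thesis by (intro assms(1)) auto
  qed
  then show ?thesis unfolding tensor_lift_def Let_def by (intro finsum_cong_on) simp
qed

text \<open>Both sides are finite sums over the same chosen representative, so linearity of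
  \<open>g\<close> suffices and \<open>f\<close> may be arbitrary.\<close>

lemma linear_map_tensor_lift:
  assumes "module K U" "module K U'" "linear_map K U U' g"
    and "\<And>x y. \<lbrakk>x \<in> carrier V; y \<in> carrier W\<rbrakk> \<Longrightarrow> f x y \<in> carrier U"
    and "t \<in> carrier (tensor K V W)"
  shows "g (tensor_lift K U f t) = tensor_lift K U' (\<lambda>x y. g (f x y)) t"
proof -
  interpret U: module K U by fact
  interpret U': module K U' by fact
  define u where "u = (SOME u. u \<in> t)"
  have u: "finite {p. u p \<noteq> \<zero>\<^bsub>K\<^esub>}" "\<And>p. u p \<noteq> \<zero>\<^bsub>K\<^esub> \<Longrightarrow> p \<in> carrier V \<times> carrier W" "\<And>p. u p \<in> carrier K"
    using tensor_some_rep(1)[OF assms(5)] by (auto simp: free_module_def u_def)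
  have "g (\<Oplus>\<^bsub>U\<^esub>p\<in>{p. u p \<noteq> \<zero>\<^bsub>K\<^esub>}. u p \<odot>\<^bsub>U\<^esub> f (fst p) (snd p)) =
      (\<Oplus>\<^bsub>U'\<^esub>p\<in>{p. u p \<noteq> \<zero>\<^bsub>K\<^esub>}. g (u p \<odot>\<^bsub>U\<^esub> f (fst p) (snd p)))"
    by (rule linear_map_finsum[OF assms(1-3) u(1)])
      (use u(3) in \<open>auto intro!: assms(4) dest!: u(2)\<close>)
  also have "\<dots> = (\<Oplus>\<^bsub>U'\<^esub>p\<in>{p. u p \<noteq> \<zero>\<^bsub>K\<^esub>}. u p \<odot>\<^bsub>U'\<^esub> g (f (fst p) (snd p)))"
  proof (rule U'.M.finsum_cong')
    show "(\<lambda>p. u p \<odot>\<^bsub>U'\<^esub> g (f (fst p) (snd p))) \<in> {p. u p \<noteq> \<zero>\<^bsub>K\<^esub>} \<rightarrow> carrier U'"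
      using u(3) by (auto intro!: U'.smult_closed linear_map_closed[OF assms(3)] assms(4) dest!: u(2))
  next
    fix p assume "p \<in> {p. u p \<noteq> \<zero>\<^bsub>K\<^esub>}"
    then have "p \<in> carrier V \<times> carrier W" by (intro u(2)) simp
    then have "f (fst p) (snd p) \<in> carrier U" by (intro assms(4)) auto
    then show "g (u p \<odot>\<^bsub>U\<^esub> f (fst p) (snd p)) = u p \<odot>\<^bsub>U'\<^esub> g (f (fst p) (snd p))"
      by (intro linear_map_smult[OF assms(3)] u(3))
  qed simp
  finally show ?thesis by (simp add: tensor_lift_def Let_def u_def)
qed

text \<open>Linearity in a parameter needs no bilinearity of the integrand, since \<open>tensor_lift\<close>
  evaluates at one and the same representative for all values of the parameter.\<close>

lemma linear_map_tensor_lift_param: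
  assumes X: "module K X" and U: "module K U"
    and f: "\<And>x y. \<lbrakk>x \<in> carrier V; y \<in> carrier W\<rbrakk> \<Longrightarrow> linear_map K X U (\<lambda>z. f z x y)"
    and t: "t \<in> carrier (tensor K V W)"
  shows "linear_map K X U (\<lambda>z. tensor_lift K U (f z) t)"
proof -
  interpret X: module K X by fact
  interpret U: module K U by fact
  define u where "u = (SOME u. u \<in> t)"
  have u: "finite {p. u p \<noteq> \<zero>\<^bsub>K\<^esub>}" "\<And>p. u p \<noteq> \<zero>\<^bsub>K\<^esub> \<Longrightarrow> p \<in> carrier V \<times> carrier W" "\<And>p. u p \<in> carrier K"
    using tensor_some_rep(1)[OF t] by (auto simp: free_module_def u_def)
  have lin: "linear_map K X U (\<lambda>z. f z (fst p) (snd p))" if "u p \<noteq> \<zero>\<^bsub>K\<^esub>" for p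
    using u(2)[OF that] by (intro f) auto
  show ?thesis
  proof (rule linear_mapI)
    fix z assume z: "z \<in> carrier X"
    show "tensor_lift K U (f z) t \<in> carrier U"
      using z f t U by (intro tensor_lift_closed) (auto dest: linear_map_closed)
  next
    fix z z' assume z: "z \<in> carrier X" "z' \<in> carrier X"
    have "(\<Oplus>\<^bsub>U\<^esub>p\<in>{p. u p \<noteq> \<zero>\<^bsub>K\<^esub>}. u p \<odot>\<^bsub>U\<^esub> f (z \<oplus>\<^bsub>X\<^esub> z') (fst p) (snd p)) =
       (\<Oplus>\<^bsub>U\<^esub>p\<in>{p. u p \<noteq> \<zero>\<^bsub>K\<^esub>}. u p \<odot>\<^bsub>U\<^esub> f z (fst p) (snd p) \<oplus>\<^bsub>U\<^esub> u p \<odot>\<^bsub>U\<^esub> f z' (fst p) (snd p))"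
      using u(3) z by (intro U.M.finsum_cong')
        (auto simp: linear_map_add[OF lin] linear_map_closed[OF lin] U.smult_r_distr)
    also have "\<dots> = (\<Oplus>\<^bsub>U\<^esub>p\<in>{p. u p \<noteq> \<zero>\<^bsub>K\<^esub>}. u p \<odot>\<^bsub>U\<^esub> f z (fst p) (snd p)) \<oplus>\<^bsub>U\<^esub>
       (\<Oplus>\<^bsub>U\<^esub>p\<in>{p. u p \<noteq> \<zero>\<^bsub>K\<^esub>}. u p \<odot>\<^bsub>U\<^esub> f z' (fst p) (snd p))"
      using u(3) z by (intro U.M.finsum_addf) (auto simp: linear_map_closed[OF lin])
    finally show "tensor_lift K U (f (z \<oplus>\<^bsub>X\<^esub> z')) t = tensor_lift K U (f z) t \<oplus>\<^bsub>U\<^esub> tensor_lift K U (f z') t"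
      by (simp add: tensor_lift_def Let_def u_def)
  next
    fix c z assume z: "c \<in> carrier K" "z \<in> carrier X"
    have "(\<Oplus>\<^bsub>U\<^esub>p\<in>{p. u p \<noteq> \<zero>\<^bsub>K\<^esub>}. u p \<odot>\<^bsub>U\<^esub> f (c \<odot>\<^bsub>X\<^esub> z) (fst p) (snd p)) =
       (\<Oplus>\<^bsub>U\<^esub>p\<in>{p. u p \<noteq> \<zero>\<^bsub>K\<^esub>}. c \<odot>\<^bsub>U\<^esub> (u p \<odot>\<^bsub>U\<^esub> f z (fst p) (snd p)))"
      using u(3) z by (intro U.M.finsum_cong')
        (auto simp: linear_map_smult[OF lin] linear_map_closed[OF lin]
          U.smult_assoc1[symmetric] V.R.m_comm)
    also have "\<dots> = c \<odot>\<^bsub>U\<^esub> (\<Oplus>\<^bsub>U\<^esub>p\<in>{p. u p \<noteq> \<zero>\<^bsub>K\<^esub>}. u p \<odot>\<^bsub>U\<^esub> f z (fst p) (snd p))"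
      using u(1,3) z by (intro U.finsum_smult_ldistr[symmetric]) (auto simp: linear_map_closed[OF lin])
    finally show "tensor_lift K U (f (c \<odot>\<^bsub>X\<^esub> z)) t = c \<odot>\<^bsub>U\<^esub> tensor_lift K U (f z) t"
      by (simp add: tensor_lift_def Let_def u_def)
  qed
qed

context
  fixes U :: "('k, 'c, 'z) module_scheme" and f
  assumes U: "module K U" and f: "bilinear_map K V W U f"
begin

interpretation U: module K U by (rule U)

text \<open>Well-definedness on the quotient: the kernel of the free lift is a submodule, and by
  bilinearity of \<open>f\<close> it contains the defining relations, hence the submodule they
  generate.\<close>

lemma free_lift_tensor_kernel:
  "tensor_kernel K V W \<subseteq> {u \<in> carrier (free_module K (carrier V \<times> carrier W)).
     free_lift K U (\<lambda>p. f (fst p) (snd p)) u = \<zero>\<^bsub>U\<^esub>}"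
  unfolding tensor_kernel_def
proof (rule generated_submodule_minimal)
  have fl: "linear_map K W U (f a)" if "a \<in> carrier V" for a using f that by (simp add: bilinear_map_def)
  have fr: "linear_map K V U (\<lambda>a. f a b)" if "b \<in> carrier W" for b using f that by (simp add: bilinear_map_def)
  let ?L = "free_lift K U (\<lambda>p. f (fst p) (snd p))"
  have cl: "f a b \<in> carrier U" if "a \<in> carrier V" "b \<in> carrier W" for a b
    using linear_map_closed[OF fl] that by blast
  have lin: "linear_map K (free_module K (carrier V \<times> carrier W)) U ?L"
    using cl by (intro linear_map_free_lift U) auto
  have gen: "?L (free_gen K (a, b)) = f a b" if "a \<in> carrier V" "b \<in> carrier W" for a b
    using free_lift_gen[OF U, of "\<lambda>p. f (fst p) (snd p)" "carrier V \<times> carrier W" "(a, b)"] that cl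
    by (auto simp: Pi_iff)
  show "submodule {u \<in> carrier (free_module K (carrier V \<times> carrier W)). ?L u = \<zero>\<^bsub>U\<^esub>} K
     (free_module K (carrier V \<times> carrier W))"
    by (intro submodule_kernel module_free_pairs U lin)
  note simps = a_minus_def linear_map_add[OF lin] linear_map_smult[OF lin] linear_map_minus[OF module_free_pairs U lin]
    gen linear_map_add[OF fl] linear_map_add[OF fr] linear_map_smult[OF fl] linear_map_smult[OF fr]
  show "tensor_relations K V W \<subseteq> {u \<in> carrier (free_module K (carrier V \<times> carrier W)). ?L u = \<zero>\<^bsub>U\<^esub>}"
    using tensor_relations_subset[OF V W]
    by (auto simp: tensor_relations_def Let_def simps free_gen_pair_closed cl U.M.r_neg)
qed

text \<open>Removes the choice of a representative: the chosen element and \<open>u\<close> differ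
  by an element of \<open>tensor_kernel\<close>, which the free lift annihilates.\<close>

lemma tensor_lift_coset:
  assumes u: "u \<in> carrier (free_module K (carrier V \<times> carrier W))"
  shows "tensor_lift K U f (tensor_kernel K V W +>\<^bsub>free_module K (carrier V \<times> carrier W)\<^esub> u) =
    free_lift K U (\<lambda>p. f (fst p) (snd p)) u"
proof -
  let ?L = "free_lift K U (\<lambda>p. f (fst p) (snd p))"
  let ?F = "free_module K (carrier V \<times> carrier W)"
  have lin: "linear_map K ?F U ?L"
    using f linear_map_closed
    by (intro linear_map_free_lift U) (fastforce simp: bilinear_map_def)
  define t where "t = tensor_kernel K V W +>\<^bsub>?F\<^esub> u"
  have t: "t \<in> carrier (tensor K V W)" unfolding t_def by (rule linear_map_closed[OF tensor_proj u])
  have "u \<in> t" unfolding t_def by (rule N.a_rcos_self[OF u])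
  then have "(SOME u. u \<in> t) \<in> t" by (rule someI[where P = "\<lambda>v. v \<in> t"])
  then obtain n where n: "n \<in> tensor_kernel K V W" "(SOME u. u \<in> t) = n \<oplus>\<^bsub>?F\<^esub> u"
    by (auto simp: t_def a_r_coset_def')
  then have n0: "n \<in> carrier ?F" "?L n = \<zero>\<^bsub>U\<^esub>" using free_lift_tensor_kernel by auto
  have "?L (SOME u. u \<in> t) = ?L u"
    unfolding n(2) using n0 u linear_map_closed[OF lin u] by (simp add: linear_map_add[OF lin])
  then show ?thesis by (simp add: tensor_lift_def free_lift_def Let_def t_def)
qed

lemma linear_tensor_lift: "linear_map K (tensor K V W) U (tensor_lift K U f)"
proof -
  let ?L = "free_lift K U (\<lambda>p. f (fst p) (snd p))"
  let ?F = "free_module K (carrier V \<times> carrier W)"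
  have lin: "linear_map K ?F U ?L"
    using f linear_map_closed
    by (intro linear_map_free_lift U) (fastforce simp: bilinear_map_def)
  show ?thesis
  proof (rule linear_mapI)
    fix t assume "t \<in> carrier (tensor K V W)"
    then show "tensor_lift K U f t \<in> carrier U"
      by (elim tensor_carrierE) (simp add: tensor_lift_coset linear_map_closed[OF lin])
  next
    fix s t assume "s \<in> carrier (tensor K V W)" "t \<in> carrier (tensor K V W)"
    then show "tensor_lift K U f (s \<oplus>\<^bsub>tensor K V W\<^esub> t) = tensor_lift K U f s \<oplus>\<^bsub>U\<^esub> tensor_lift K U f t"
      by (elim tensor_carrierE)
        (simp add: tensor_lift_coset linear_map_add[OF lin] linear_map_add[OF tensor_proj, symmetric])
  next
    fix c t assume "c \<in> carrier K" "t \<in> carrier (tensor K V W)"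
    then show "tensor_lift K U f (c \<odot>\<^bsub>tensor K V W\<^esub> t) = c \<odot>\<^bsub>U\<^esub> tensor_lift K U f t"
      by (elim tensor_carrierE)
        (simp add: tensor_lift_coset linear_map_smult[OF lin] linear_map_smult[OF tensor_proj, symmetric])
  qed
qed

lemma tensor_lift_pure:
  "\<lbrakk>a \<in> carrier V; b \<in> carrier W\<rbrakk> \<Longrightarrow> tensor_lift K U f (pure_tensor K V W a b) = f a b"
  unfolding pure_tensor_def
  using free_lift_gen[OF U, of "\<lambda>p. f (fst p) (snd p)" "carrier V \<times> carrier W" "(a, b)"] f
  by (auto simp: tensor_lift_coset free_gen_pair_closed bilinear_map_def Pi_iff dest: linear_map_closed)

end

end


section \<open>Sweedler calculus\<close>

text \<open>The inner map \<open>l\<close> is arbitrary, so rules of this shape compose: the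
  simplifier proves linearity of a deeply nested integrand in one of its variables by descending
  along the occurrence of that variable.\<close>

lemma linear_pure_tensor_leftI [simp]:
  "\<lbrakk>module K V; module K W; linear_map K X V l; b \<in> carrier W\<rbrakk> \<Longrightarrow>
    linear_map K X (tensor K V W) (\<lambda>x. pure_tensor K V W (l x) b)"
  by (rule linear_map_comp[OF linear_pure_tensor_left])

lemma linear_pure_tensor_rightI [simp]:
  "\<lbrakk>module K V; module K W; linear_map K X W l; a \<in> carrier V\<rbrakk> \<Longrightarrow>
    linear_map K X (tensor K V W) (\<lambda>x. pure_tensor K V W a (l x))"
  by (rule linear_map_comp[OF linear_pure_tensor_right])

lemma linear_smult_right [simp]:
  assumes "module K U" "linear_map K X U l" "c \<in> carrier K"
  shows "linear_map K X U (\<lambda>x. c \<odot>\<^bsub>U\<^esub> l x)"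
proof -
  interpret module K U by fact
  show ?thesis
    using assms(2,3) by (auto simp: linear_map_def Pi_iff smult_r_distr smult_assoc1[symmetric] R.m_comm)
qed

lemma linear_smult_left [simp]:
  assumes "module K U" "linear_map K X (ground_module K) l" "u \<in> carrier U"
  shows "linear_map K X U (\<lambda>x. l x \<odot>\<^bsub>U\<^esub> u)"
proof -
  interpret module K U by fact
  show ?thesis
    using assms(2,3) by (auto simp: linear_map_def Pi_iff ground_module_def smult_l_distr smult_assoc1)
qed

lemma bilinear_mapI:
  "\<lbrakk>\<And>x. x \<in> carrier V \<Longrightarrow> linear_map K W U (f x); \<And>y. y \<in> carrier W \<Longrightarrow> linear_map K V U (\<lambda>x. f x y)\<rbrakk>
    \<Longrightarrow> bilinear_map K V W U f"
  by (simp add: bilinear_map_def)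

lemma linear_tensor_liftI [simp]:
  "\<lbrakk>module K V; module K W; module K U;
    \<And>x. x \<in> carrier V \<Longrightarrow> linear_map K W U (f x);
    \<And>y. y \<in> carrier W \<Longrightarrow> linear_map K V U (\<lambda>x. f x y)\<rbrakk> \<Longrightarrow>
    linear_map K (tensor K V W) U (tensor_lift K U f)"
  by (rule linear_tensor_lift) (simp_all add: bilinear_mapI)

lemma tensor_lift_pure_tensor:
  assumes "module K V" "module K W" "module K U"
    and "\<And>x. x \<in> carrier V \<Longrightarrow> linear_map K W U (f x)"
    and "\<And>y. y \<in> carrier W \<Longrightarrow> linear_map K V U (\<lambda>x. f x y)"
    and "a \<in> carrier V" "b \<in> carrier W"
  shows "tensor_lift K U f (pure_tensor K V W a b) = f a b"
  by (rule tensor_lift_pure) (simp_all add: assms bilinear_mapI)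

lemma tensor_lift_eta:
  assumes "module K V" "module K W" "t \<in> carrier (tensor K V W)"
  shows "tensor_lift K (tensor K V W) (pure_tensor K V W) t = t"
  by (rule tensor_linear_ext[where V = V and W = W and K = K and U = "tensor K V W"])
    (simp_all add: assms tensor_lift_pure_tensor)

text \<open>A Fubini rule. With \<open>t\<close> evaluated at one fixed representative, both sides
  are linear in \<open>s\<close>, so it suffices to check pure tensors \<open>s\<close>; linearity
  of \<open>f\<close> is needed only in the two variables that belong to \<open>s\<close>.\<close>

lemma tensor_lift_swap:
  assumes "module K V" "module K W" "module K V'" "module K W'" "module K U"
    and "t \<in> carrier (tensor K V W)" "s \<in> carrier (tensor K V' W')"
    and f1: "\<And>x y x'. \<lbrakk>x \<in> carrier V; y \<in> carrier W; x' \<in> carrier V'\<rbrakk> \<Longrightarrow> linear_map K W' U (f x y x')"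
    and f2: "\<And>x y y'. \<lbrakk>x \<in> carrier V; y \<in> carrier W; y' \<in> carrier W'\<rbrakk> \<Longrightarrow> linear_map K V' U (\<lambda>x'. f x y x' y')"
  shows "tensor_lift K U (\<lambda>x y. tensor_lift K U (f x y) s) t =
    tensor_lift K U (\<lambda>x' y'. tensor_lift K U (\<lambda>x y. f x y x' y') t) s"
proof (rule tensor_linear_ext[OF assms(3,4,5) _ _ _ assms(7)])
  show "linear_map K (tensor K V' W') U (\<lambda>s. tensor_lift K U (\<lambda>x y. tensor_lift K U (f x y) s) t)"
    by (rule linear_map_tensor_lift_param[where V = V and W = W]) (simp_all add: assms)
  show "linear_map K (tensor K V' W') U (tensor_lift K U (\<lambda>x' y'. tensor_lift K U (\<lambda>x y. f x y x' y') t))"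
    by (rule linear_tensor_lift; (rule bilinear_mapI)?)
      (simp_all add: assms linear_map_tensor_lift_param[where V = V and W = W])
next
  fix a b assume ab: "a \<in> carrier V'" "b \<in> carrier W'"
  have cl: "f x y a b \<in> carrier U" if "x \<in> carrier V" "y \<in> carrier W" for x y
    using linear_map_closed[OF f1] that ab by blast
  have "tensor_lift K U (\<lambda>x y. tensor_lift K U (f x y) (pure_tensor K V' W' a b)) t =
      tensor_lift K U (\<lambda>x y. f x y a b) t"
    by (rule tensor_lift_cong[where V = V and W = W]) (simp_all add: assms tensor_lift_pure_tensor ab)
  also have "\<dots> = tensor_lift K U (\<lambda>x' y'. tensor_lift K U (\<lambda>x y. f x y x' y') t) (pure_tensor K V' W' a b)"
    by (rule tensor_lift_pure_tensor[symmetric]) (simp_all add: assms ab linear_map_tensor_lift_param[where V = V and W = W])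
  finally show "tensor_lift K U (\<lambda>x y. tensor_lift K U (f x y) (pure_tensor K V' W' a b)) t =
    tensor_lift K U (\<lambda>x' y'. tensor_lift K U (\<lambda>x y. f x y x' y') t) (pure_tensor K V' W' a b)" .
qed

text \<open>Isolates what a linear coproduct alone provides, so that Sweedler sums are available for
  a candidate coproduct while its coassociativity is still to be proved.\<close>

locale comultiplication = K?: field K + C?: module K C
  for K (structure) and C (structure) +
  fixes comult :: "'c \<Rightarrow> ('c \<times> 'c \<Rightarrow> 'k) set"
  assumes comult_linear: "linear_map K C (tensor K C C) comult"
begin

abbreviation sw :: "('k, 'w, 'z) module_scheme \<Rightarrow> ('c \<Rightarrow> 'c \<Rightarrow> 'w) \<Rightarrow> 'c \<Rightarrow> 'w"
  where "sw U \<equiv> sweedler2 K U comult"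

lemma module_C [simp]: "module K C"
  by (rule C.module_axioms)

lemma module_ground_K [simp]: "module K (ground_module K)"
  by (rule module_ground) (rule K.cring_axioms)

lemma comult_closed [simp]: "c \<in> carrier C \<Longrightarrow> comult c \<in> carrier (tensor K C C)"
  by (rule linear_map_closed[OF comult_linear])

lemma linear_comult [simp]: "linear_map K X C l \<Longrightarrow> linear_map K X (tensor K C C) (\<lambda>x. comult (l x))"
  by (rule linear_map_comp[OF comult_linear])

lemma sw_closed [simp]:
  "\<lbrakk>module K U; \<And>x y. \<lbrakk>x \<in> carrier C; y \<in> carrier C\<rbrakk> \<Longrightarrow> f x y \<in> carrier U; c \<in> carrier C\<rbrakk> \<Longrightarrow>
    sw U f c \<in> carrier U"
  unfolding sweedler2_def by (rule tensor_lift_closed[where V = C and W = C]) simp_all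

lemma sw_cong:
  "\<lbrakk>c = d; d \<in> carrier C; \<And>x y. \<lbrakk>x \<in> carrier C; y \<in> carrier C\<rbrakk> \<Longrightarrow> f x y = g x y\<rbrakk> \<Longrightarrow> sw U f c = sw U g d"
  unfolding sweedler2_def by (hypsubst, rule tensor_lift_cong[where V = C and W = C]) simp_all

lemma linear_sw_body [simp]:
  "\<lbrakk>module K X; module K U; c \<in> carrier C;
    \<And>x y. \<lbrakk>x \<in> carrier C; y \<in> carrier C\<rbrakk> \<Longrightarrow> linear_map K X U (\<lambda>z. f z x y)\<rbrakk> \<Longrightarrow>
    linear_map K X U (\<lambda>z. sw U (f z) c)"
  unfolding sweedler2_def by (rule linear_map_tensor_lift_param[where V = C and W = C]) simp_all

lemma linear_sw_arg [simp]:
  "\<lbrakk>module K U; linear_map K X C l;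
    \<And>x. x \<in> carrier C \<Longrightarrow> linear_map K C U (f x);
    \<And>y. y \<in> carrier C \<Longrightarrow> linear_map K C U (\<lambda>x. f x y)\<rbrakk> \<Longrightarrow>
    linear_map K X U (\<lambda>z. sw U f (l z))"
  unfolding sweedler2_def by (rule linear_map_comp[where V = "tensor K C C"]) simp_all

lemma linear_sw:
  "\<lbrakk>module K U; module K U'; linear_map K U U' g; c \<in> carrier C;
    \<And>x y. \<lbrakk>x \<in> carrier C; y \<in> carrier C\<rbrakk> \<Longrightarrow> f x y \<in> carrier U\<rbrakk> \<Longrightarrow>
    g (sw U f c) = sw U' (\<lambda>x y. g (f x y)) c"
  unfolding sweedler2_def by (rule linear_map_tensor_lift[where V = C and W = C]) simp_all

lemma comult_eq_sw: "c \<in> carrier C \<Longrightarrow> comult c = sw (tensor K C C) (pure_tensor K C C) c"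
  unfolding sweedler2_def by (simp add: tensor_lift_eta)

lemma tensor_lift_sw:
  assumes "module K V" "module K W" "module K U" "c \<in> carrier C"
    and "\<And>x. x \<in> carrier V \<Longrightarrow> linear_map K W U (f x)"
    and "\<And>y. y \<in> carrier W \<Longrightarrow> linear_map K V U (\<lambda>x. f x y)"
    and "\<And>x y. \<lbrakk>x \<in> carrier C; y \<in> carrier C\<rbrakk> \<Longrightarrow> g x y \<in> carrier (tensor K V W)"
  shows "tensor_lift K U f (sw (tensor K V W) g c) = sw U (\<lambda>x y. tensor_lift K U f (g x y)) c"
  by (rule linear_sw) (simp_all add: assms)

text \<open>Together with \<open>coassoc_right_eq\<close> this expresses the coassociativity axiom
  by Sweedler sums of the universal trilinear map \<open>x \<otimes> (y \<otimes> z)\<close>, free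
  of \<open>tensor_assoc\<close> and \<open>tensor_map\<close>.\<close>

lemma coassoc_left_eq:
  assumes c: "c \<in> carrier C"
  shows "tensor_assoc K C C C (tensor_map K (tensor K C C) C comult id (comult c)) =
    sw (tensor K C (tensor K C C)) (\<lambda>x y. sw (tensor K C (tensor K C C))
      (\<lambda>x1 x2. pure_tensor K C (tensor K C C) x1 (pure_tensor K C C x2 y)) x) c"
  (is "?L = ?R")
proof -
  let ?T = "tensor K C (tensor K C C)"
  let ?f = "\<lambda>t w. tensor_lift K ?T (\<lambda>u v. pure_tensor K C (tensor K C C) u (pure_tensor K C C v w)) t"
  have "?L = tensor_lift K ?T ?f (sw (tensor K (tensor K C C) C)
      (\<lambda>x y. pure_tensor K (tensor K C C) C (comult x) y) c)"
    by (simp add: tensor_assoc_def Let_def tensor_map_def sweedler2_def)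
  also have "\<dots> = sw ?T (\<lambda>x y. tensor_lift K ?T ?f (pure_tensor K (tensor K C C) C (comult x) y)) c"
    by (rule tensor_lift_sw) (simp_all add: c linear_map_tensor_lift_param[where V = C and W = C])
  also have "\<dots> = ?R"
    by (rule sw_cong) (simp_all add: c tensor_lift_pure_tensor linear_map_tensor_lift_param[where V = C and W = C] sweedler2_def)
  finally show ?thesis .
qed

lemma coassoc_right_eq:
  assumes c: "c \<in> carrier C"
  shows "tensor_map K C (tensor K C C) id comult (comult c) =
    sw (tensor K C (tensor K C C)) (\<lambda>x y. sw (tensor K C (tensor K C C))
      (\<lambda>y1 y2. pure_tensor K C (tensor K C C) x (pure_tensor K C C y1 y2)) y) c"
  (is "?L = ?R")
proof -
  let ?T = "tensor K C (tensor K C C)"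
  have "?L = sw ?T (\<lambda>x y. pure_tensor K C (tensor K C C) x (comult y)) c"
    by (simp add: tensor_map_def sweedler2_def)
  also have "\<dots> = ?R"
  proof (rule sw_cong)
    fix x y assume xy: "x \<in> carrier C" "y \<in> carrier C"
    have "pure_tensor K C (tensor K C C) x (comult y) =
        pure_tensor K C (tensor K C C) x (sw (tensor K C C) (pure_tensor K C C) y)"
      using xy by (simp flip: comult_eq_sw)
    also have "\<dots> = sw ?T (\<lambda>y1 y2. pure_tensor K C (tensor K C C) x (pure_tensor K C C y1 y2)) y"
      by (rule linear_sw) (simp_all add: xy)
    finally show "pure_tensor K C (tensor K C C) x (comult y) =
        sw ?T (\<lambda>y1 y2. pure_tensor K C (tensor K C C) x (pure_tensor K C C y1 y2)) y" .
  qed (simp_all add: c)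
  finally show ?thesis .
qed

end

sublocale coalgebra \<subseteq> comultiplication K C comult
  by unfold_locales (rule comult_linear)

text \<open>Lets a new coalgebra be established by Sweedler sums alone; coassociativity has to be
  checked only for the universal trilinear map.\<close>

lemma (in comultiplication) coalgebraI:
  assumes "linear_map K C (ground_module K) counit"
    and "\<And>c. c \<in> carrier C \<Longrightarrow>
      sw (tensor K C (tensor K C C)) (\<lambda>x y. sw (tensor K C (tensor K C C))
        (\<lambda>x1 x2. pure_tensor K C (tensor K C C) x1 (pure_tensor K C C x2 y)) x) c =
      sw (tensor K C (tensor K C C)) (\<lambda>x y. sw (tensor K C (tensor K C C))
        (\<lambda>y1 y2. pure_tensor K C (tensor K C C) x (pure_tensor K C C y1 y2)) y) c"
    and "\<And>c. c \<in> carrier C \<Longrightarrow> sw C (\<lambda>x y. counit x \<odot>\<^bsub>C\<^esub> y) c = c"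
    and "\<And>c. c \<in> carrier C \<Longrightarrow> sw C (\<lambda>x y. counit y \<odot>\<^bsub>C\<^esub> x) c = c"
  shows "coalgebra K C comult counit"
proof (intro coalgebra.intro coalgebra_axioms.intro)
  fix c assume c: "c \<in> carrier C"
  show "tensor_assoc K C C C (tensor_map K (tensor K C C) C comult id (comult c)) =
      tensor_map K C (tensor K C C) id comult (comult c)"
    unfolding coassoc_left_eq[OF c] coassoc_right_eq[OF c] by (rule assms(2)[OF c])
  show "tensor_lift K C (\<lambda>x y. counit x \<odot>\<^bsub>C\<^esub> y) (comult c) = c"
    using assms(3)[OF c] by (simp add: sweedler2_def)
  show "tensor_lift K C (\<lambda>x y. counit y \<odot>\<^bsub>C\<^esub> x) (comult c) = c"
    using assms(4)[OF c] by (simp add: sweedler2_def)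
qed (rule K.field_axioms module_C comult_linear assms(1))+

context coalgebra
begin

lemma linear_counit [simp]: "linear_map K X C l \<Longrightarrow> linear_map K X (ground_module K) (\<lambda>x. counit (l x))"
  by (rule linear_map_comp[OF counit_linear])

lemma counit_closed [simp]: "c \<in> carrier C \<Longrightarrow> counit c \<in> carrier K"
  using linear_map_closed[OF counit_linear] by (simp add: ground_module_def)

text \<open>A trilinear \<open>f\<close> factors through the triple tensor product by the linear map
  \<open>?g\<close>. This map is pulled out of both sums, the axiom is applied to the universal map,
  and \<open>?g\<close> is pushed back in.\<close>

lemma sw_coassoc:
  assumes U: "module K U" and c: "c \<in> carrier C"
    and f1: "\<And>y z. \<lbrakk>y \<in> carrier C; z \<in> carrier C\<rbrakk> \<Longrightarrow> linear_map K C U (\<lambda>x. f x y z)"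
    and f2: "\<And>x z. \<lbrakk>x \<in> carrier C; z \<in> carrier C\<rbrakk> \<Longrightarrow> linear_map K C U (\<lambda>y. f x y z)"
    and f3: "\<And>x y. \<lbrakk>x \<in> carrier C; y \<in> carrier C\<rbrakk> \<Longrightarrow> linear_map K C U (f x y)"
  shows "sw U (\<lambda>x z. sw U (\<lambda>x y. f x y z) x) c = sw U (\<lambda>x y. sw U (f x) y) c"
proof -
  let ?T = "tensor K C (tensor K C C)"
  let ?g = "tensor_lift K U (\<lambda>x. tensor_lift K U (f x))"
  note [simp] = U c f1 f2 f3
  have lin: "linear_map K ?T U ?g"
    by (rule linear_tensor_lift; (rule bilinear_mapI)?)
      (simp_all add: linear_map_tensor_lift_param[where V = C and W = C])
  have eq: "?g (pure_tensor K C (tensor K C C) x (pure_tensor K C C y z)) = f x y z"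
    if "x \<in> carrier C" "y \<in> carrier C" "z \<in> carrier C" for x y z
    using that by (simp add: tensor_lift_pure_tensor linear_map_tensor_lift_param[where V = C and W = C])
  have "sw U (\<lambda>x z. sw U (\<lambda>x y. f x y z) x) c =
      sw U (\<lambda>x z. sw U (\<lambda>x y. ?g (pure_tensor K C (tensor K C C) x (pure_tensor K C C y z))) x) c"
    by (intro sw_cong) (simp_all add: eq)
  also have "\<dots> = sw U (\<lambda>x z. ?g (sw ?T (\<lambda>x y. pure_tensor K C (tensor K C C) x (pure_tensor K C C y z)) x)) c"
    by (intro sw_cong linear_sw[OF _ _ lin, symmetric]) simp_all
  also have "\<dots> = ?g (sw ?T (\<lambda>x z. sw ?T (\<lambda>x y. pure_tensor K C (tensor K C C) x (pure_tensor K C C y z)) x) c)"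
    by (intro linear_sw[OF _ _ lin, symmetric]) simp_all
  also have "\<dots> = ?g (sw ?T (\<lambda>x y. sw ?T (\<lambda>y z. pure_tensor K C (tensor K C C) x (pure_tensor K C C y z)) y) c)"
    using coassoc[OF c] by (simp add: coassoc_left_eq coassoc_right_eq)
  also have "\<dots> = sw U (\<lambda>x y. ?g (sw ?T (\<lambda>y z. pure_tensor K C (tensor K C C) x (pure_tensor K C C y z)) y)) c"
    by (intro linear_sw[OF _ _ lin]) simp_all
  also have "\<dots> = sw U (\<lambda>x y. sw U (\<lambda>y z. ?g (pure_tensor K C (tensor K C C) x (pure_tensor K C C y z))) y) c"
    by (intro sw_cong linear_sw[OF _ _ lin]) simp_all
  also have "\<dots> = sw U (\<lambda>x y. sw U (f x) y) c"
    by (intro sw_cong) (simp_all add: eq)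
  finally show ?thesis .
qed

lemma sw_counit_left:
  assumes "module K U" "c \<in> carrier C" "linear_map K C U f"
  shows "sw U (\<lambda>x y. counit x \<odot>\<^bsub>U\<^esub> f y) c = f c"
proof -
  have "sw U (\<lambda>x y. counit x \<odot>\<^bsub>U\<^esub> f y) c = sw U (\<lambda>x y. f (counit x \<odot>\<^bsub>C\<^esub> y)) c"
    by (intro sw_cong) (simp_all add: assms linear_map_smult[OF assms(3)])
  also have "\<dots> = f (sw C (\<lambda>x y. counit x \<odot>\<^bsub>C\<^esub> y) c)"
    by (rule linear_sw[symmetric]) (simp_all add: assms)
  also have "\<dots> = f c" using counit_left[OF assms(2)] by (simp add: sweedler2_def)
  finally show ?thesis .
qed

lemma sw_counit_right:
  assumes "module K U" "c \<in> carrier C" "linear_map K C U f"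
  shows "sw U (\<lambda>x y. counit y \<odot>\<^bsub>U\<^esub> f x) c = f c"
proof -
  have "sw U (\<lambda>x y. counit y \<odot>\<^bsub>U\<^esub> f x) c = sw U (\<lambda>x y. f (counit y \<odot>\<^bsub>C\<^esub> x)) c"
    by (intro sw_cong) (simp_all add: assms linear_map_smult[OF assms(3)])
  also have "\<dots> = f (sw C (\<lambda>x y. counit y \<odot>\<^bsub>C\<^esub> x) c)"
    by (rule linear_sw[symmetric]) (simp_all add: assms)
  also have "\<dots> = f c" using counit_right[OF assms(2)] by (simp add: sweedler2_def)
  finally show ?thesis .
qed

end


section \<open>Tensor products and transport of coalgebras\<close>

lemma (in comultiplication) sw_swap:
  assumes "comultiplication K E comult'" "module K U" "c \<in> carrier C" "d \<in> carrier E"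
    and "\<And>x y x'. \<lbrakk>x \<in> carrier C; y \<in> carrier C; x' \<in> carrier E\<rbrakk> \<Longrightarrow> linear_map K E U (f x y x')"
    and "\<And>x y y'. \<lbrakk>x \<in> carrier C; y \<in> carrier C; y' \<in> carrier E\<rbrakk> \<Longrightarrow> linear_map K E U (\<lambda>x'. f x y x' y')"
  shows "sw U (\<lambda>x y. sweedler2 K U comult' (f x y) d) c =
    sweedler2 K U comult' (\<lambda>x' y'. sw U (\<lambda>x y. f x y x' y') c) d"
proof -
  interpret E: comultiplication K E comult' by fact
  show ?thesis unfolding sweedler2_def
    by (rule tensor_lift_swap[where V = C and W = C and V' = E and W' = E]) (simp_all add: assms)
qed

section \<open>The tensor product of two coalgebras\<close>

definition tensor_comult ::
  "('k, 'm) ring_scheme \<Rightarrow> ('k, 'c, 'x) module_scheme \<Rightarrow> ('k, 'e, 'y) module_scheme \<Rightarrow>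
   ('c \<Rightarrow> ('c \<times> 'c \<Rightarrow> 'k) set) \<Rightarrow> ('e \<Rightarrow> ('e \<times> 'e \<Rightarrow> 'k) set) \<Rightarrow>
   ('c \<times> 'e \<Rightarrow> 'k) set \<Rightarrow> (('c \<times> 'e \<Rightarrow> 'k) set \<times> ('c \<times> 'e \<Rightarrow> 'k) set \<Rightarrow> 'k) set"
  where "tensor_comult K C E \<Delta> \<Delta>' =
    (let CE = tensor K C E; W = tensor K CE CE in
      tensor_lift K W (\<lambda>a b. sweedler2 K W \<Delta> (\<lambda>a1 a2. sweedler2 K W \<Delta>' (\<lambda>b1 b2.
        pure_tensor K CE CE (pure_tensor K C E a1 b1) (pure_tensor K C E a2 b2)) b) a))"

definition tensor_counit ::
  "('k, 'm) ring_scheme \<Rightarrow> ('c \<Rightarrow> 'k) \<Rightarrow> ('e \<Rightarrow> 'k) \<Rightarrow> ('c \<times> 'e \<Rightarrow> 'k) set \<Rightarrow> 'k"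
  where "tensor_counit K \<epsilon> \<epsilon>' = tensor_lift K (ground_module K) (\<lambda>a b. \<epsilon> a \<otimes>\<^bsub>K\<^esub> \<epsilon>' b)"

lemma linear_ground_mult_left [simp]:
  "\<lbrakk>cring K; linear_map K X (ground_module K) l; k \<in> carrier K\<rbrakk> \<Longrightarrow>
    linear_map K X (ground_module K) (\<lambda>x. l x \<otimes>\<^bsub>K\<^esub> k)"
  using linear_smult_left[of K "ground_module K" X l k] module_ground[of K] by (simp add: ground_module_def)

lemma linear_ground_mult_right [simp]:
  "\<lbrakk>cring K; linear_map K X (ground_module K) l; k \<in> carrier K\<rbrakk> \<Longrightarrow>
    linear_map K X (ground_module K) (\<lambda>x. k \<otimes>\<^bsub>K\<^esub> l x)"
  using linear_smult_right[of K "ground_module K" X l k] module_ground[of K] by (simp add: ground_module_def)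

locale coalgebra_pair = C: coalgebra K C \<Delta> \<epsilon> + E: coalgebra K E \<Delta>' \<epsilon>'
  for K (structure) and C (structure) and \<Delta> \<epsilon> and E (structure) and \<Delta>' \<epsilon>'
begin

abbreviation "CE \<equiv> tensor K C E"
abbreviation "tcomult \<equiv> tensor_comult K C E \<Delta> \<Delta>'"

lemma cring_K [simp]: "cring K"
  by (rule C.K.cring_axioms)

lemma linear_tcomult: "linear_map K CE (tensor K CE CE) tcomult"
  unfolding tensor_comult_def Let_def by simp

lemma comultiplication_tensor: "comultiplication K CE tcomult"
  by (intro comultiplication.intro comultiplication_axioms.intro C.K.field_axioms linear_tcomult) simp

sublocale T: comultiplication K CE tcomult
  by (rule comultiplication_tensor)

text \<open>The coproduct of a pure tensor is known as a sum of tensors, not through its chosen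
  representative, so \<open>f\<close> must be bilinear before it can be moved inside that
  sum.\<close>

lemma tensor_sw_pure:
  assumes "module K U" "a \<in> carrier C" "b \<in> carrier E"
    and "\<And>x. x \<in> carrier CE \<Longrightarrow> linear_map K CE U (f x)"
    and "\<And>y. y \<in> carrier CE \<Longrightarrow> linear_map K CE U (\<lambda>x. f x y)"
  shows "T.sw U f (pure_tensor K C E a b) = C.sw U (\<lambda>a1 a2. E.sw U (\<lambda>b1 b2.
    f (pure_tensor K C E a1 b1) (pure_tensor K C E a2 b2)) b) a"
proof -
  let ?W = "tensor K CE CE"
  have "tcomult (pure_tensor K C E a b) = C.sw ?W (\<lambda>a1 a2. E.sw ?W (\<lambda>b1 b2.
        pure_tensor K CE CE (pure_tensor K C E a1 b1) (pure_tensor K C E a2 b2)) b) a"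
    unfolding tensor_comult_def Let_def by (simp add: tensor_lift_pure_tensor assms)
  then have "T.sw U f (pure_tensor K C E a b) = tensor_lift K U f (C.sw ?W (\<lambda>a1 a2. E.sw ?W (\<lambda>b1 b2.
        pure_tensor K CE CE (pure_tensor K C E a1 b1) (pure_tensor K C E a2 b2)) b) a)"
    by (simp add: sweedler2_def)
  also have "\<dots> = C.sw U (\<lambda>a1 a2. tensor_lift K U f (E.sw ?W (\<lambda>b1 b2.
        pure_tensor K CE CE (pure_tensor K C E a1 b1) (pure_tensor K C E a2 b2)) b)) a"
    by (rule C.tensor_lift_sw) (simp_all add: assms)
  also have "\<dots> = C.sw U (\<lambda>a1 a2. E.sw U (\<lambda>b1 b2. tensor_lift K U f
        (pure_tensor K CE CE (pure_tensor K C E a1 b1) (pure_tensor K C E a2 b2))) b) a"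
    by (intro C.sw_cong E.tensor_lift_sw) (simp_all add: assms)
  also have "\<dots> = C.sw U (\<lambda>a1 a2. E.sw U (\<lambda>b1 b2.
    f (pure_tensor K C E a1 b1) (pure_tensor K C E a2 b2)) b) a"
    by (intro C.sw_cong E.sw_cong tensor_lift_pure_tensor) (simp_all add: assms)
  finally show ?thesis .
qed

lemma coalgebra_tensor: "coalgebra K CE tcomult (tensor_counit K \<epsilon> \<epsilon>')"
proof (rule T.coalgebraI)
  show lin: "linear_map K CE (ground_module K) (tensor_counit K \<epsilon> \<epsilon>')"
    unfolding tensor_counit_def by simp
  note [simp] = linear_map_comp[OF lin]
  have [simp]: "tensor_counit K \<epsilon> \<epsilon>' c \<in> carrier K" if "c \<in> carrier CE" for c
    using linear_map_closed[OF lin that] by (simp add: ground_module_def)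
  have eps: "tensor_counit K \<epsilon> \<epsilon>' (pure_tensor K C E a b) = \<epsilon> a \<otimes>\<^bsub>K\<^esub> \<epsilon>' b"
    if "a \<in> carrier C" "b \<in> carrier E" for a b
    unfolding tensor_counit_def using that by (simp add: tensor_lift_pure_tensor)
  show "T.sw CE (\<lambda>x y. tensor_counit K \<epsilon> \<epsilon>' x \<odot>\<^bsub>CE\<^esub> y) c = c" if "c \<in> carrier CE" for c
  proof (rule tensor_linear_ext[where U = CE, OF C.module_C E.module_C _ _ _ _ that])
    fix a b assume ab: "a \<in> carrier C" "b \<in> carrier E"
    have "T.sw CE (\<lambda>x y. tensor_counit K \<epsilon> \<epsilon>' x \<odot>\<^bsub>CE\<^esub> y) (pure_tensor K C E a b) =
        C.sw CE (\<lambda>a1 a2. E.sw CE (\<lambda>b1 b2. tensor_counit K \<epsilon> \<epsilon>' (pure_tensor K C E a1 b1) \<odot>\<^bsub>CE\<^esub> pure_tensor K C E a2 b2) b) a"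
      using ab by (intro tensor_sw_pure) simp_all
    \<comment> \<open>The scalars are regrouped so that the sum over \<open>b\<close> collapses
      first and leaves a counit sum over \<open>a\<close>.\<close>
    also have "\<dots> = C.sw CE (\<lambda>a1 a2. E.sw CE (\<lambda>b1 b2. \<epsilon>' b1 \<odot>\<^bsub>CE\<^esub> (\<epsilon> a1 \<odot>\<^bsub>CE\<^esub> pure_tensor K C E a2 b2)) b) a"
      using ab by (intro C.sw_cong E.sw_cong refl)
        (simp_all add: eps T.C.smult_assoc1[symmetric] C.K.m_comm)
    also have "\<dots> = C.sw CE (\<lambda>a1 a2. \<epsilon> a1 \<odot>\<^bsub>CE\<^esub> pure_tensor K C E a2 b) a"
      using ab by (intro C.sw_cong E.sw_counit_left refl) simp_all
    also have "\<dots> = pure_tensor K C E a b"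
      using ab by (intro C.sw_counit_left) simp_all
    finally show "T.sw CE (\<lambda>x y. tensor_counit K \<epsilon> \<epsilon>' x \<odot>\<^bsub>CE\<^esub> y) (pure_tensor K C E a b) = pure_tensor K C E a b" .
  qed simp_all
  show "T.sw CE (\<lambda>x y. tensor_counit K \<epsilon> \<epsilon>' y \<odot>\<^bsub>CE\<^esub> x) c = c" if "c \<in> carrier CE" for c
  proof (rule tensor_linear_ext[where U = CE, OF C.module_C E.module_C _ _ _ _ that])
    fix a b assume ab: "a \<in> carrier C" "b \<in> carrier E"
    have "T.sw CE (\<lambda>x y. tensor_counit K \<epsilon> \<epsilon>' y \<odot>\<^bsub>CE\<^esub> x) (pure_tensor K C E a b) =
        C.sw CE (\<lambda>a1 a2. E.sw CE (\<lambda>b1 b2. tensor_counit K \<epsilon> \<epsilon>' (pure_tensor K C E a2 b2) \<odot>\<^bsub>CE\<^esub> pure_tensor K C E a1 b1) b) a"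
      using ab by (intro tensor_sw_pure) simp_all
    also have "\<dots> = C.sw CE (\<lambda>a1 a2. E.sw CE (\<lambda>b1 b2. \<epsilon>' b2 \<odot>\<^bsub>CE\<^esub> (\<epsilon> a2 \<odot>\<^bsub>CE\<^esub> pure_tensor K C E a1 b1)) b) a"
      using ab by (intro C.sw_cong E.sw_cong refl)
        (simp_all add: eps T.C.smult_assoc1[symmetric] C.K.m_comm)
    also have "\<dots> = C.sw CE (\<lambda>a1 a2. \<epsilon> a2 \<odot>\<^bsub>CE\<^esub> pure_tensor K C E a1 b) a"
      using ab by (intro C.sw_cong E.sw_counit_right refl) simp_all
    also have "\<dots> = pure_tensor K C E a b"
      using ab by (intro C.sw_counit_right) simp_all
    finally show "T.sw CE (\<lambda>x y. tensor_counit K \<epsilon> \<epsilon>' y \<odot>\<^bsub>CE\<^esub> x) (pure_tensor K C E a b) = pure_tensor K C E a b" .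
  qed simp_all
  let ?T3 = "tensor K CE (tensor K CE CE)"
  let ?P = "\<lambda>x y z. pure_tensor K CE (tensor K CE CE) x (pure_tensor K CE CE y z)"
  show "T.sw ?T3 (\<lambda>x z. T.sw ?T3 (\<lambda>x y. ?P x y z) x) c = T.sw ?T3 (\<lambda>x y. T.sw ?T3 (\<lambda>y z. ?P x y z) y) c"
    if "c \<in> carrier CE" for c
  proof (rule tensor_linear_ext[where U = ?T3, OF C.module_C E.module_C _ _ _ _ that])
    fix a b assume ab: "a \<in> carrier C" "b \<in> carrier E"
    let ?G = "\<lambda>a1 a2 a3 b1 b2 b3. ?P (pure_tensor K C E a1 b1) (pure_tensor K C E a2 b2) (pure_tensor K C E a3 b3)"
    have "T.sw ?T3 (\<lambda>x z. T.sw ?T3 (\<lambda>x y. ?P x y z) x) (pure_tensor K C E a b) =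
        C.sw ?T3 (\<lambda>a1 a3. E.sw ?T3 (\<lambda>b1 b3. T.sw ?T3 (\<lambda>x y. ?P x y (pure_tensor K C E a3 b3)) (pure_tensor K C E a1 b1)) b) a"
      using ab by (intro tensor_sw_pure) simp_all
    also have "\<dots> = C.sw ?T3 (\<lambda>a1 a3. E.sw ?T3 (\<lambda>b1 b3. C.sw ?T3 (\<lambda>a1 a2.
        E.sw ?T3 (\<lambda>b1 b2. ?G a1 a2 a3 b1 b2 b3) b1) a1) b) a"
      using ab by (intro C.sw_cong E.sw_cong tensor_sw_pure refl) simp_all
    \<comment> \<open>Sums over \<open>C\<close> and \<open>E\<close> alternate at this point.
      Bringing the two sums over \<open>E\<close> together lets coassociativity act in each factor
      separately; a second exchange restores the alternation.\<close>
    also have "\<dots> = C.sw ?T3 (\<lambda>a1 a3. C.sw ?T3 (\<lambda>a1 a2. E.sw ?T3 (\<lambda>b1 b3.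
        E.sw ?T3 (\<lambda>b1 b2. ?G a1 a2 a3 b1 b2 b3) b1) b) a1) a"
      using ab by (intro C.sw_cong[OF refl] E.sw_swap[OF C.comultiplication_axioms]) simp_all
    also have "\<dots> = C.sw ?T3 (\<lambda>a1 a3. C.sw ?T3 (\<lambda>a1 a2. E.sw ?T3 (\<lambda>b1 b2.
        E.sw ?T3 (\<lambda>b2 b3. ?G a1 a2 a3 b1 b2 b3) b2) b) a1) a"
      using ab by (intro C.sw_cong[OF refl] E.sw_coassoc) simp_all
    also have "\<dots> = C.sw ?T3 (\<lambda>a1 a2. C.sw ?T3 (\<lambda>a2 a3. E.sw ?T3 (\<lambda>b1 b2.
        E.sw ?T3 (\<lambda>b2 b3. ?G a1 a2 a3 b1 b2 b3) b2) b) a2) a"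
      using ab by (intro C.sw_coassoc) simp_all
    also have "\<dots> = C.sw ?T3 (\<lambda>a1 a2. E.sw ?T3 (\<lambda>b1 b2. C.sw ?T3 (\<lambda>a2 a3.
        E.sw ?T3 (\<lambda>b2 b3. ?G a1 a2 a3 b1 b2 b3) b2) a2) b) a"
      using ab by (intro C.sw_cong[OF refl] C.sw_swap[OF E.comultiplication_axioms]) simp_all
    also have "\<dots> = C.sw ?T3 (\<lambda>a1 a2. E.sw ?T3 (\<lambda>b1 b2. T.sw ?T3 (\<lambda>y z. ?P (pure_tensor K C E a1 b1) y z)
        (pure_tensor K C E a2 b2)) b) a"
      using ab by (intro C.sw_cong E.sw_cong tensor_sw_pure[symmetric] refl) simp_all
    also have "\<dots> = T.sw ?T3 (\<lambda>x y. T.sw ?T3 (\<lambda>y z. ?P x y z) y) (pure_tensor K C E a b)"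
      using ab by (intro tensor_sw_pure[symmetric]) simp_all
    finally show "T.sw ?T3 (\<lambda>x z. T.sw ?T3 (\<lambda>x y. ?P x y z) x) (pure_tensor K C E a b) =
      T.sw ?T3 (\<lambda>x y. T.sw ?T3 (\<lambda>y z. ?P x y z) y) (pure_tensor K C E a b)" .
  qed simp_all
qed

sublocale T: coalgebra K CE tcomult "tensor_counit K \<epsilon> \<epsilon>'"
  by (rule coalgebra_tensor)

end

text \<open>The structure on \<open>D\<close> is a parameter that agrees on the carrier with the
  conjugate of the structure on \<open>C\<close>, rather than being defined as that conjugate; in
  this way an explicitly given coproduct such as the smash coproduct can be plugged in.\<close>

locale coalgebra_transport = C: coalgebra K C \<Delta> \<epsilon> + D: module K D
  for K (structure) and C (structure) and \<Delta> \<epsilon> and D (structure) +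
  fixes \<Phi> \<Psi> \<Delta>' \<epsilon>'
  assumes \<Phi>: "linear_map K D C \<Phi>" and \<Psi>: "linear_map K C D \<Psi>"
    and \<Psi>\<Phi>: "d \<in> carrier D \<Longrightarrow> \<Psi> (\<Phi> d) = d" and \<Phi>\<Psi>: "c \<in> carrier C \<Longrightarrow> \<Phi> (\<Psi> c) = c"
    and \<Delta>'_def: "d \<in> carrier D \<Longrightarrow> \<Delta>' d = tensor_map K D D \<Psi> \<Psi> (\<Delta> (\<Phi> d))"
    and \<epsilon>'_def: "d \<in> carrier D \<Longrightarrow> \<epsilon>' d = \<epsilon> (\<Phi> d)"
begin

lemma transport_simps [simp]:
  "module K D" "linear_map K D C \<Phi>" "linear_map K C D \<Psi>"
  "linear_map K X D l \<Longrightarrow> linear_map K X C (\<lambda>x. \<Phi> (l x))"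
  "linear_map K X C l' \<Longrightarrow> linear_map K X D (\<lambda>x. \<Psi> (l' x))"
  "d \<in> carrier D \<Longrightarrow> \<Phi> d \<in> carrier C" "c \<in> carrier C \<Longrightarrow> \<Psi> c \<in> carrier D"
  "d \<in> carrier D \<Longrightarrow> \<Psi> (\<Phi> d) = d" "c \<in> carrier C \<Longrightarrow> \<Phi> (\<Psi> c) = c"
  by (simp_all add: D.module_axioms \<Phi> \<Psi> \<Phi>\<Psi> \<Psi>\<Phi> linear_map_comp[OF \<Phi>] linear_map_comp[OF \<Psi>]
      linear_map_closed[OF \<Phi>] linear_map_closed[OF \<Psi>])

lemma \<Delta>'_eq: "d \<in> carrier D \<Longrightarrow>
  \<Delta>' d = C.sw (tensor K D D) (\<lambda>x y. pure_tensor K D D (\<Psi> x) (\<Psi> y)) (\<Phi> d)"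
  by (simp add: \<Delta>'_def tensor_map_def sweedler2_def)

lemma comultiplication_transport: "comultiplication K D \<Delta>'"
proof (intro comultiplication.intro comultiplication_axioms.intro C.K.field_axioms D.module_axioms)
  show "linear_map K D (tensor K D D) \<Delta>'"
    by (subst linear_map_cong[OF _ \<Delta>'_eq]) simp_all
qed

sublocale D: comultiplication K D \<Delta>'
  by (rule comultiplication_transport)

text \<open>A change of variables: since \<open>\<Delta>'\<close> is conjugate to
  \<open>\<Delta>\<close>, Sweedler sums over \<open>D\<close> become sums over \<open>C\<close>,
  where the coalgebra laws are known.\<close>

lemma sw_transport:
  assumes "module K U" "d \<in> carrier D" "\<And>x. x \<in> carrier D \<Longrightarrow> linear_map K D U (f x)"
    and "\<And>y. y \<in> carrier D \<Longrightarrow> linear_map K D U (\<lambda>x. f x y)"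
  shows "D.sw U f d = C.sw U (\<lambda>x y. f (\<Psi> x) (\<Psi> y)) (\<Phi> d)"
proof -
  have "D.sw U f d = tensor_lift K U f (C.sw (tensor K D D) (\<lambda>x y. pure_tensor K D D (\<Psi> x) (\<Psi> y)) (\<Phi> d))"
    using assms by (simp add: sweedler2_def[of K U \<Delta>'] \<Delta>'_eq)
  also have "\<dots> = C.sw U (\<lambda>x y. tensor_lift K U f (pure_tensor K D D (\<Psi> x) (\<Psi> y))) (\<Phi> d)"
    by (rule C.tensor_lift_sw) (simp_all add: assms)
  also have "\<dots> = C.sw U (\<lambda>x y. f (\<Psi> x) (\<Psi> y)) (\<Phi> d)"
    by (intro C.sw_cong tensor_lift_pure_tensor) (simp_all add: assms)
  finally show ?thesis .
qed

lemma coalgebra_transport: "coalgebra K D \<Delta>' \<epsilon>'"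
proof -
  show ?thesis
  proof (rule D.coalgebraI)
    show lin: "linear_map K D (ground_module K) \<epsilon>'"
      by (subst linear_map_cong[OF _ \<epsilon>'_def]) simp_all
    have [simp]: "\<epsilon>' d \<in> carrier K" if "d \<in> carrier D" for d
      using that by (simp add: \<epsilon>'_def)
    note [simp] = linear_map_comp[OF lin]
    fix d assume d: "d \<in> carrier D"
    show "D.sw D (\<lambda>x y. \<epsilon>' x \<odot>\<^bsub>D\<^esub> y) d = d"
    proof -
      have "D.sw D (\<lambda>x y. \<epsilon>' x \<odot>\<^bsub>D\<^esub> y) d = C.sw D (\<lambda>x y. \<epsilon>' (\<Psi> x) \<odot>\<^bsub>D\<^esub> \<Psi> y) (\<Phi> d)"
        by (rule sw_transport) (simp_all add: d lin)
      also have "\<dots> = C.sw D (\<lambda>x y. \<epsilon> x \<odot>\<^bsub>D\<^esub> \<Psi> y) (\<Phi> d)"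
        by (intro C.sw_cong) (simp_all add: d \<epsilon>'_def)
      also have "\<dots> = \<Psi> (\<Phi> d)"
        by (intro C.sw_counit_left) (simp_all add: d)
      finally show ?thesis using d by simp
    qed
    show "D.sw D (\<lambda>x y. \<epsilon>' y \<odot>\<^bsub>D\<^esub> x) d = d"
    proof -
      have "D.sw D (\<lambda>x y. \<epsilon>' y \<odot>\<^bsub>D\<^esub> x) d = C.sw D (\<lambda>x y. \<epsilon>' (\<Psi> y) \<odot>\<^bsub>D\<^esub> \<Psi> x) (\<Phi> d)"
        by (rule sw_transport) (simp_all add: d lin)
      also have "\<dots> = C.sw D (\<lambda>x y. \<epsilon> y \<odot>\<^bsub>D\<^esub> \<Psi> x) (\<Phi> d)"
        by (intro C.sw_cong) (simp_all add: d \<epsilon>'_def)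
      also have "\<dots> = \<Psi> (\<Phi> d)"
        by (intro C.sw_counit_right) (simp_all add: d)
      finally show ?thesis using d by simp
    qed
    let ?T3 = "tensor K D (tensor K D D)"
    let ?P = "\<lambda>x y z. pure_tensor K D (tensor K D D) x (pure_tensor K D D y z)"
    have "D.sw ?T3 (\<lambda>x z. D.sw ?T3 (\<lambda>x y. ?P x y z) x) d =
        C.sw ?T3 (\<lambda>x z. D.sw ?T3 (\<lambda>x y. ?P x y (\<Psi> z)) (\<Psi> x)) (\<Phi> d)"
      by (rule sw_transport) (simp_all add: d)
    also have "\<dots> = C.sw ?T3 (\<lambda>x z. C.sw ?T3 (\<lambda>x y. ?P (\<Psi> x) (\<Psi> y) (\<Psi> z)) x) (\<Phi> d)"
      by (rule C.sw_cong; (subst sw_transport)?) (simp_all add: d)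
    also have "\<dots> = C.sw ?T3 (\<lambda>x y. C.sw ?T3 (\<lambda>y z. ?P (\<Psi> x) (\<Psi> y) (\<Psi> z)) y) (\<Phi> d)"
      by (rule C.sw_coassoc) (simp_all add: d)
    also have "\<dots> = C.sw ?T3 (\<lambda>x y. D.sw ?T3 (\<lambda>y z. ?P (\<Psi> x) y z) (\<Psi> y)) (\<Phi> d)"
      by (rule C.sw_cong; (subst sw_transport)?) (simp_all add: d)
    also have "\<dots> = D.sw ?T3 (\<lambda>x y. D.sw ?T3 (\<lambda>y z. ?P x y z) y) d"
      by (rule sw_transport[symmetric]) (simp_all add: d)
    finally show "D.sw ?T3 (\<lambda>x z. D.sw ?T3 (\<lambda>x y. ?P x y z) x) d =
      D.sw ?T3 (\<lambda>x y. D.sw ?T3 (\<lambda>y z. ?P x y z) y) d" .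
  qed
qed

text \<open>One naturality statement for all the terms of the Rota-Baxter identity that carry an
  operator: \<open>g'\<close> and \<open>h'\<close> are each either the operator or the
  identity.\<close>

lemma tensor_map_transport:
  assumes "linear_map K C C g" "linear_map K C C h" "linear_map K D D g'" "linear_map K D D h'"
    and "\<And>x. x \<in> carrier C \<Longrightarrow> g' (\<Psi> x) = \<Psi> (g x)" "\<And>x. x \<in> carrier C \<Longrightarrow> h' (\<Psi> x) = \<Psi> (h x)"
    and d: "d \<in> carrier D"
  shows "tensor_map K D D g' h' (\<Delta>' d) = tensor_map K D D \<Psi> \<Psi> (tensor_map K C C g h (\<Delta> (\<Phi> d)))"
proof -
  note [simp] = linear_map_comp[OF assms(1)] linear_map_comp[OF assms(2)] linear_map_comp[OF assms(3)]
    linear_map_comp[OF assms(4)] linear_map_closed[OF assms(1)] linear_map_closed[OF assms(2)]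
    linear_map_closed[OF assms(3)] linear_map_closed[OF assms(4)] assms
  have "tensor_map K D D g' h' (\<Delta>' d) = D.sw (tensor K D D) (\<lambda>x y. pure_tensor K D D (g' x) (h' y)) d"
    by (simp add: tensor_map_def sweedler2_def)
  also have "\<dots> = C.sw (tensor K D D) (\<lambda>x y. pure_tensor K D D (g' (\<Psi> x)) (h' (\<Psi> y))) (\<Phi> d)"
    by (rule sw_transport) simp_all
  also have "\<dots> = C.sw (tensor K D D) (\<lambda>x y. tensor_map K D D \<Psi> \<Psi> (pure_tensor K C C (g x) (h y))) (\<Phi> d)"
    by (intro C.sw_cong) (simp_all add: tensor_map_def tensor_lift_pure_tensor)
  also have "\<dots> = tensor_map K D D \<Psi> \<Psi> (C.sw (tensor K C C) (\<lambda>x y. pure_tensor K C C (g x) (h y)) (\<Phi> d))"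
    by (rule C.linear_sw[symmetric]) (simp_all add: tensor_map_def)
  also have "\<dots> = tensor_map K D D \<Psi> \<Psi> (tensor_map K C C g h (\<Delta> (\<Phi> d)))"
    by (simp add: tensor_map_def sweedler2_def)
  finally show ?thesis .
qed

lemma idempotent_rota_baxter_transport:
  assumes Q: "idempotent_rota_baxter_coalgebra K C \<Delta> \<epsilon> Q w"
    and P: "\<And>d. d \<in> carrier D \<Longrightarrow> P d = \<Psi> (Q (\<Phi> d))"
  shows "idempotent_rota_baxter_coalgebra K D \<Delta>' \<epsilon>' P w"
proof -
  interpret Q: idempotent_rota_baxter_coalgebra K C \<Delta> \<epsilon> Q w by fact
  note Q = Q.P_linear
  note [simp] = linear_map_comp[OF Q] linear_map_closed[OF Q]
  have P_lin: "linear_map K D D P"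
    by (subst linear_map_cong[OF _ P]) simp_all
  have id: "linear_map K D D id" "linear_map K C C id" by (simp_all add: id_def)
  let ?M = "tensor_map K D D \<Psi> \<Psi>"
  have M: "linear_map K (tensor K C C) (tensor K D D) ?M" by (simp add: tensor_map_def)
  have Q_map: "tensor_map K C C g h (\<Delta> c) \<in> carrier (tensor K C C)"
    if "linear_map K C C g" "linear_map K C C h" "c \<in> carrier C" for g h c
  proof -
    have "tensor_map K C C g h (\<Delta> c) = C.sw (tensor K C C) (\<lambda>x y. pure_tensor K C C (g x) (h y)) c"
      by (simp add: tensor_map_def sweedler2_def)
    then show ?thesis using that linear_map_closed[OF that(1)] linear_map_closed[OF that(2)] by simp
  qed
  show ?thesis
  proof (intro idempotent_rota_baxter_coalgebra.intro rota_baxter_coalgebra.intro rota_baxter_coalgebra_axioms.intro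
      idempotent_rota_baxter_coalgebra_axioms.intro coalgebra_transport P_lin Q.weight_closed)
    fix d assume d: "d \<in> carrier D"
    show "P (P d) = P d" using d Q.idempotent[of "\<Phi> d"] by (simp add: P)
    \<comment> \<open>The equation for \<open>\<Phi> (P d)\<close> identifies the point at which the
      right-hand side of the identity for \<open>Q\<close> is taken with the image of
      \<open>P d\<close>.\<close>
    have Pd: "P d \<in> carrier D" "\<Phi> (P d) = Q (\<Phi> d)" using d by (simp_all add: P)
    have "tensor_map K D D P P (\<Delta>' d) = ?M (tensor_map K C C Q Q (\<Delta> (\<Phi> d)))"
      using d by (intro tensor_map_transport P_lin Q) (simp_all add: P)
    also have "\<dots> = ?M (tensor_map K C C id Q (\<Delta> (\<Phi> (P d))) \<oplus>\<^bsub>tensor K C C\<^esub>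
        tensor_map K C C Q id (\<Delta> (\<Phi> (P d))) \<oplus>\<^bsub>tensor K C C\<^esub> w \<odot>\<^bsub>tensor K C C\<^esub> \<Delta> (\<Phi> (P d)))"
      using d Q.rota_baxter[of "\<Phi> d"] by (simp add: Pd)
    also have "\<dots> = ?M (tensor_map K C C id Q (\<Delta> (\<Phi> (P d)))) \<oplus>\<^bsub>tensor K D D\<^esub>
        ?M (tensor_map K C C Q id (\<Delta> (\<Phi> (P d)))) \<oplus>\<^bsub>tensor K D D\<^esub> w \<odot>\<^bsub>tensor K D D\<^esub> ?M (\<Delta> (\<Phi> (P d)))"
    proof -
      interpret CC: module K "tensor K C C" by simp
      show ?thesis
        using Q_map[OF id(2) Q, of "\<Phi> (P d)"] Q_map[OF Q id(2), of "\<Phi> (P d)"] Pd(1) Q.weight_closed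
        by (simp add: linear_map_add[OF M] linear_map_smult[OF M])
    qed
    also have "?M (tensor_map K C C id Q (\<Delta> (\<Phi> (P d)))) = tensor_map K D D id P (\<Delta>' (P d))"
      by (intro tensor_map_transport[symmetric] P_lin Q id) (simp_all add: P Pd(1))
    also have "?M (tensor_map K C C Q id (\<Delta> (\<Phi> (P d)))) = tensor_map K D D P id (\<Delta>' (P d))"
      by (intro tensor_map_transport[symmetric] P_lin Q id) (simp_all add: P Pd(1))
    also have "?M (\<Delta> (\<Phi> (P d))) = \<Delta>' (P d)"
      by (simp add: \<Delta>'_def Pd(1))
    finally show "tensor_map K D D P P (\<Delta>' d) = tensor_map K D D id P (\<Delta>' (P d)) \<oplus>\<^bsub>tensor K D D\<^esub>
        tensor_map K D D P id (\<Delta>' (P d)) \<oplus>\<^bsub>tensor K D D\<^esub> w \<odot>\<^bsub>tensor K D D\<^esub> \<Delta>' (P d)" .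
  qed
qed

end

text \<open>The condition \<open>cond\<close> compares unordered pairs because the two operators
  realise it in opposite orders. Idempotence comes from \<open>fj\<close>, and
  \<open>f_comult\<close> makes the left-hand side of the Rota-Baxter identity depend on
  \<open>f c\<close> only.\<close>

lemma (in coalgebra) idempotent_rota_baxter_sectionI:
  assumes E: "comultiplication K E \<Delta>'" and f: "linear_map K C E f" and j: "linear_map K E C j"
    and fj: "\<And>e. e \<in> carrier E \<Longrightarrow> f (j e) = e"
    and f_comult: "\<And>c. c \<in> carrier C \<Longrightarrow> tensor_map K E E f f (comult c) = \<Delta>' (f c)"
    and cond: "\<And>e. e \<in> carrier E \<Longrightarrow>
      {sw (tensor K C C) (\<lambda>x y. pure_tensor K C C x (j (f y))) (j e),
       sw (tensor K C C) (\<lambda>x y. pure_tensor K C C (j (f x)) y) (j e)} =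
      {comult (j e), sweedler2 K (tensor K C C) \<Delta>' (\<lambda>x y. pure_tensor K C C (j x) (j y)) e}"
  shows "idempotent_rota_baxter_coalgebra K C comult counit (\<lambda>c. j (f c)) (\<ominus>\<^bsub>K\<^esub> \<one>\<^bsub>K\<^esub>)"
proof -
  interpret E: comultiplication K E \<Delta>' by fact
  interpret CC: module K "tensor K C C" by simp
  note [simp] = linear_map_comp[OF f] linear_map_comp[OF j] linear_map_closed[OF f] linear_map_closed[OF j] f j fj
  let ?T = "tensor K C C"
  let ?JJ = "\<lambda>x y. pure_tensor K C C (j x) (j y)"
  show ?thesis
  proof (intro idempotent_rota_baxter_coalgebra.intro rota_baxter_coalgebra.intro rota_baxter_coalgebra_axioms.intro
      idempotent_rota_baxter_coalgebra_axioms.intro coalgebra_axioms)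
    fix c assume c: "c \<in> carrier C"
    show "j (f (j (f c))) = j (f c)" using c by simp
    have "sw ?T (\<lambda>x y. ?JJ (f x) (f y)) c =
        sw ?T (\<lambda>x y. tensor_lift K ?T ?JJ (pure_tensor K E E (f x) (f y))) c"
      using c by (intro sw_cong) (simp_all add: tensor_lift_pure_tensor)
    also have "\<dots> = tensor_lift K ?T ?JJ (sw (tensor K E E) (\<lambda>x y. pure_tensor K E E (f x) (f y)) c)"
      using c by (intro tensor_lift_sw[symmetric]) simp_all
    also have "\<dots> = E.sw ?T ?JJ (f c)"
      using f_comult[OF c] by (simp add: tensor_map_def sweedler2_def)
    finally have "sw ?T (\<lambda>x y. ?JJ (f x) (f y)) c = E.sw ?T ?JJ (f c)" .
    moreover have "E.sw ?T ?JJ (f c) = sw ?T (\<lambda>x y. pure_tensor K C C x (j (f y))) (j (f c)) \<oplus>\<^bsub>?T\<^esub>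
        sw ?T (\<lambda>x y. pure_tensor K C C (j (f x)) y) (j (f c)) \<oplus>\<^bsub>?T\<^esub>
        (\<ominus>\<^bsub>K\<^esub> \<one>\<^bsub>K\<^esub>) \<odot>\<^bsub>?T\<^esub> comult (j (f c))"
    proof -
      have "E.sw ?T ?JJ (f c) \<in> carrier ?T" "comult (j (f c)) \<in> carrier ?T" using c by simp_all
      \<comment> \<open>One equation for each order of the pair. The weight -1 cancels the term that
        is a bare coproduct.\<close>
      then have "E.sw ?T ?JJ (f c) = comult (j (f c)) \<oplus>\<^bsub>?T\<^esub> E.sw ?T ?JJ (f c) \<oplus>\<^bsub>?T\<^esub>
          (\<ominus>\<^bsub>K\<^esub> \<one>\<^bsub>K\<^esub>) \<odot>\<^bsub>?T\<^esub> comult (j (f c))"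
        "E.sw ?T ?JJ (f c) = E.sw ?T ?JJ (f c) \<oplus>\<^bsub>?T\<^esub> comult (j (f c)) \<oplus>\<^bsub>?T\<^esub>
          (\<ominus>\<^bsub>K\<^esub> \<one>\<^bsub>K\<^esub>) \<odot>\<^bsub>?T\<^esub> comult (j (f c))"
        by (simp_all add: CC.smult_l_minus CC.M.a_ac CC.M.r_neg CC.M.r_neg1 CC.M.r_neg2)
      then show ?thesis
        using cond[of "f c"] c by (auto simp: doubleton_eq_iff)
    qed
    ultimately show "tensor_map K C C (\<lambda>c. j (f c)) (\<lambda>c. j (f c)) (comult c) =
        tensor_map K C C id (\<lambda>c. j (f c)) (comult (j (f c))) \<oplus>\<^bsub>?T\<^esub>
        tensor_map K C C (\<lambda>c. j (f c)) id (comult (j (f c))) \<oplus>\<^bsub>?T\<^esub>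
        (\<ominus>\<^bsub>K\<^esub> \<one>\<^bsub>K\<^esub>) \<odot>\<^bsub>?T\<^esub> comult (j (f c))"
      by (simp add: tensor_map_def sweedler2_def)
  qed simp_all
qed


section \<open>Convolution and the antipode\<close>

context coalgebra
begin

text \<open>With this bracketing the middle pair can be collapsed first, and then either outer leg.\<close>

lemma sw_bracket:
  assumes "module K U" "c \<in> carrier C"
    and "\<And>x y z. \<lbrakk>x \<in> carrier C; y \<in> carrier C; z \<in> carrier C\<rbrakk> \<Longrightarrow> linear_map K C U (\<lambda>w. G w x y z)"
    and "\<And>x y z. \<lbrakk>x \<in> carrier C; y \<in> carrier C; z \<in> carrier C\<rbrakk> \<Longrightarrow> linear_map K C U (\<lambda>w. G x w y z)"
    and "\<And>x y z. \<lbrakk>x \<in> carrier C; y \<in> carrier C; z \<in> carrier C\<rbrakk> \<Longrightarrow> linear_map K C U (\<lambda>w. G x y w z)"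
    and "\<And>x y z. \<lbrakk>x \<in> carrier C; y \<in> carrier C; z \<in> carrier C\<rbrakk> \<Longrightarrow> linear_map K C U (G x y z)"
  shows "sw U (\<lambda>u v. sw U (\<lambda>c1 c2. sw U (\<lambda>c3 c4. G c1 c2 c3 c4) v) u) c =
    sw U (\<lambda>c1 w. sw U (\<lambda>m c4. sw U (\<lambda>c2 c3. G c1 c2 c3 c4) m) w) c"
proof -
  note [simp] = assms
  have "sw U (\<lambda>u v. sw U (\<lambda>c1 c2. sw U (\<lambda>c3 c4. G c1 c2 c3 c4) v) u) c =
      sw U (\<lambda>c1 w. sw U (\<lambda>c2 v. sw U (\<lambda>c3 c4. G c1 c2 c3 c4) v) w) c"
    by (rule sw_coassoc) simp_all
  also have "\<dots> = sw U (\<lambda>c1 w. sw U (\<lambda>m c4. sw U (\<lambda>c2 c3. G c1 c2 c3 c4) m) w) c"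
    by (intro sw_cong[OF refl] sw_coassoc[symmetric]) simp_all
  finally show ?thesis .
qed

text \<open>The usual argument \<open>f = f * (h * g) = (f * h) * g = g\<close> for the convolution
  \<open>*\<close>. The product \<open>\<mu>\<close> is a parameter because it is instantiated both
  by the product of \<open>H\<close> and by one on \<open>tensor K H H\<close>, whose record field
  \<open>mult\<close> carries no product.\<close>

lemma convolution_inverse_unique:
  assumes U: "module K U"
    and \<mu>1: "\<And>x. x \<in> carrier U \<Longrightarrow> linear_map K U U (\<mu> x)"
    and \<mu>2: "\<And>y. y \<in> carrier U \<Longrightarrow> linear_map K U U (\<lambda>x. \<mu> x y)"
    and assoc: "\<And>x y z. \<lbrakk>x \<in> carrier U; y \<in> carrier U; z \<in> carrier U\<rbrakk> \<Longrightarrow> \<mu> (\<mu> x y) z = \<mu> x (\<mu> y z)"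
    and unit: "u \<in> carrier U" "\<And>x. x \<in> carrier U \<Longrightarrow> \<mu> u x = x" "\<And>x. x \<in> carrier U \<Longrightarrow> \<mu> x u = x"
    and f: "linear_map K C U f" and g: "linear_map K C U g" and h: "linear_map K C U h"
    and left: "\<And>c. c \<in> carrier C \<Longrightarrow> sw U (\<lambda>x y. \<mu> (f x) (h y)) c = counit c \<odot>\<^bsub>U\<^esub> u"
    and right: "\<And>c. c \<in> carrier C \<Longrightarrow> sw U (\<lambda>x y. \<mu> (h x) (g y)) c = counit c \<odot>\<^bsub>U\<^esub> u"
    and c: "c \<in> carrier C"
  shows "f c = g c"
proof -
  note lin = f g h
  note [simp] = U unit c lin lin[THEN linear_map_closed] lin[THEN linear_map_comp]
    linear_map_comp[OF \<mu>1] linear_map_comp[OF \<mu>2]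
  have [simp]: "\<mu> x y \<in> carrier U" if "x \<in> carrier U" "y \<in> carrier U" for x y
    using linear_map_closed[OF \<mu>1] that by blast
  have "f c = sw U (\<lambda>x y. counit y \<odot>\<^bsub>U\<^esub> f x) c"
    by (rule sw_counit_right[symmetric]) simp_all
  also have "\<dots> = sw U (\<lambda>x y. \<mu> (f x) (sw U (\<lambda>y1 y2. \<mu> (h y1) (g y2)) y)) c"
    by (rule sw_cong) (simp_all add: right linear_map_smult[OF \<mu>1])
  also have "\<dots> = sw U (\<lambda>x y. sw U (\<lambda>y1 y2. \<mu> (f x) (\<mu> (h y1) (g y2))) y) c"
    by (intro sw_cong[OF refl] linear_sw[OF _ _ \<mu>1]) simp_all
  also have "\<dots> = sw U (\<lambda>x y. sw U (\<lambda>x1 x2. \<mu> (f x1) (\<mu> (h x2) (g y))) x) c"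
    by (rule sw_coassoc[symmetric]) simp_all
  also have "\<dots> = sw U (\<lambda>x y. sw U (\<lambda>x1 x2. \<mu> (\<mu> (f x1) (h x2)) (g y)) x) c"
    by (intro sw_cong[OF refl]) (simp_all add: assoc)
  also have "\<dots> = sw U (\<lambda>x y. \<mu> (sw U (\<lambda>x1 x2. \<mu> (f x1) (h x2)) x) (g y)) c"
    by (intro sw_cong[OF refl] linear_sw[OF _ _ \<mu>2, symmetric]) simp_all
  also have "\<dots> = sw U (\<lambda>x y. counit x \<odot>\<^bsub>U\<^esub> g y) c"
    by (rule sw_cong) (simp_all add: left linear_map_smult[OF \<mu>2])
  also have "\<dots> = g c"
    by (rule sw_counit_left) simp_all
  finally show ?thesis .
qed

end

sublocale hopf_algebra \<subseteq> HH: coalgebra_pair K H comult counit H comult counit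
  by unfold_locales

context hopf_algebra
begin

abbreviation "HH \<equiv> tensor K H H"

lemma antipode_closed [simp]: "x \<in> carrier H \<Longrightarrow> antipode x \<in> carrier H"
  by (rule linear_map_closed[OF antipode_linear])

lemma linear_antipode [simp]: "linear_map K X H l \<Longrightarrow> linear_map K X H (\<lambda>x. antipode (l x))"
  by (rule linear_map_comp[OF antipode_linear])

lemma linear_mult_left [simp]:
  "\<lbrakk>linear_map K X H l; b \<in> carrier H\<rbrakk> \<Longrightarrow> linear_map K X H (\<lambda>x. l x \<otimes>\<^bsub>H\<^esub> b)"
  by (simp add: linear_map_def Pi_iff H.l_distr smult_mult_left)

lemma linear_mult_right [simp]:
  "\<lbrakk>linear_map K X H l; b \<in> carrier H\<rbrakk> \<Longrightarrow> linear_map K X H (\<lambda>x. b \<otimes>\<^bsub>H\<^esub> l x)"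
  by (simp add: linear_map_def Pi_iff H.r_distr smult_mult_right)

lemma sw_mult:
  assumes "module K U" "x \<in> carrier H" "y \<in> carrier H"
    and "\<And>x. x \<in> carrier H \<Longrightarrow> linear_map K H U (f x)"
    and "\<And>y. y \<in> carrier H \<Longrightarrow> linear_map K H U (\<lambda>x. f x y)"
  shows "sw U f (x \<otimes>\<^bsub>H\<^esub> y) =
    sw U (\<lambda>x1 x2. sw U (\<lambda>y1 y2. f (x1 \<otimes>\<^bsub>H\<^esub> y1) (x2 \<otimes>\<^bsub>H\<^esub> y2)) y) x"
proof -
  note [simp] = assms
  have "sw U f (x \<otimes>\<^bsub>H\<^esub> y) = tensor_lift K U f (sw HH (\<lambda>x1 x2. sw HH (\<lambda>y1 y2.
      pure_tensor K H H (x1 \<otimes>\<^bsub>H\<^esub> y1) (x2 \<otimes>\<^bsub>H\<^esub> y2)) y) x)"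
    unfolding sweedler2_def[of K U] by (simp add: comult_mult)
  also have "\<dots> = sw U (\<lambda>x1 x2. tensor_lift K U f (sw HH (\<lambda>y1 y2.
      pure_tensor K H H (x1 \<otimes>\<^bsub>H\<^esub> y1) (x2 \<otimes>\<^bsub>H\<^esub> y2)) y)) x"
    by (rule tensor_lift_sw) simp_all
  also have "\<dots> = sw U (\<lambda>x1 x2. sw U (\<lambda>y1 y2. tensor_lift K U f (
      pure_tensor K H H (x1 \<otimes>\<^bsub>H\<^esub> y1) (x2 \<otimes>\<^bsub>H\<^esub> y2))) y) x"
    by (intro sw_cong[OF refl] tensor_lift_sw) simp_all
  also have "\<dots> = sw U (\<lambda>x1 x2. sw U (\<lambda>y1 y2. f (x1 \<otimes>\<^bsub>H\<^esub> y1) (x2 \<otimes>\<^bsub>H\<^esub> y2)) y) x"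
    by (intro sw_cong[OF refl] tensor_lift_pure_tensor) simp_all
  finally show ?thesis .
qed

text \<open>The counit of \<open>\<Sum> S(h1) h2\<close> is computed twice: multiplicativity gives
  \<open>\<Sum> \<epsilon>(S(h1)) \<epsilon>(h2) = \<epsilon>(S(h))\<close>, the antipode axiom
  gives \<open>\<epsilon>(h)\<close>.\<close>

lemma counit_antipode:
  assumes h: "h \<in> carrier H"
  shows "counit (antipode h) = counit h"
proof -
  let ?k = "ground_module K"
  have "counit (antipode h) = sw ?k (\<lambda>x y. counit y \<odot>\<^bsub>?k\<^esub> counit (antipode x)) h"
    using h by (intro sw_counit_right[symmetric]) simp_all
  also have "\<dots> = sw ?k (\<lambda>x y. counit (antipode x \<otimes>\<^bsub>H\<^esub> y)) h"
    using h by (intro sw_cong) (simp_all add: counit_mult ground_module_def K.m_comm)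
  also have "\<dots> = counit (sw H (\<lambda>x y. antipode x \<otimes>\<^bsub>H\<^esub> y) h)"
    using h by (intro linear_sw[symmetric] counit_linear) simp_all
  also have "\<dots> = counit h"
    using h linear_map_smult[OF counit_linear, of "counit h" "\<one>\<^bsub>H\<^esub>"]
    by (simp add: antipode_left counit_one ground_module_def)
  finally show ?thesis .
qed

text \<open>Both sides, as maps from \<open>H \<otimes> H\<close> to \<open>H\<close>, are
  convolution inverses of the multiplication: the left one from the left, because the coproduct is
  multiplicative, the right one from the right, by cancelling twice.\<close>

lemma antipode_mult:
  assumes a: "a \<in> carrier H" and b: "b \<in> carrier H"
  shows "antipode (a \<otimes>\<^bsub>H\<^esub> b) = antipode b \<otimes>\<^bsub>H\<^esub> antipode a"
proof -
  let ?\<epsilon> = "tensor_counit K counit counit"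
  let ?f = "tensor_lift K H (\<lambda>a b. antipode (a \<otimes>\<^bsub>H\<^esub> b))"
  let ?g = "tensor_lift K H (\<lambda>a b. antipode b \<otimes>\<^bsub>H\<^esub> antipode a)"
  let ?h = "tensor_lift K H (\<lambda>a b. a \<otimes>\<^bsub>H\<^esub> b)"
  have lin: "linear_map K HH H ?f" "linear_map K HH H ?g" "linear_map K HH H ?h"
    by simp_all
  note [simp] = lin[THEN linear_map_comp] lin[THEN linear_map_closed]
  have f [simp]: "?f (pure_tensor K H H a b) = antipode (a \<otimes>\<^bsub>H\<^esub> b)"
    and g [simp]: "?g (pure_tensor K H H a b) = antipode b \<otimes>\<^bsub>H\<^esub> antipode a"
    and h [simp]: "?h (pure_tensor K H H a b) = a \<otimes>\<^bsub>H\<^esub> b"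
    and \<epsilon> [simp]: "?\<epsilon> (pure_tensor K H H a b) = counit a \<otimes>\<^bsub>K\<^esub> counit b"
    if "a \<in> carrier H" "b \<in> carrier H" for a b
    using that by (simp_all add: tensor_lift_pure_tensor tensor_counit_def)
  have "?f (pure_tensor K H H a b) = ?g (pure_tensor K H H a b)"
  proof (rule HH.T.convolution_inverse_unique[where U = H and \<mu> = "mult H" and u = "\<one>\<^bsub>H\<^esub>" and h = ?h])
    fix c assume c: "c \<in> carrier HH"
    show "HH.T.sw H (\<lambda>x y. ?f x \<otimes>\<^bsub>H\<^esub> ?h y) c = ?\<epsilon> c \<odot>\<^bsub>H\<^esub> \<one>\<^bsub>H\<^esub>"
    proof (rule tensor_linear_ext[where U = H, OF module_C module_C _ _ _ _ c])
      fix a b assume ab: "a \<in> carrier H" "b \<in> carrier H"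
      have "HH.T.sw H (\<lambda>x y. ?f x \<otimes>\<^bsub>H\<^esub> ?h y) (pure_tensor K H H a b) =
          sw H (\<lambda>a1 a2. sw H (\<lambda>b1 b2. ?f (pure_tensor K H H a1 b1) \<otimes>\<^bsub>H\<^esub> ?h (pure_tensor K H H a2 b2)) b) a"
        using ab by (intro HH.tensor_sw_pure) simp_all
      also have "\<dots> = sw H (\<lambda>a1 a2. sw H (\<lambda>b1 b2. antipode (a1 \<otimes>\<^bsub>H\<^esub> b1) \<otimes>\<^bsub>H\<^esub> (a2 \<otimes>\<^bsub>H\<^esub> b2)) b) a"
        using ab by (intro sw_cong) simp_all
      also have "\<dots> = sw H (\<lambda>x y. antipode x \<otimes>\<^bsub>H\<^esub> y) (a \<otimes>\<^bsub>H\<^esub> b)"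
        using ab by (intro sw_mult[symmetric]) simp_all
      also have "\<dots> = ?\<epsilon> (pure_tensor K H H a b) \<odot>\<^bsub>H\<^esub> \<one>\<^bsub>H\<^esub>"
        using ab by (simp add: antipode_left counit_mult)
      finally show "HH.T.sw H (\<lambda>x y. ?f x \<otimes>\<^bsub>H\<^esub> ?h y) (pure_tensor K H H a b) =
        ?\<epsilon> (pure_tensor K H H a b) \<odot>\<^bsub>H\<^esub> \<one>\<^bsub>H\<^esub>" .
    qed simp_all
    show "HH.T.sw H (\<lambda>x y. ?h x \<otimes>\<^bsub>H\<^esub> ?g y) c = ?\<epsilon> c \<odot>\<^bsub>H\<^esub> \<one>\<^bsub>H\<^esub>"
    proof (rule tensor_linear_ext[where U = H, OF module_C module_C _ _ _ _ c])
      fix a b assume ab: "a \<in> carrier H" "b \<in> carrier H"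
      have "HH.T.sw H (\<lambda>x y. ?h x \<otimes>\<^bsub>H\<^esub> ?g y) (pure_tensor K H H a b) =
          sw H (\<lambda>a1 a2. sw H (\<lambda>b1 b2. ?h (pure_tensor K H H a1 b1) \<otimes>\<^bsub>H\<^esub> ?g (pure_tensor K H H a2 b2)) b) a"
        using ab by (intro HH.tensor_sw_pure) simp_all
      \<comment> \<open>The legs of \<open>b\<close> stand in the middle of the product, so
        \<open>b1 S(b2)\<close> collapses first and brings \<open>a1\<close> next to
        \<open>S(a2)\<close>.\<close>
      also have "\<dots> = sw H (\<lambda>a1 a2. sw H (\<lambda>b1 b2. (a1 \<otimes>\<^bsub>H\<^esub> (b1 \<otimes>\<^bsub>H\<^esub> antipode b2)) \<otimes>\<^bsub>H\<^esub> antipode a2) b) a"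
        using ab by (intro sw_cong) (simp_all add: H.m_assoc)
      also have "\<dots> = sw H (\<lambda>a1 a2. (a1 \<otimes>\<^bsub>H\<^esub> sw H (\<lambda>b1 b2. b1 \<otimes>\<^bsub>H\<^esub> antipode b2) b) \<otimes>\<^bsub>H\<^esub> antipode a2) a"
        using ab by (intro sw_cong[OF refl]
            linear_sw[where g = "\<lambda>x. (_ \<otimes>\<^bsub>H\<^esub> x) \<otimes>\<^bsub>H\<^esub> _", symmetric]) simp_all
      also have "\<dots> = sw H (\<lambda>a1 a2. counit b \<odot>\<^bsub>H\<^esub> (a1 \<otimes>\<^bsub>H\<^esub> antipode a2)) a"
        using ab by (intro sw_cong) (simp_all add: antipode_right smult_mult_left smult_mult_right)
      also have "\<dots> = counit b \<odot>\<^bsub>H\<^esub> sw H (\<lambda>a1 a2. a1 \<otimes>\<^bsub>H\<^esub> antipode a2) a"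
        using ab by (intro linear_sw[symmetric]) simp_all
      also have "\<dots> = ?\<epsilon> (pure_tensor K H H a b) \<odot>\<^bsub>H\<^esub> \<one>\<^bsub>H\<^esub>"
        using ab by (simp add: antipode_right K.m_comm flip: C.smult_assoc1)
      finally show "HH.T.sw H (\<lambda>x y. ?h x \<otimes>\<^bsub>H\<^esub> ?g y) (pure_tensor K H H a b) =
        ?\<epsilon> (pure_tensor K H H a b) \<odot>\<^bsub>H\<^esub> \<one>\<^bsub>H\<^esub>" .
    qed simp_all
  qed (simp_all add: H.m_assoc a b)
  then show ?thesis using a b by simp
qed

text \<open>The componentwise product of the algebra \<open>H \<otimes> H\<close>, kept as a
  separate function because the record built by \<open>tensor\<close> leaves its field
  \<open>mult\<close> undefined.\<close>

definition tensor_mult where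
  "tensor_mult s t = tensor_lift K HH (\<lambda>x1 x2. tensor_lift K HH (\<lambda>y1 y2.
    pure_tensor K H H (x1 \<otimes>\<^bsub>H\<^esub> y1) (x2 \<otimes>\<^bsub>H\<^esub> y2)) t) s"

lemma linear_tensor_mult_left: "t \<in> carrier HH \<Longrightarrow> linear_map K HH HH (\<lambda>s. tensor_mult s t)"
  unfolding tensor_mult_def by (simp add: linear_map_tensor_lift_param[where V = H and W = H])

lemma linear_tensor_mult_right: "s \<in> carrier HH \<Longrightarrow> linear_map K HH HH (tensor_mult s)"
  unfolding tensor_mult_def by (simp add: linear_map_tensor_lift_param[where V = H and W = H])

lemma tensor_mult_closed [simp]: "\<lbrakk>s \<in> carrier HH; t \<in> carrier HH\<rbrakk> \<Longrightarrow> tensor_mult s t \<in> carrier HH"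
  by (rule linear_map_closed[OF linear_tensor_mult_right])

lemmas linear_tensor_mult [simp] = linear_map_comp[OF linear_tensor_mult_left] linear_map_comp[OF linear_tensor_mult_right]

lemma tensor_mult_pure [simp]:
  "\<lbrakk>a \<in> carrier H; b \<in> carrier H; c \<in> carrier H; d \<in> carrier H\<rbrakk> \<Longrightarrow>
    tensor_mult (pure_tensor K H H a b) (pure_tensor K H H c d) =
    pure_tensor K H H (a \<otimes>\<^bsub>H\<^esub> c) (b \<otimes>\<^bsub>H\<^esub> d)"
  unfolding tensor_mult_def
  by (simp add: tensor_lift_pure_tensor linear_map_tensor_lift_param[where V = H and W = H])

lemma tensor_mult_assoc:
  assumes r: "r \<in> carrier HH" and s: "s \<in> carrier HH" and t: "t \<in> carrier HH"
  shows "tensor_mult (tensor_mult r s) t = tensor_mult r (tensor_mult s t)"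
proof (rule tensor_linear_ext[where U = HH, OF module_C module_C _ _ _ _ r])
  fix a b assume ab: "a \<in> carrier H" "b \<in> carrier H"
  show "tensor_mult (tensor_mult (pure_tensor K H H a b) s) t = tensor_mult (pure_tensor K H H a b) (tensor_mult s t)"
  proof (rule tensor_linear_ext[where U = HH, OF module_C module_C _ _ _ _ s])
    fix c d assume cd: "c \<in> carrier H" "d \<in> carrier H"
    show "tensor_mult (tensor_mult (pure_tensor K H H a b) (pure_tensor K H H c d)) t =
        tensor_mult (pure_tensor K H H a b) (tensor_mult (pure_tensor K H H c d) t)"
      by (rule tensor_linear_ext[where U = HH, OF module_C module_C _ _ _ _ t])
        (use ab cd t in \<open>simp_all add: H.m_assoc linear_tensor_mult_right\<close>)
  qed (use ab s t in \<open>simp_all add: linear_tensor_mult_right\<close>)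
qed (use s t in \<open>simp_all add: linear_tensor_mult_left\<close>)

lemma tensor_mult_one:
  assumes t: "t \<in> carrier HH"
  shows "tensor_mult (pure_tensor K H H \<one>\<^bsub>H\<^esub> \<one>\<^bsub>H\<^esub>) t = t" "tensor_mult t (pure_tensor K H H \<one>\<^bsub>H\<^esub> \<one>\<^bsub>H\<^esub>) = t"
  by (rule tensor_linear_ext[where U = HH, OF module_C module_C _ _ _ _ t],
      simp_all add: linear_tensor_mult_right linear_tensor_mult_left)+

text \<open>Both sides, as maps from \<open>H\<close> to \<open>H \<otimes> H\<close>, are
  convolution inverses of the coproduct: the left one because the coproduct is an algebra map, the
  right one by cancelling nested pairs of legs.\<close>

lemma comult_antipode:
  assumes h: "h \<in> carrier H"
  shows "comult (antipode h) = sw HH (\<lambda>x y. pure_tensor K H H (antipode y) (antipode x)) h"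
proof (rule convolution_inverse_unique[where U = HH and \<mu> = tensor_mult and h = comult
      and u = "pure_tensor K H H \<one>\<^bsub>H\<^esub> \<one>\<^bsub>H\<^esub>"])
  let ?g = "sw HH (\<lambda>x y. pure_tensor K H H (antipode y) (antipode x))"
  show "linear_map K H HH ?g"
    using linear_sw_arg[of HH H "\<lambda>x. x"] by simp
  fix c assume c: "c \<in> carrier H"
  have "sw HH (\<lambda>x y. tensor_mult (comult (antipode x)) (comult y)) c = sw HH (\<lambda>x y. comult (antipode x \<otimes>\<^bsub>H\<^esub> y)) c"
    using c by (intro sw_cong) (simp_all add: comult_mult tensor_mult_def sweedler2_def)
  also have "\<dots> = comult (sw H (\<lambda>x y. antipode x \<otimes>\<^bsub>H\<^esub> y) c)"
    using c by (intro linear_sw[symmetric] comult_linear) simp_all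
  also have "\<dots> = counit c \<odot>\<^bsub>HH\<^esub> pure_tensor K H H \<one>\<^bsub>H\<^esub> \<one>\<^bsub>H\<^esub>"
    using c by (simp add: antipode_left linear_map_smult[OF comult_linear] comult_one)
  finally show "sw HH (\<lambda>x y. tensor_mult (comult (antipode x)) (comult y)) c =
    counit c \<odot>\<^bsub>HH\<^esub> pure_tensor K H H \<one>\<^bsub>H\<^esub> \<one>\<^bsub>H\<^esub>" .
  let ?G = "\<lambda>c1 c2 c3 c4. pure_tensor K H H (c1 \<otimes>\<^bsub>H\<^esub> antipode c4) (c2 \<otimes>\<^bsub>H\<^esub> antipode c3)"
  have "tensor_mult (comult x) (?g y) = sw HH (\<lambda>x1 x2. sw HH (\<lambda>y1 y2. ?G x1 x2 y1 y2) y) x"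
    if xy: "x \<in> carrier H" "y \<in> carrier H" for x y
  proof -
    have "tensor_mult (comult x) (?g y) = sw HH (\<lambda>x1 x2. tensor_lift K HH (\<lambda>z1 z2.
        pure_tensor K H H (x1 \<otimes>\<^bsub>H\<^esub> z1) (x2 \<otimes>\<^bsub>H\<^esub> z2)) (?g y)) x"
      by (simp add: tensor_mult_def sweedler2_def)
    also have "\<dots> = sw HH (\<lambda>x1 x2. sw HH (\<lambda>y1 y2. tensor_lift K HH (\<lambda>z1 z2.
        pure_tensor K H H (x1 \<otimes>\<^bsub>H\<^esub> z1) (x2 \<otimes>\<^bsub>H\<^esub> z2)) (pure_tensor K H H (antipode y2) (antipode y1))) y) x"
      using xy by (intro sw_cong[OF refl] tensor_lift_sw) simp_all
    also have "\<dots> = sw HH (\<lambda>x1 x2. sw HH (\<lambda>y1 y2. ?G x1 x2 y1 y2) y) x"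
      using xy by (intro sw_cong) (simp_all add: tensor_lift_pure_tensor)
    finally show ?thesis .
  qed
  then have "sw HH (\<lambda>x y. tensor_mult (comult x) (?g y)) c =
      sw HH (\<lambda>x y. sw HH (\<lambda>x1 x2. sw HH (\<lambda>y1 y2. ?G x1 x2 y1 y2) y) x) c"
    using c by (intro sw_cong) simp_all
  \<comment> \<open>Rebracketing makes \<open>c2\<close> and \<open>c3\<close> legs of one element,
    so \<open>c2 S(c3)\<close> turns into a counit; after that, so does the product of the outer
    legs.\<close>
  also have "\<dots> = sw HH (\<lambda>c1 w. sw HH (\<lambda>m c4. sw HH (\<lambda>c2 c3. ?G c1 c2 c3 c4) m) w) c"
    using c by (intro sw_bracket) simp_all
  also have "\<dots> = sw HH (\<lambda>c1 w. sw HH (\<lambda>m c4. pure_tensor K H H (c1 \<otimes>\<^bsub>H\<^esub> antipode c4)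
      (sw H (\<lambda>c2 c3. c2 \<otimes>\<^bsub>H\<^esub> antipode c3) m)) w) c"
    using c by (intro sw_cong[OF refl] linear_sw[symmetric]) simp_all
  also have "\<dots> = sw HH (\<lambda>c1 w. sw HH (\<lambda>m c4. counit m \<odot>\<^bsub>HH\<^esub>
      pure_tensor K H H (c1 \<otimes>\<^bsub>H\<^esub> antipode c4) \<one>\<^bsub>H\<^esub>) w) c"
    using c by (intro sw_cong)
      (simp_all add: antipode_right linear_map_smult[OF linear_pure_tensor_right])
  also have "\<dots> = sw HH (\<lambda>c1 w. pure_tensor K H H (c1 \<otimes>\<^bsub>H\<^esub> antipode w) \<one>\<^bsub>H\<^esub>) c"
    using c by (intro sw_cong[OF refl] sw_counit_left) simp_all
  also have "\<dots> = pure_tensor K H H (sw H (\<lambda>x y. x \<otimes>\<^bsub>H\<^esub> antipode y) c) \<one>\<^bsub>H\<^esub>"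
    using c by (intro linear_sw[symmetric]) simp_all
  also have "\<dots> = counit c \<odot>\<^bsub>HH\<^esub> pure_tensor K H H \<one>\<^bsub>H\<^esub> \<one>\<^bsub>H\<^esub>"
    using c by (simp add: antipode_right linear_map_smult[OF linear_pure_tensor_left])
  finally show "sw HH (\<lambda>x y. tensor_mult (comult x) (?g y)) c =
    counit c \<odot>\<^bsub>HH\<^esub> pure_tensor K H H \<one>\<^bsub>H\<^esub> \<one>\<^bsub>H\<^esub>" .
qed (use h in \<open>simp_all add: tensor_mult_assoc tensor_mult_one linear_tensor_mult_right linear_tensor_mult_left comult_linear\<close>)

lemma sw_antipode:
  assumes "module K U" "c \<in> carrier H"
    and "\<And>x. x \<in> carrier H \<Longrightarrow> linear_map K H U (f x)"
    and "\<And>y. y \<in> carrier H \<Longrightarrow> linear_map K H U (\<lambda>x. f x y)"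
  shows "sw U f (antipode c) = sw U (\<lambda>x y. f (antipode y) (antipode x)) c"
proof -
  note [simp] = assms
  have "sw U f (antipode c) = tensor_lift K U f (sw HH (\<lambda>x y. pure_tensor K H H (antipode y) (antipode x)) c)"
    unfolding sweedler2_def[of K U] by (simp add: comult_antipode)
  also have "\<dots> = sw U (\<lambda>x y. tensor_lift K U f (pure_tensor K H H (antipode y) (antipode x))) c"
    by (rule tensor_lift_sw) simp_all
  also have "\<dots> = sw U (\<lambda>x y. f (antipode y) (antipode x)) c"
    by (intro sw_cong tensor_lift_pure_tensor) simp_all
  finally show ?thesis .
qed

end


section \<open>The smash coproduct as a twisted tensor product\<close>

context hopf_algebra
begin

abbreviation "pt \<equiv> pure_tensor K H H"
abbreviation "pT \<equiv> pure_tensor K HH HH"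
abbreviation "S \<equiv> antipode"
abbreviation "W \<equiv> tensor K HH HH"

section \<open>The twisting isomorphism and its inverse\<close>

definition "smash_to_tensor = tensor_lift K HH (\<lambda>a b. sw HH (\<lambda>a1 a2. pt a1 (S a2 \<otimes>\<^bsub>H\<^esub> b)) a)"
definition "tensor_to_smash = tensor_lift K HH (\<lambda>a b. sw HH (\<lambda>a1 a2. pt a1 (a2 \<otimes>\<^bsub>H\<^esub> b)) a)"

lemma linear_smash_to_tensor: "linear_map K HH HH smash_to_tensor"
  and linear_tensor_to_smash: "linear_map K HH HH tensor_to_smash"
  by (simp_all add: smash_to_tensor_def tensor_to_smash_def)

lemmas twist_simps [simp] =
  linear_map_comp[OF linear_smash_to_tensor] linear_map_closed[OF linear_smash_to_tensor]
  linear_map_comp[OF linear_tensor_to_smash] linear_map_closed[OF linear_tensor_to_smash]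

lemma smash_to_tensor_pure: "\<lbrakk>a \<in> carrier H; b \<in> carrier H\<rbrakk> \<Longrightarrow>
    smash_to_tensor (pt a b) = sw HH (\<lambda>a1 a2. pt a1 (S a2 \<otimes>\<^bsub>H\<^esub> b)) a"
  and tensor_to_smash_pure: "\<lbrakk>a \<in> carrier H; b \<in> carrier H\<rbrakk> \<Longrightarrow>
    tensor_to_smash (pt a b) = sw HH (\<lambda>a1 a2. pt a1 (a2 \<otimes>\<^bsub>H\<^esub> b)) a"
  by (simp_all add: smash_to_tensor_def tensor_to_smash_def tensor_lift_pure_tensor)

text \<open>Covers both compositions at once: one of \<open>p\<close>, \<open>q\<close> is the
  antipode and the other the identity. The leg \<open>x\<close> is untouched, and coassociativity
  joins \<open>p\<close> and \<open>q\<close> to a convolution product that is trivial by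
  \<open>pq\<close>.\<close>

lemma twist_untwist:
  assumes a: "a \<in> carrier H" and b: "b \<in> carrier H"
    and p: "linear_map K H H p" and q: "linear_map K H H q"
    and pq: "\<And>c. c \<in> carrier H \<Longrightarrow> sw H (\<lambda>x y. p x \<otimes>\<^bsub>H\<^esub> q y) c = counit c \<odot>\<^bsub>H\<^esub> \<one>\<^bsub>H\<^esub>"
  shows "sw HH (\<lambda>a1 a2. sw HH (\<lambda>x y. pt x (p y \<otimes>\<^bsub>H\<^esub> (q a2 \<otimes>\<^bsub>H\<^esub> b))) a1) a = pt a b"
proof -
  note [simp] = a b linear_map_comp[OF p] linear_map_comp[OF q] linear_map_closed[OF p] linear_map_closed[OF q]
  have "sw HH (\<lambda>a1 a2. sw HH (\<lambda>x y. pt x (p y \<otimes>\<^bsub>H\<^esub> (q a2 \<otimes>\<^bsub>H\<^esub> b))) a1) a =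
      sw HH (\<lambda>x w. sw HH (\<lambda>y z. pt x (p y \<otimes>\<^bsub>H\<^esub> (q z \<otimes>\<^bsub>H\<^esub> b))) w) a"
    by (rule sw_coassoc) simp_all
  also have "\<dots> = sw HH (\<lambda>x w. pt x (sw H (\<lambda>y z. p y \<otimes>\<^bsub>H\<^esub> q z) w \<otimes>\<^bsub>H\<^esub> b)) a"
  proof (rule sw_cong)
    fix x w assume [simp]: "x \<in> carrier H" "w \<in> carrier H"
    have "sw HH (\<lambda>y z. pt x (p y \<otimes>\<^bsub>H\<^esub> (q z \<otimes>\<^bsub>H\<^esub> b))) w = sw HH (\<lambda>y z. pt x ((p y \<otimes>\<^bsub>H\<^esub> q z) \<otimes>\<^bsub>H\<^esub> b)) w"
      by (intro sw_cong) (simp_all add: H.m_assoc)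
    also have "\<dots> = pt x (sw H (\<lambda>y z. p y \<otimes>\<^bsub>H\<^esub> q z) w \<otimes>\<^bsub>H\<^esub> b)"
      by (intro linear_sw[where g = "\<lambda>t. pt x (t \<otimes>\<^bsub>H\<^esub> b)", symmetric]) simp_all
    finally show "sw HH (\<lambda>y z. pt x (p y \<otimes>\<^bsub>H\<^esub> (q z \<otimes>\<^bsub>H\<^esub> b))) w = pt x (sw H (\<lambda>y z. p y \<otimes>\<^bsub>H\<^esub> q z) w \<otimes>\<^bsub>H\<^esub> b)" .
  qed simp_all
  also have "\<dots> = sw HH (\<lambda>x w. counit w \<odot>\<^bsub>HH\<^esub> pt x b) a"
    by (intro sw_cong) (simp_all add: pq smult_mult_left linear_map_smult[OF linear_pure_tensor_right])
  also have "\<dots> = pt a b" by (rule sw_counit_right) simp_all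
  finally show ?thesis .
qed

lemma tensor_to_smash_inverse [simp]:
  assumes "t \<in> carrier HH"
  shows "tensor_to_smash (smash_to_tensor t) = t"
proof (rule tensor_linear_ext[where U = HH, OF module_C module_C _ _ _ _ assms])
  fix a b assume ab: "a \<in> carrier H" "b \<in> carrier H"
  have "tensor_to_smash (smash_to_tensor (pt a b)) =
      sw HH (\<lambda>a1 a2. tensor_to_smash (pt a1 (S a2 \<otimes>\<^bsub>H\<^esub> b))) a"
    using ab by (simp add: smash_to_tensor_pure linear_sw[OF _ _ linear_tensor_to_smash])
  also have "\<dots> = sw HH (\<lambda>a1 a2. sw HH (\<lambda>x y. pt x (y \<otimes>\<^bsub>H\<^esub> (S a2 \<otimes>\<^bsub>H\<^esub> b))) a1) a"
    using ab by (intro sw_cong) (simp_all add: tensor_to_smash_pure)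
  also have "\<dots> = pt a b"
    using ab by (intro twist_untwist) (simp_all add: antipode_right)
  finally show "tensor_to_smash (smash_to_tensor (pt a b)) = pt a b" .
qed simp_all

lemma smash_to_tensor_inverse [simp]:
  assumes "t \<in> carrier HH"
  shows "smash_to_tensor (tensor_to_smash t) = t"
proof (rule tensor_linear_ext[where U = HH, OF module_C module_C _ _ _ _ assms])
  fix a b assume ab: "a \<in> carrier H" "b \<in> carrier H"
  have "smash_to_tensor (tensor_to_smash (pt a b)) =
      sw HH (\<lambda>a1 a2. smash_to_tensor (pt a1 (a2 \<otimes>\<^bsub>H\<^esub> b))) a"
    using ab by (simp add: tensor_to_smash_pure linear_sw[OF _ _ linear_smash_to_tensor])
  also have "\<dots> = sw HH (\<lambda>a1 a2. sw HH (\<lambda>x y. pt x (S y \<otimes>\<^bsub>H\<^esub> (a2 \<otimes>\<^bsub>H\<^esub> b))) a1) a"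
    using ab by (intro sw_cong) (simp_all add: smash_to_tensor_pure)
  also have "\<dots> = pt a b"
    using ab by (intro twist_untwist) (simp_all add: antipode_left)
  finally show "smash_to_tensor (tensor_to_smash (pt a b)) = pt a b" .
qed simp_all

section \<open>The smash structure as the transported tensor product structure\<close>

lemma linear_smash_comult: "linear_map K HH W (smash_comult K H comult S)"
  unfolding smash_comult_def Let_def sweedler4_def sweedler3_def by simp

lemma smash_comult_pure:
  assumes "a \<in> carrier H" "b \<in> carrier H"
  shows "smash_comult K H comult S (pt a b) = sw W (\<lambda>a1 w1. sw W (\<lambda>a2 w2. sw W (\<lambda>a3 a4.
    sw W (\<lambda>b1 b2. pT (pt a1 (a2 \<otimes>\<^bsub>H\<^esub> S a4 \<otimes>\<^bsub>H\<^esub> b1)) (pt a3 b2)) b) w2) w1) a"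
  unfolding smash_comult_def Let_def sweedler4_def sweedler3_def using assms by (simp add: tensor_lift_pure_tensor)

text \<open>Since \<open>S\<close> reverses coproducts, twisting and then splitting yields
  \<open>c1 \<otimes> S(c4) b1\<close> and \<open>c2 \<otimes> S(c3) b2\<close>. Untwisting the
  second tensor undoes the twist of the inner legs; untwisting the first supplies the factor in
  front of \<open>S(c4)\<close>.\<close>

lemma smash_comult_eq:
  assumes "t \<in> carrier HH"
  shows "smash_comult K H comult S t =
    tensor_map K HH HH tensor_to_smash tensor_to_smash (HH.tcomult (smash_to_tensor t))"
proof (rule tensor_linear_ext[where U = W, OF module_C module_C _ linear_smash_comult _ _ assms])
  show "linear_map K HH W (\<lambda>t. tensor_map K HH HH tensor_to_smash tensor_to_smash (HH.tcomult (smash_to_tensor t)))"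
    unfolding tensor_map_def
    by (rule linear_map_comp[where V = W]) (simp_all add: linear_tensor_to_smash)
  let ?\<Psi> = tensor_to_smash
  let ?F = "\<lambda>x y. pT (?\<Psi> x) (?\<Psi> y)"
  fix a b assume ab [simp]: "a \<in> carrier H" "b \<in> carrier H"
  have "tensor_map K HH HH ?\<Psi> ?\<Psi> (HH.tcomult (smash_to_tensor (pt a b))) =
      HH.T.sw W ?F (sw HH (\<lambda>u v. pt u (S v \<otimes>\<^bsub>H\<^esub> b)) a)"
    by (simp add: smash_to_tensor_pure tensor_map_def sweedler2_def)
  also have "\<dots> = sw W (\<lambda>u v. HH.T.sw W ?F (pt u (S v \<otimes>\<^bsub>H\<^esub> b))) a"
    by (intro linear_sw) simp_all
  also have "\<dots> = sw W (\<lambda>u v. sw W (\<lambda>c1 c2. sw W (\<lambda>z1 z2. ?F (pt c1 z1) (pt c2 z2)) (S v \<otimes>\<^bsub>H\<^esub> b)) u) a"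
    by (intro sw_cong[OF refl] HH.tensor_sw_pure) simp_all
  also have "\<dots> = sw W (\<lambda>u v. sw W (\<lambda>c1 c2. sw W (\<lambda>p q. sw W (\<lambda>b1 b2.
      ?F (pt c1 (p \<otimes>\<^bsub>H\<^esub> b1)) (pt c2 (q \<otimes>\<^bsub>H\<^esub> b2))) b) (S v)) u) a"
    by (intro sw_cong[OF refl] sw_mult) simp_all
  also have "\<dots> = sw W (\<lambda>u v. sw W (\<lambda>c1 c2. sw W (\<lambda>c3 c4. sw W (\<lambda>b1 b2.
      ?F (pt c1 (S c4 \<otimes>\<^bsub>H\<^esub> b1)) (pt c2 (S c3 \<otimes>\<^bsub>H\<^esub> b2))) b) v) u) a"
    by (intro sw_cong[OF refl] sw_antipode) simp_all
  \<comment> \<open>Now \<open>c2\<close> and \<open>c3\<close> are legs of \<open>m\<close>. Once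
    the sum over \<open>b\<close> is moved outwards, the second factor is the untwisting of
    \<open>smash_to_tensor (pt m b2)\<close>.\<close>
  also have "\<dots> = sw W (\<lambda>c1 w. sw W (\<lambda>m c4. sw W (\<lambda>c2 c3. sw W (\<lambda>b1 b2.
      ?F (pt c1 (S c4 \<otimes>\<^bsub>H\<^esub> b1)) (pt c2 (S c3 \<otimes>\<^bsub>H\<^esub> b2))) b) m) w) a"
    by (intro sw_bracket) simp_all
  also have "\<dots> = sw W (\<lambda>c1 w. sw W (\<lambda>m c4. sw W (\<lambda>b1 b2. sw W (\<lambda>c2 c3.
      ?F (pt c1 (S c4 \<otimes>\<^bsub>H\<^esub> b1)) (pt c2 (S c3 \<otimes>\<^bsub>H\<^esub> b2))) m) b) w) a"
    by (intro sw_cong[OF refl] sw_swap[OF comultiplication_axioms]) simp_all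
  also have "\<dots> = sw W (\<lambda>c1 w. sw W (\<lambda>m c4. sw W (\<lambda>b1 b2.
      pT (?\<Psi> (pt c1 (S c4 \<otimes>\<^bsub>H\<^esub> b1))) (?\<Psi> (smash_to_tensor (pt m b2)))) b) w) a"
  proof (intro sw_cong[OF refl])
    fix c1 w m c4 b1 b2 assume [simp]: "c1 \<in> carrier H" "c4 \<in> carrier H" "m \<in> carrier H" "b1 \<in> carrier H" "b2 \<in> carrier H"
    show "sw W (\<lambda>c2 c3. ?F (pt c1 (S c4 \<otimes>\<^bsub>H\<^esub> b1)) (pt c2 (S c3 \<otimes>\<^bsub>H\<^esub> b2))) m =
        pT (?\<Psi> (pt c1 (S c4 \<otimes>\<^bsub>H\<^esub> b1))) (?\<Psi> (smash_to_tensor (pt m b2)))"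
      unfolding smash_to_tensor_pure[OF \<open>m \<in> carrier H\<close> \<open>b2 \<in> carrier H\<close>]
      by (intro linear_sw[where g = "\<lambda>t. pT _ (?\<Psi> t)", symmetric]) simp_all
  qed simp_all
  \<comment> \<open>In the second factor the two maps cancel; in the first, \<open>?\<Psi>\<close>
    splits \<open>c1\<close> into \<open>x\<close> and \<open>y\<close> and multiplies
    \<open>y\<close> in.\<close>
  also have "\<dots> = sw W (\<lambda>c1 w. sw W (\<lambda>m c4. sw W (\<lambda>b1 b2. sw W (\<lambda>x y.
      pT (pt x (y \<otimes>\<^bsub>H\<^esub> (S c4 \<otimes>\<^bsub>H\<^esub> b1))) (pt m b2)) c1) b) w) a"
  proof (intro sw_cong[OF refl])
    fix c1 w m c4 b1 b2 assume [simp]: "c1 \<in> carrier H" "c4 \<in> carrier H" "m \<in> carrier H" "b1 \<in> carrier H" "b2 \<in> carrier H"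
    have "pT (sw HH (\<lambda>x y. pt x (y \<otimes>\<^bsub>H\<^esub> (S c4 \<otimes>\<^bsub>H\<^esub> b1))) c1) (pt m b2) =
        sw W (\<lambda>x y. pT (pt x (y \<otimes>\<^bsub>H\<^esub> (S c4 \<otimes>\<^bsub>H\<^esub> b1))) (pt m b2)) c1"
      by (intro linear_sw) simp_all
    then show "pT (?\<Psi> (pt c1 (S c4 \<otimes>\<^bsub>H\<^esub> b1))) (?\<Psi> (smash_to_tensor (pt m b2))) =
        sw W (\<lambda>x y. pT (pt x (y \<otimes>\<^bsub>H\<^esub> (S c4 \<otimes>\<^bsub>H\<^esub> b1))) (pt m b2)) c1"
      by (simp add: tensor_to_smash_pure)
  qed simp_all
  also have "\<dots> = sw W (\<lambda>c1 w. sw W (\<lambda>m c4. sw W (\<lambda>x y. sw W (\<lambda>b1 b2.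
      pT (pt x (y \<otimes>\<^bsub>H\<^esub> (S c4 \<otimes>\<^bsub>H\<^esub> b1))) (pt m b2)) b) c1) w) a"
    by (intro sw_cong[OF refl] sw_swap[OF comultiplication_axioms]) simp_all
  also have "\<dots> = sw W (\<lambda>c1 w. sw W (\<lambda>x y. sw W (\<lambda>m c4. sw W (\<lambda>b1 b2.
      pT (pt x (y \<otimes>\<^bsub>H\<^esub> (S c4 \<otimes>\<^bsub>H\<^esub> b1))) (pt m b2)) b) w) c1) a"
    by (intro sw_cong[OF refl] sw_swap[OF comultiplication_axioms]) simp_all
  \<comment> \<open>Coassociativity puts the legs in order: \<open>x\<close>, \<open>y\<close>,
    \<open>m\<close>, \<open>c4\<close> are \<open>a1\<close>, \<open>a2\<close>, \<open>a3\<close>,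
    \<open>a4\<close> of the smash formula.\<close>
  also have "\<dots> = sw W (\<lambda>x w. sw W (\<lambda>y w. sw W (\<lambda>m c4. sw W (\<lambda>b1 b2.
      pT (pt x (y \<otimes>\<^bsub>H\<^esub> (S c4 \<otimes>\<^bsub>H\<^esub> b1))) (pt m b2)) b) w) w) a"
    by (intro sw_coassoc) simp_all
  also have "\<dots> = smash_comult K H comult S (pt a b)"
    unfolding smash_comult_pure[OF ab] by (intro sw_cong[OF refl]) (simp_all add: H.m_assoc)
  finally show "smash_comult K H comult S (pt a b) =
    tensor_map K HH HH ?\<Psi> ?\<Psi> (HH.tcomult (smash_to_tensor (pt a b)))" ..
qed simp

lemma smash_counit_eq:
  assumes "t \<in> carrier HH"
  shows "smash_counit K counit t = tensor_counit K counit counit (smash_to_tensor t)"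
proof (rule tensor_linear_ext[where U = "ground_module K", OF module_C module_C _ _ _ _ assms])
  \<comment> \<open>Both counits are given by the same formula, so the claim is that the twist
    preserves it; this comes down to the antipode preserving the counit of \<open>H\<close>.\<close>
  have eq: "smash_counit K counit = tensor_counit K counit counit"
    by (simp add: smash_counit_def tensor_counit_def)
  show "linear_map K HH (ground_module K) (smash_counit K counit)"
    unfolding eq by (rule HH.T.counit_linear)
  let ?k = "ground_module K"
  fix a b assume ab [simp]: "a \<in> carrier H" "b \<in> carrier H"
  have \<epsilon>: "tensor_counit K counit counit (pt x y) = counit x \<odot>\<^bsub>?k\<^esub> counit y"
    if "x \<in> carrier H" "y \<in> carrier H" for x y
    using that by (simp add: tensor_counit_def tensor_lift_pure_tensor) (simp add: ground_module_def)
  have "tensor_counit K counit counit (smash_to_tensor (pt a b)) =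
      sw ?k (\<lambda>x y. tensor_counit K counit counit (pt x (S y \<otimes>\<^bsub>H\<^esub> b))) a"
    by (simp add: smash_to_tensor_pure linear_sw[OF _ _ HH.T.counit_linear])
  also have "\<dots> = sw ?k (\<lambda>x y. counit x \<odot>\<^bsub>?k\<^esub> counit (y \<otimes>\<^bsub>H\<^esub> b)) a"
    by (intro sw_cong) (simp_all add: \<epsilon> counit_mult counit_antipode)
  also have "\<dots> = counit (a \<otimes>\<^bsub>H\<^esub> b)"
    by (intro sw_counit_left) simp_all
  also have "\<dots> = smash_counit K counit (pt a b)"
    unfolding eq by (simp add: \<epsilon> counit_mult ground_module_def)
  finally show "smash_counit K counit (pt a b) = tensor_counit K counit counit (smash_to_tensor (pt a b))" ..
qed simp_all

text \<open>At this point the smash structure becomes a coalgebra: all its laws come from the tensor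
  product coalgebra along the isomorphism.\<close>

sublocale smash: coalgebra_transport K HH HH.tcomult "tensor_counit K counit counit" HH
  smash_to_tensor tensor_to_smash "smash_comult K H comult S" "smash_counit K counit"
  by (intro coalgebra_transport.intro coalgebra_transport_axioms.intro HH.T.coalgebra_axioms)
    (simp_all add: linear_smash_to_tensor linear_tensor_to_smash smash_comult_eq smash_counit_eq)

section \<open>The two projections onto \<open>H\<close>, their sections and the Rota-Baxter
  identity\<close>

definition "proj1 = tensor_lift K H (\<lambda>a b. counit b \<odot>\<^bsub>H\<^esub> a)"
definition "proj2 = tensor_lift K H (\<lambda>a b. counit a \<odot>\<^bsub>H\<^esub> b)"
text \<open>This is the twist of \<open>h \<otimes> 1\<close>, which is how it arises from
  \<open>P1\<close>. Flipping the factors and reversing the legs gives \<open>sect2\<close>.\<close>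

definition "sect1 = sw HH (\<lambda>a1 a2. pt a1 (S a2))"
definition "sect2 = sw HH (\<lambda>b1 b2. pt (S b1) b2)"

lemma linear_proj1: "linear_map K HH H proj1" and linear_proj2: "linear_map K HH H proj2"
  by (simp_all add: proj1_def proj2_def)

lemma linear_sect1: "linear_map K H HH sect1" and linear_sect2: "linear_map K H HH sect2"
  using linear_sw_arg[of HH H "\<lambda>x. x"] by (simp_all add: sect1_def sect2_def)

lemmas proj_sect_simps [simp] =
  linear_proj1[THEN linear_map_comp] linear_proj2[THEN linear_map_comp]
  linear_sect1[THEN linear_map_comp] linear_sect2[THEN linear_map_comp]
  linear_proj1[THEN linear_map_closed] linear_proj2[THEN linear_map_closed]
  linear_sect1[THEN linear_map_closed] linear_sect2[THEN linear_map_closed]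

lemma proj1_pure: "\<lbrakk>a \<in> carrier H; b \<in> carrier H\<rbrakk> \<Longrightarrow> proj1 (pt a b) = counit b \<odot>\<^bsub>H\<^esub> a"
  and proj2_pure: "\<lbrakk>a \<in> carrier H; b \<in> carrier H\<rbrakk> \<Longrightarrow> proj2 (pt a b) = counit a \<odot>\<^bsub>H\<^esub> b"
  by (simp_all add: proj1_def proj2_def tensor_lift_pure_tensor)

lemma proj1_sect1 [simp]:
  assumes [simp]: "h \<in> carrier H"
  shows "proj1 (sect1 h) = h"
proof -
  have "proj1 (sect1 h) = sw H (\<lambda>x y. proj1 (pt x (S y))) h"
    unfolding sect1_def by (intro linear_sw linear_proj1) simp_all
  also have "\<dots> = sw H (\<lambda>x y. counit y \<odot>\<^bsub>H\<^esub> x) h"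
    by (intro sw_cong) (simp_all add: proj1_pure counit_antipode)
  also have "\<dots> = h" by (intro sw_counit_right) simp_all
  finally show ?thesis .
qed

lemma proj2_sect2 [simp]:
  assumes [simp]: "h \<in> carrier H"
  shows "proj2 (sect2 h) = h"
proof -
  have "proj2 (sect2 h) = sw H (\<lambda>x y. proj2 (pt (S x) y)) h"
    unfolding sect2_def by (intro linear_sw linear_proj2) simp_all
  also have "\<dots> = sw H (\<lambda>x y. counit x \<odot>\<^bsub>H\<^esub> y) h"
    by (intro sw_cong) (simp_all add: proj2_pure counit_antipode)
  also have "\<dots> = h" by (intro sw_counit_left) simp_all
  finally show ?thesis .
qed

lemma proj1_comult:
  assumes "t \<in> carrier HH"
  shows "tensor_map K H H proj1 proj1 (HH.tcomult t) = comult (proj1 t)"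
proof -
  have "HH.T.sw HH (\<lambda>x y. pt (proj1 x) (proj1 y)) t = comult (proj1 t)"
  proof (rule tensor_linear_ext[where U = HH, OF module_C module_C _ _ _ _ assms])
    fix a b assume [simp]: "a \<in> carrier H" "b \<in> carrier H"
    have "HH.T.sw HH (\<lambda>x y. pt (proj1 x) (proj1 y)) (pt a b) =
        sw HH (\<lambda>a1 a2. sw HH (\<lambda>b1 b2. pt (proj1 (pt a1 b1)) (proj1 (pt a2 b2))) b) a"
      by (intro HH.tensor_sw_pure) simp_all
    also have "\<dots> = sw HH (\<lambda>a1 a2. sw HH (\<lambda>b1 b2. counit b1 \<odot>\<^bsub>HH\<^esub> pt a1 (counit b2 \<odot>\<^bsub>H\<^esub> a2)) b) a"
      by (intro sw_cong) (simp_all add: proj1_pure linear_map_smult[OF linear_pure_tensor_left])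
    also have "\<dots> = sw HH (\<lambda>a1 a2. pt a1 (counit b \<odot>\<^bsub>H\<^esub> a2)) a"
      by (intro sw_cong[OF refl] sw_counit_left) simp_all
    also have "\<dots> = sw HH (\<lambda>a1 a2. counit b \<odot>\<^bsub>HH\<^esub> pt a1 a2) a"
      by (intro sw_cong) (simp_all add: linear_map_smult[OF linear_pure_tensor_right])
    also have "\<dots> = counit b \<odot>\<^bsub>HH\<^esub> comult a"
      unfolding comult_eq_sw[OF \<open>a \<in> carrier H\<close>] by (intro linear_sw[symmetric]) simp_all
    also have "\<dots> = comult (proj1 (pt a b))"
      by (simp add: proj1_pure linear_map_smult[OF comult_linear])
    finally show "HH.T.sw HH (\<lambda>x y. pt (proj1 x) (proj1 y)) (pt a b) = comult (proj1 (pt a b))" .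
  qed simp_all
  then show ?thesis by (simp add: tensor_map_def sweedler2_def)
qed

lemma proj2_comult:
  assumes "t \<in> carrier HH"
  shows "tensor_map K H H proj2 proj2 (HH.tcomult t) = comult (proj2 t)"
proof -
  have "HH.T.sw HH (\<lambda>x y. pt (proj2 x) (proj2 y)) t = comult (proj2 t)"
  proof (rule tensor_linear_ext[where U = HH, OF module_C module_C _ _ _ _ assms])
    fix a b assume [simp]: "a \<in> carrier H" "b \<in> carrier H"
    have "HH.T.sw HH (\<lambda>x y. pt (proj2 x) (proj2 y)) (pt a b) =
        sw HH (\<lambda>a1 a2. sw HH (\<lambda>b1 b2. pt (proj2 (pt a1 b1)) (proj2 (pt a2 b2))) b) a"
      by (intro HH.tensor_sw_pure) simp_all
    also have "\<dots> = sw HH (\<lambda>a1 a2. sw HH (\<lambda>b1 b2. counit a1 \<odot>\<^bsub>HH\<^esub> pt b1 (counit a2 \<odot>\<^bsub>H\<^esub> b2)) b) a"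
      by (intro sw_cong) (simp_all add: proj2_pure linear_map_smult[OF linear_pure_tensor_left])
    \<comment> \<open>Unlike for \<open>proj1\<close>, the scalar comes from the outer sum and has
      to leave the sum over \<open>b\<close> before the counit law in \<open>a\<close>
      applies.\<close>
    also have "\<dots> = sw HH (\<lambda>a1 a2. counit a1 \<odot>\<^bsub>HH\<^esub> sw HH (\<lambda>b1 b2. pt b1 (counit a2 \<odot>\<^bsub>H\<^esub> b2)) b) a"
      by (intro sw_cong[OF refl] linear_sw[symmetric]) simp_all
    also have "\<dots> = sw HH (\<lambda>b1 b2. pt b1 (counit a \<odot>\<^bsub>H\<^esub> b2)) b"
      by (intro sw_counit_left) simp_all
    also have "\<dots> = sw HH (\<lambda>b1 b2. counit a \<odot>\<^bsub>HH\<^esub> pt b1 b2) b"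
      by (intro sw_cong) (simp_all add: linear_map_smult[OF linear_pure_tensor_right])
    also have "\<dots> = counit a \<odot>\<^bsub>HH\<^esub> comult b"
      unfolding comult_eq_sw[OF \<open>b \<in> carrier H\<close>] by (intro linear_sw[symmetric]) simp_all
    also have "\<dots> = comult (proj2 (pt a b))"
      by (simp add: proj2_pure linear_map_smult[OF comult_linear])
    finally show "HH.T.sw HH (\<lambda>x y. pt (proj2 x) (proj2 y)) (pt a b) = comult (proj2 (pt a b))" .
  qed simp_all
  then show ?thesis by (simp add: tensor_map_def sweedler2_def)
qed

text \<open>The reversal by \<open>S\<close> nests the legs: the second argument of \<open>F\<close>
  carries the inner pair, whose sum over the legs of \<open>m\<close> has the shape of
  \<open>sect1 m\<close>.\<close>

lemma sw_sect1:
  assumes "module K U" "h \<in> carrier H"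
    and "\<And>x. x \<in> carrier HH \<Longrightarrow> linear_map K HH U (F x)"
    and "\<And>y. y \<in> carrier HH \<Longrightarrow> linear_map K HH U (\<lambda>x. F x y)"
  shows "HH.T.sw U F (sect1 h) = sw U (\<lambda>c1 w. sw U (\<lambda>m c4. sw U (\<lambda>c2 c3. F (pt c1 (S c4)) (pt c2 (S c3))) m) w) h"
proof -
  note [simp] = assms linear_map_comp[OF assms(3)] linear_map_comp[OF assms(4)]
  have "HH.T.sw U F (sect1 h) = sw U (\<lambda>u v. HH.T.sw U F (pt u (S v))) h"
    unfolding sect1_def by (intro linear_sw) simp_all
  also have "\<dots> = sw U (\<lambda>u v. sw U (\<lambda>c1 c2. sw U (\<lambda>y1 y2. F (pt c1 y1) (pt c2 y2)) (S v)) u) h"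
    by (intro sw_cong[OF refl] HH.tensor_sw_pure) simp_all
  also have "\<dots> = sw U (\<lambda>u v. sw U (\<lambda>c1 c2. sw U (\<lambda>c3 c4. F (pt c1 (S c4)) (pt c2 (S c3))) v) u) h"
    by (intro sw_cong[OF refl] sw_antipode) simp_all
  also have "\<dots> = sw U (\<lambda>c1 w. sw U (\<lambda>m c4. sw U (\<lambda>c2 c3. F (pt c1 (S c4)) (pt c2 (S c3))) m) w) h"
    by (intro sw_bracket) simp_all
  finally show ?thesis .
qed

text \<open>The same nesting as for \<open>sect1\<close>, but now the first argument of
  \<open>F\<close> carries the inner pair. This is the source of the opposite orders in the two
  Rota-Baxter proofs.\<close>

lemma sw_sect2:
  assumes "module K U" "h \<in> carrier H"
    and "\<And>x. x \<in> carrier HH \<Longrightarrow> linear_map K HH U (F x)"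
    and "\<And>y. y \<in> carrier HH \<Longrightarrow> linear_map K HH U (\<lambda>x. F x y)"
  shows "HH.T.sw U F (sect2 h) = sw U (\<lambda>c1 w. sw U (\<lambda>m c4. sw U (\<lambda>c2 c3. F (pt (S c2) c3) (pt (S c1) c4)) m) w) h"
proof -
  note [simp] = assms linear_map_comp[OF assms(3)] linear_map_comp[OF assms(4)]
  have "HH.T.sw U F (sect2 h) = sw U (\<lambda>u v. HH.T.sw U F (pt (S u) v)) h"
    unfolding sect2_def by (intro linear_sw) simp_all
  also have "\<dots> = sw U (\<lambda>u v. sw U (\<lambda>x1 x2. sw U (\<lambda>y1 y2. F (pt x1 y1) (pt x2 y2)) v) (S u)) h"
    by (intro sw_cong[OF refl] HH.tensor_sw_pure) simp_all
  also have "\<dots> = sw U (\<lambda>u v. sw U (\<lambda>c1 c2. sw U (\<lambda>c3 c4. F (pt (S c2) c3) (pt (S c1) c4)) v) u) h"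
    by (intro sw_cong[OF refl] sw_antipode) simp_all
  also have "\<dots> = sw U (\<lambda>c1 w. sw U (\<lambda>m c4. sw U (\<lambda>c2 c3. F (pt (S c2) c3) (pt (S c1) c4)) m) w) h"
    by (intro sw_bracket) simp_all
  finally show ?thesis .
qed

lemma rota_baxter_sect1:
  "idempotent_rota_baxter_coalgebra K HH HH.tcomult (tensor_counit K counit counit)
    (\<lambda>t. sect1 (proj1 t)) (\<ominus>\<^bsub>K\<^esub> \<one>\<^bsub>K\<^esub>)"
proof (rule HH.T.idempotent_rota_baxter_sectionI[OF comultiplication_axioms linear_proj1 linear_sect1
      proj1_sect1 proj1_comult])
  fix h assume h [simp]: "h \<in> carrier H"
  have \<Delta>: "HH.tcomult (sect1 h) =
      sw W (\<lambda>c1 w. sw W (\<lambda>m c4. sw W (\<lambda>c2 c3. pT (pt c1 (S c4)) (pt c2 (S c3))) m) w) h"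
    by (subst HH.T.comult_eq_sw; (subst sw_sect1)?) simp_all
  have fold_sect1: "sw W (\<lambda>c2 c3. pT t (pt c2 (S c3))) m = pT t (sect1 m)"
    if "t \<in> carrier HH" "m \<in> carrier H" for t m
    unfolding sect1_def using that by (intro linear_sw[symmetric]) simp_all
  have proj: "sect1 (proj1 (pt a (S b))) = counit b \<odot>\<^bsub>HH\<^esub> sect1 a" if "a \<in> carrier H" "b \<in> carrier H" for a b
    using that by (simp add: proj1_pure counit_antipode linear_map_smult[OF linear_sect1])
  have "HH.T.sw W (\<lambda>x y. pT x (sect1 (proj1 y))) (sect1 h) =
      sw W (\<lambda>c1 w. sw W (\<lambda>m c4. sw W (\<lambda>c2 c3. pT (pt c1 (S c4)) (sect1 (proj1 (pt c2 (S c3))))) m) w) h"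
    by (intro sw_sect1) simp_all
  \<comment> \<open>On the inner pair the projection kills \<open>c3\<close>, so the sum over
    \<open>m\<close> yields \<open>sect1 m\<close>, which is what stood there before: this operator
    fixes the coproduct.\<close>
  also have "\<dots> = sw W (\<lambda>c1 w. sw W (\<lambda>m c4. sw W (\<lambda>c2 c3. counit c3 \<odot>\<^bsub>W\<^esub> pT (pt c1 (S c4)) (sect1 c2)) m) w) h"
    by (intro sw_cong) (simp_all add: proj linear_map_smult[OF linear_pure_tensor_right])
  also have "\<dots> = sw W (\<lambda>c1 w. sw W (\<lambda>m c4. pT (pt c1 (S c4)) (sect1 m)) w) h"
    by (intro sw_cong[OF refl] sw_counit_right) simp_all
  also have "\<dots> = HH.tcomult (sect1 h)"
    unfolding \<Delta> by (intro sw_cong[OF refl] fold_sect1[symmetric]) simp_all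
  finally have 1: "HH.T.sw W (\<lambda>x y. pT x (sect1 (proj1 y))) (sect1 h) = HH.tcomult (sect1 h)" .
  have "HH.T.sw W (\<lambda>x y. pT (sect1 (proj1 x)) y) (sect1 h) =
      sw W (\<lambda>c1 w. sw W (\<lambda>m c4. sw W (\<lambda>c2 c3. pT (sect1 (proj1 (pt c1 (S c4)))) (pt c2 (S c3))) m) w) h"
    by (intro sw_sect1) simp_all
  also have "\<dots> = sw W (\<lambda>c1 w. sw W (\<lambda>m c4. pT (sect1 (proj1 (pt c1 (S c4)))) (sect1 m)) w) h"
    by (intro sw_cong[OF refl] fold_sect1) simp_all
  \<comment> \<open>On the outer pair the projection kills \<open>c4\<close> and leaves
    \<open>sect1 c1\<close>; the counit law then reduces the legs to \<open>c1\<close> and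
    \<open>m\<close>, now the two legs of \<open>h\<close>.\<close>
  also have "\<dots> = sw W (\<lambda>c1 w. sw W (\<lambda>m c4. counit c4 \<odot>\<^bsub>W\<^esub> pT (sect1 c1) (sect1 m)) w) h"
    by (intro sw_cong) (simp_all add: proj linear_map_smult[OF linear_pure_tensor_left])
  also have "\<dots> = sw W (\<lambda>x y. pT (sect1 x) (sect1 y)) h"
    by (intro sw_cong[OF refl] sw_counit_right) simp_all
  finally have 2: "HH.T.sw W (\<lambda>x y. pT (sect1 (proj1 x)) y) (sect1 h) = sw W (\<lambda>x y. pT (sect1 x) (sect1 y)) h" .
  show "{HH.T.sw W (\<lambda>x y. pT x (sect1 (proj1 y))) (sect1 h), HH.T.sw W (\<lambda>x y. pT (sect1 (proj1 x)) y) (sect1 h)} =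
    {HH.tcomult (sect1 h), sw W (\<lambda>x y. pT (sect1 x) (sect1 y)) h}"
    by (simp only: 1 2)
qed

lemma rota_baxter_sect2:
  "idempotent_rota_baxter_coalgebra K HH HH.tcomult (tensor_counit K counit counit)
    (\<lambda>t. sect2 (proj2 t)) (\<ominus>\<^bsub>K\<^esub> \<one>\<^bsub>K\<^esub>)"
proof (rule HH.T.idempotent_rota_baxter_sectionI[OF comultiplication_axioms linear_proj2 linear_sect2
      proj2_sect2 proj2_comult])
  fix h assume h [simp]: "h \<in> carrier H"
  have \<Delta>: "HH.tcomult (sect2 h) =
      sw W (\<lambda>c1 w. sw W (\<lambda>m c4. sw W (\<lambda>c2 c3. pT (pt (S c2) c3) (pt (S c1) c4)) m) w) h"
    by (subst HH.T.comult_eq_sw; (subst sw_sect2)?) simp_all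
  have fold_sect2: "sw W (\<lambda>c2 c3. pT (pt (S c2) c3) t) m = pT (sect2 m) t"
    if "t \<in> carrier HH" "m \<in> carrier H" for t m
    unfolding sect2_def using that by (intro linear_sw[where g = "\<lambda>x. pT x t", symmetric]) simp_all
  have proj: "sect2 (proj2 (pt (S a) b)) = counit a \<odot>\<^bsub>HH\<^esub> sect2 b" if "a \<in> carrier H" "b \<in> carrier H" for a b
    using that by (simp add: proj2_pure counit_antipode linear_map_smult[OF linear_sect2])
  have "HH.T.sw W (\<lambda>x y. pT x (sect2 (proj2 y))) (sect2 h) =
      sw W (\<lambda>c1 w. sw W (\<lambda>m c4. sw W (\<lambda>c2 c3. pT (pt (S c2) c3) (sect2 (proj2 (pt (S c1) c4)))) m) w) h"
    by (intro sw_sect2) simp_all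
  also have "\<dots> = sw W (\<lambda>c1 w. sw W (\<lambda>m c4. pT (sect2 m) (sect2 (proj2 (pt (S c1) c4)))) w) h"
    by (intro sw_cong[OF refl] fold_sect2) simp_all
  also have "\<dots> = sw W (\<lambda>c1 w. sw W (\<lambda>m c4. counit c1 \<odot>\<^bsub>W\<^esub> pT (sect2 m) (sect2 c4)) w) h"
    by (intro sw_cong) (simp_all add: proj linear_map_smult[OF linear_pure_tensor_right])
  \<comment> \<open>The surviving counit sits on the outermost leg \<open>c1\<close>, so it is moved
    in front of the inner sum to meet the left counit law.\<close>
  also have "\<dots> = sw W (\<lambda>c1 w. counit c1 \<odot>\<^bsub>W\<^esub> sw W (\<lambda>m c4. pT (sect2 m) (sect2 c4)) w) h"
    by (intro sw_cong[OF refl] linear_sw[symmetric]) simp_all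
  also have "\<dots> = sw W (\<lambda>x y. pT (sect2 x) (sect2 y)) h"
    by (intro sw_counit_left) (use linear_sw_arg[of W H "\<lambda>x. x"] in simp_all)
  finally have 1: "HH.T.sw W (\<lambda>x y. pT x (sect2 (proj2 y))) (sect2 h) = sw W (\<lambda>x y. pT (sect2 x) (sect2 y)) h" .
  have "HH.T.sw W (\<lambda>x y. pT (sect2 (proj2 x)) y) (sect2 h) =
      sw W (\<lambda>c1 w. sw W (\<lambda>m c4. sw W (\<lambda>c2 c3. pT (sect2 (proj2 (pt (S c2) c3))) (pt (S c1) c4)) m) w) h"
    by (intro sw_sect2) simp_all
  also have "\<dots> = sw W (\<lambda>c1 w. sw W (\<lambda>m c4. sw W (\<lambda>c2 c3. counit c2 \<odot>\<^bsub>W\<^esub> pT (sect2 c3) (pt (S c1) c4)) m) w) h"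
    by (intro sw_cong) (simp_all add: proj linear_map_smult[OF linear_pure_tensor_left])
  also have "\<dots> = sw W (\<lambda>c1 w. sw W (\<lambda>m c4. pT (sect2 m) (pt (S c1) c4)) w) h"
    by (intro sw_cong[OF refl] sw_counit_left) simp_all
  also have "\<dots> = HH.tcomult (sect2 h)"
    unfolding \<Delta> by (intro sw_cong[OF refl] fold_sect2[symmetric]) simp_all
  finally have 2: "HH.T.sw W (\<lambda>x y. pT (sect2 (proj2 x)) y) (sect2 h) = HH.tcomult (sect2 h)" .
  show "{HH.T.sw W (\<lambda>x y. pT x (sect2 (proj2 y))) (sect2 h), HH.T.sw W (\<lambda>x y. pT (sect2 (proj2 x)) y) (sect2 h)} =
    {HH.tcomult (sect2 h), sw W (\<lambda>x y. pT (sect2 x) (sect2 y)) h}"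
    \<comment> \<open>Here it is the operator acting on the first factor that fixes the coproduct,
      hence the exchange within the pair.\<close>
    by (simp only: 1 2 insert_commute)
qed

text \<open>The first projection of a twisted \<open>a \<otimes> b\<close> is
  \<open>\<epsilon>(b) a\<close>, because the antipode preserves the counit; and
  \<open>sect1\<close> is the twist of \<open>h \<otimes> 1\<close>, which
  \<open>tensor_to_smash\<close> undoes.\<close>

lemma P1_eq:
  assumes "t \<in> carrier HH"
  shows "P1 K H counit t = tensor_to_smash (sect1 (proj1 (smash_to_tensor t)))"
proof (rule tensor_linear_ext[where U = HH, OF module_C module_C _ _ _ _ assms])
  show "linear_map K HH HH (P1 K H counit)"
    unfolding P1_def by simp
  fix a b assume [simp]: "a \<in> carrier H" "b \<in> carrier H"
  have "proj1 (smash_to_tensor (pt a b)) = sw H (\<lambda>x y. proj1 (pt x (S y \<otimes>\<^bsub>H\<^esub> b))) a"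
    by (simp add: smash_to_tensor_pure linear_sw[OF _ _ linear_proj1])
  also have "\<dots> = sw H (\<lambda>x y. counit y \<odot>\<^bsub>H\<^esub> (counit b \<odot>\<^bsub>H\<^esub> x)) a"
    by (intro sw_cong) (simp_all add: proj1_pure counit_mult counit_antipode C.smult_assoc1)
  also have "\<dots> = counit b \<odot>\<^bsub>H\<^esub> a"
    by (intro sw_counit_right) simp_all
  finally have 1: "proj1 (smash_to_tensor (pt a b)) = counit b \<odot>\<^bsub>H\<^esub> a" .
  \<comment> \<open>Both sides are the same Sweedler sum, since multiplying \<open>S a2\<close> by
    the unit changes nothing.\<close>
  have "sect1 (counit b \<odot>\<^bsub>H\<^esub> a) = smash_to_tensor (pt (counit b \<odot>\<^bsub>H\<^esub> a) \<one>\<^bsub>H\<^esub>)"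
    unfolding sect1_def by (simp add: smash_to_tensor_pure cong: sw_cong)
  then have "tensor_to_smash (sect1 (proj1 (smash_to_tensor (pt a b)))) = pt (counit b \<odot>\<^bsub>H\<^esub> a) \<one>\<^bsub>H\<^esub>"
    by (simp add: 1)
  also have "\<dots> = P1 K H counit (pt a b)"
    by (simp add: P1_def tensor_lift_pure_tensor linear_map_smult[OF linear_pure_tensor_left]
        linear_map_smult[OF linear_pure_tensor_right])
  finally show "P1 K H counit (pt a b) = tensor_to_smash (sect1 (proj1 (smash_to_tensor (pt a b))))" ..
qed simp_all

text \<open>Untwisting splits \<open>S(u)\<close>, and the reversal of legs by \<open>S\<close> puts
  the second leg of \<open>u\<close> into the first factor and the first leg into the second. This
  is the form of \<open>P2\<close> in terms of three legs of one element.\<close>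

lemma tensor_to_smash_sect2:
  assumes [simp]: "c \<in> carrier H"
  shows "tensor_to_smash (sect2 c) = sw HH (\<lambda>z1 w. sw HH (\<lambda>z2 z3. pt (S z2) (S z1 \<otimes>\<^bsub>H\<^esub> z3)) w) c"
proof -
  have "tensor_to_smash (sect2 c) = sw HH (\<lambda>u v. tensor_to_smash (pt (S u) v)) c"
    unfolding sect2_def by (intro linear_sw linear_tensor_to_smash) simp_all
  also have "\<dots> = sw HH (\<lambda>u v. sw HH (\<lambda>x y. pt x (y \<otimes>\<^bsub>H\<^esub> v)) (S u)) c"
    by (intro sw_cong[OF refl]) (simp_all add: tensor_to_smash_pure)
  also have "\<dots> = sw HH (\<lambda>u v. sw HH (\<lambda>x y. pt (S y) (S x \<otimes>\<^bsub>H\<^esub> v)) u) c"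
    by (intro sw_cong[OF refl] sw_antipode) simp_all
  also have "\<dots> = sw HH (\<lambda>z1 w. sw HH (\<lambda>z2 z3. pt (S z2) (S z1 \<otimes>\<^bsub>H\<^esub> z3)) w) c"
    by (intro sw_coassoc) simp_all
  finally show ?thesis .
qed

text \<open>The second projection of a twisted \<open>a \<otimes> b\<close> is
  \<open>S(a) b\<close>, so the right-hand side involves three legs of \<open>S(a) b\<close>, hence
  three of \<open>a\<close>. The other two legs of \<open>a\<close> in \<open>P2\<close> cancel:
  \<open>S(a2 S(a4) b2) a3 = S(S(a4) b2) S(a2) a3\<close>, and \<open>S(a2) a3\<close> sums to a
  counit.\<close>

lemma P2_eq:
  assumes "t \<in> carrier HH"
  shows "P2 K H comult S t = tensor_to_smash (sect2 (proj2 (smash_to_tensor t)))"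
proof (rule tensor_linear_ext[where U = HH, OF module_C module_C _ _ _ _ assms])
  show "linear_map K HH HH (P2 K H comult S)"
    unfolding P2_def Let_def sweedler5_def sweedler4_def sweedler3_def by simp
  fix a b assume [simp]: "a \<in> carrier H" "b \<in> carrier H"
  have "proj2 (smash_to_tensor (pt a b)) = sw H (\<lambda>x y. proj2 (pt x (S y \<otimes>\<^bsub>H\<^esub> b))) a"
    by (simp add: smash_to_tensor_pure linear_sw[OF _ _ linear_proj2])
  also have "\<dots> = sw H (\<lambda>x y. counit x \<odot>\<^bsub>H\<^esub> (S y \<otimes>\<^bsub>H\<^esub> b)) a"
    by (intro sw_cong) (simp_all add: proj2_pure)
  also have "\<dots> = S a \<otimes>\<^bsub>H\<^esub> b"
    by (intro sw_counit_left) simp_all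
  finally have 1: "proj2 (smash_to_tensor (pt a b)) = S a \<otimes>\<^bsub>H\<^esub> b" .
  \<comment> \<open>The common normal form of both sides. The slot \<open>p\<close> holds
    \<open>S(a2) a3\<close> on the side of \<open>P2\<close> and the unit on the other side.\<close>
  let ?Y = "\<lambda>x p y z. sw HH (\<lambda>b1 v. sw HH (\<lambda>b2 b3.
    pt (S (S y \<otimes>\<^bsub>H\<^esub> b2) \<otimes>\<^bsub>H\<^esub> p) (S (S z \<otimes>\<^bsub>H\<^esub> b1) \<otimes>\<^bsub>H\<^esub> (S x \<otimes>\<^bsub>H\<^esub> b3))) v) b"
  have "tensor_to_smash (sect2 (S a \<otimes>\<^bsub>H\<^esub> b)) =
      sw HH (\<lambda>z1 w. sw HH (\<lambda>z2 z3. pt (S z2) (S z1 \<otimes>\<^bsub>H\<^esub> z3)) w) (S a \<otimes>\<^bsub>H\<^esub> b)"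
    by (rule tensor_to_smash_sect2) simp
  also have "\<dots> = sw HH (\<lambda>p q. sw HH (\<lambda>b1 v. sw HH (\<lambda>z2 z3.
      pt (S z2) (S (p \<otimes>\<^bsub>H\<^esub> b1) \<otimes>\<^bsub>H\<^esub> z3)) (q \<otimes>\<^bsub>H\<^esub> v)) b) (S a)"
    by (intro sw_mult) simp_all
  also have "\<dots> = sw HH (\<lambda>u z. sw HH (\<lambda>b1 v. sw HH (\<lambda>z2 z3.
      pt (S z2) (S (S z \<otimes>\<^bsub>H\<^esub> b1) \<otimes>\<^bsub>H\<^esub> z3)) (S u \<otimes>\<^bsub>H\<^esub> v)) b) a"
    by (intro sw_antipode) simp_all
  also have "\<dots> = sw HH (\<lambda>u z. sw HH (\<lambda>b1 v. sw HH (\<lambda>r s. sw HH (\<lambda>b2 b3.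
      pt (S (r \<otimes>\<^bsub>H\<^esub> b2)) (S (S z \<otimes>\<^bsub>H\<^esub> b1) \<otimes>\<^bsub>H\<^esub> (s \<otimes>\<^bsub>H\<^esub> b3))) v) (S u)) b) a"
    by (intro sw_cong[OF refl] sw_mult) simp_all
  also have "\<dots> = sw HH (\<lambda>u z. sw HH (\<lambda>b1 v. sw HH (\<lambda>x y. sw HH (\<lambda>b2 b3.
      pt (S (S y \<otimes>\<^bsub>H\<^esub> b2)) (S (S z \<otimes>\<^bsub>H\<^esub> b1) \<otimes>\<^bsub>H\<^esub> (S x \<otimes>\<^bsub>H\<^esub> b3))) v) u) b) a"
    by (intro sw_cong[OF refl] sw_antipode) simp_all
  also have "\<dots> = sw HH (\<lambda>u z. sw HH (\<lambda>x y. sw HH (\<lambda>b1 v. sw HH (\<lambda>b2 b3.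
      pt (S (S y \<otimes>\<^bsub>H\<^esub> b2)) (S (S z \<otimes>\<^bsub>H\<^esub> b1) \<otimes>\<^bsub>H\<^esub> (S x \<otimes>\<^bsub>H\<^esub> b3))) v) b) u) a"
    by (intro sw_cong[OF refl] sw_swap[OF comultiplication_axioms]) simp_all
  also have "\<dots> = sw HH (\<lambda>x w. sw HH (\<lambda>y z. sw HH (\<lambda>b1 v. sw HH (\<lambda>b2 b3.
      pt (S (S y \<otimes>\<^bsub>H\<^esub> b2)) (S (S z \<otimes>\<^bsub>H\<^esub> b1) \<otimes>\<^bsub>H\<^esub> (S x \<otimes>\<^bsub>H\<^esub> b3))) v) b) w) a"
    by (intro sw_coassoc) simp_all
  also have "\<dots> = sw HH (\<lambda>x w. sw HH (\<lambda>y z. ?Y x \<one>\<^bsub>H\<^esub> y z) w) a"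
    by (intro sw_cong[OF refl]) simp_all
  finally have 2: "tensor_to_smash (sect2 (S a \<otimes>\<^bsub>H\<^esub> b)) = sw HH (\<lambda>x w. sw HH (\<lambda>y z. ?Y x \<one>\<^bsub>H\<^esub> y z) w) a" .
  have "P2 K H comult S (pt a b) = sw HH (\<lambda>a1 w1. sw HH (\<lambda>a2 w2. sw HH (\<lambda>a3 w3. sw HH (\<lambda>a4 a5.
      sw HH (\<lambda>b1 v. sw HH (\<lambda>b2 b3. pt (S (a2 \<otimes>\<^bsub>H\<^esub> S a4 \<otimes>\<^bsub>H\<^esub> b2) \<otimes>\<^bsub>H\<^esub> a3)
        (S (a1 \<otimes>\<^bsub>H\<^esub> S a5 \<otimes>\<^bsub>H\<^esub> b1) \<otimes>\<^bsub>H\<^esub> b3)) v) b) w3) w2) w1) a"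
    unfolding P2_def Let_def sweedler5_def sweedler4_def sweedler3_def by (simp add: tensor_lift_pure_tensor)
  \<comment> \<open>Antimultiplicativity of the antipode brings \<open>S(a2)\<close> next to
    \<open>a3\<close> in the first factor, and splits off \<open>S(a1)\<close> in the
    second.\<close>
  also have "\<dots> = sw HH (\<lambda>a1 w1. sw HH (\<lambda>a2 w2. sw HH (\<lambda>a3 w3. sw HH (\<lambda>a4 a5.
      ?Y a1 (S a2 \<otimes>\<^bsub>H\<^esub> a3) a4 a5) w3) w2) w1) a"
    by (intro sw_cong[OF refl]) (simp_all add: antipode_mult H.m_assoc)
  \<comment> \<open>The legs \<open>a2\<close> and \<open>a3\<close> become those of one element
    \<open>m\<close>, so that the antipode axiom applies to the slot \<open>p\<close>.\<close>
  also have "\<dots> = sw HH (\<lambda>a1 w1. sw HH (\<lambda>m w3. sw HH (\<lambda>a2 a3. sw HH (\<lambda>a4 a5.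
      ?Y a1 (S a2 \<otimes>\<^bsub>H\<^esub> a3) a4 a5) w3) m) w1) a"
    by (intro sw_cong[OF refl] sw_coassoc[symmetric]) simp_all
  also have "\<dots> = sw HH (\<lambda>a1 w1. sw HH (\<lambda>m w3. counit m \<odot>\<^bsub>HH\<^esub> sw HH (\<lambda>a4 a5. ?Y a1 \<one>\<^bsub>H\<^esub> a4 a5) w3) w1) a"
  proof (intro sw_cong[OF refl])
    fix a1 w1 m w3 assume [simp]: "a1 \<in> carrier H" "m \<in> carrier H" "w3 \<in> carrier H"
    let ?Z = "\<lambda>p. sw HH (\<lambda>a4 a5. ?Y a1 p a4 a5) w3"
    have Z: "linear_map K H HH ?Z" by simp
    have "sw HH (\<lambda>a2 a3. ?Z (S a2 \<otimes>\<^bsub>H\<^esub> a3)) m = ?Z (sw H (\<lambda>a2 a3. S a2 \<otimes>\<^bsub>H\<^esub> a3) m)"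
      by (rule linear_sw[OF _ _ Z, symmetric]) simp_all
    also have "\<dots> = counit m \<odot>\<^bsub>HH\<^esub> ?Z \<one>\<^bsub>H\<^esub>"
      using linear_map_smult[OF Z, of "counit m" "\<one>\<^bsub>H\<^esub>"] by (simp add: antipode_left)
    finally show "sw HH (\<lambda>a2 a3. ?Z (S a2 \<otimes>\<^bsub>H\<^esub> a3)) m = counit m \<odot>\<^bsub>HH\<^esub> ?Z \<one>\<^bsub>H\<^esub>" .
  qed simp_all
  also have "\<dots> = sw HH (\<lambda>x w. sw HH (\<lambda>y z. ?Y x \<one>\<^bsub>H\<^esub> y z) w) a"
    by (intro sw_cong[OF refl] sw_counit_left linear_sw_arg) simp_all
  finally show "P2 K H comult S (pt a b) = tensor_to_smash (sect2 (proj2 (smash_to_tensor (pt a b))))"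
    by (simp only: 1 2)
qed simp_all

lemma idempotent_rota_baxter_smash:
  "idempotent_rota_baxter_coalgebra K HH (smash_comult K H comult S) (smash_counit K counit)
    (P1 K H counit) (\<ominus>\<^bsub>K\<^esub> \<one>\<^bsub>K\<^esub>)"
  "idempotent_rota_baxter_coalgebra K HH (smash_comult K H comult S) (smash_counit K counit)
    (P2 K H comult S) (\<ominus>\<^bsub>K\<^esub> \<one>\<^bsub>K\<^esub>)"
  by (intro smash.idempotent_rota_baxter_transport[OF rota_baxter_sect1] P1_eq
      smash.idempotent_rota_baxter_transport[OF rota_baxter_sect2] P2_eq; assumption)+

end

theorem proposition2p6:
  fixes K :: "('k, 'm) ring_scheme" and H :: "('k, 'h, 'n) module_scheme"
    and \<Delta> :: "'h \<Rightarrow> ('h \<times> 'h \<Rightarrow> 'k) set" and \<epsilon> :: "'h \<Rightarrow> 'k" and S :: "'h \<Rightarrow> 'h"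
  assumes "field K"
    and "\<forall>n::nat. n > 0 \<longrightarrow> [n] \<cdot>\<^bsub>K\<^esub> \<one>\<^bsub>K\<^esub> \<noteq> \<zero>\<^bsub>K\<^esub>"
    and "hopf_algebra K H \<Delta> \<epsilon> S"
  shows "idempotent_rota_baxter_coalgebra K (tensor K H H)
           (smash_comult K H \<Delta> S) (smash_counit K \<epsilon>) (P1 K H \<epsilon>) (\<ominus>\<^bsub>K\<^esub> \<one>\<^bsub>K\<^esub>) \<and>
         idempotent_rota_baxter_coalgebra K (tensor K H H)
           (smash_comult K H \<Delta> S) (smash_counit K \<epsilon>) (P2 K H \<Delta> S) (\<ominus>\<^bsub>K\<^esub> \<one>\<^bsub>K\<^esub>)"
  using assms(3) by (intro conjI hopf_algebra.idempotent_rota_baxter_smash)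

end
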